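(* Let $R$ be a Gorenstein local ring and let $x \in \mathrm{ca}(R)$ be a nonzerodivisor. Then the function $\pi : \mathfrak{CM}(R) \to \mathfrak{CM}(R/xR)$ defined by $M \mapsto M/xM$ is continuous.
   Context: All rings are commutative Noetherian and all modules are finitely generated. For a Gorenstein ring $R$, $\underline{\mathrm{MCM}}(R)$ is the stable category of maximal Cohen-Macaulay $R$-modules, with morphisms $\underline{\mathrm{Hom}}_R(M,N) = \mathrm{Hom}_R(M,N)/P(M,N)$, where $P(M,N)$ is the submodule of maps factoring through a projective module (the zero module counts as maximal Cohen-Macaulay). The stable annihilator of $M$ is $\underline{\mathrm{ann}}_R M = \mathrm{ann}_R\, \underline{\mathrm{End}}_R(M)$, and the cohomology annihilator ideal is $\mathrm{ca}(R) = \bigcap_{M} \underline{\mathrm{ann}}_R M$ over all maximal Cohen-Macaulay $R$-modules $M$. $\mathfrak{CM}(R)$ is the set of isomorphism classes of maximal Cohen-Macaulay $R$-modules with the topology in which a subset $U$ is closed if and only if $U = \bigcup_{M \in U}\mathrm{cl}(M)$, where $\mathrm{cl}(M) = \{L : \underline{\mathrm{ann}}_R L \subseteq \underline{\mathrm{ann}}_R M\}$. *)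

theory Defs
  imports
    "HOL-Library.Extended_Nat"
    "HOL-Analysis.Abstract_Topology"
    "HOL-Algebra.Ring_Divisibility"
    "HOL-Algebra.Module"
begin

section \<open>Modules, homomorphisms and quotients\<close>

definition regular_module :: "('a, 'b) ring_scheme \<Rightarrow> ('a, 'a) module" where
  "regular_module R = \<lparr>carrier = carrier R, mult = mult R, one = one R,
     zero = zero R, add = add R, smult = mult R\<rparr>"

definition module_span :: "('a, 'b) ring_scheme \<Rightarrow> ('a, 'm) module \<Rightarrow> 'm set \<Rightarrow> 'm set" where
  "module_span R M S = \<Inter>{N. submodule N R M \<and> S \<subseteq> N}"

definition fg_module :: "('a, 'b) ring_scheme \<Rightarrow> ('a, 'm) module \<Rightarrow> bool" where
  "fg_module R M \<longleftrightarrow> Module.module R M \<and>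
     (\<exists>S. finite S \<and> S \<subseteq> carrier M \<and> module_span R M S = carrier M)"

text \<open>Homomorphisms are extensional, so that equality of homomorphisms is equality in HOL
  and they form a module under the pointwise operations.\<close>

definition module_hom ::
  "('a, 'b) ring_scheme \<Rightarrow> ('a, 'm) module \<Rightarrow> ('a, 'n) module \<Rightarrow> ('m \<Rightarrow> 'n) set" where
  "module_hom R M N = {f \<in> carrier M \<rightarrow>\<^sub>E carrier N.
     (\<forall>x\<in>carrier M. \<forall>y\<in>carrier M. f (x \<oplus>\<^bsub>M\<^esub> y) = f x \<oplus>\<^bsub>N\<^esub> f y) \<and>
     (\<forall>r\<in>carrier R. \<forall>x\<in>carrier M. f (r \<odot>\<^bsub>M\<^esub> x) = r \<odot>\<^bsub>N\<^esub> f x)}"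

definition module_iso ::
  "('a, 'b) ring_scheme \<Rightarrow> ('a, 'm) module \<Rightarrow> ('a, 'n) module \<Rightarrow> bool" where
  "module_iso R M N \<longleftrightarrow> (\<exists>f\<in>module_hom R M N. bij_betw f (carrier M) (carrier N))"

text \<open>The fields \<open>mult\<close> and \<open>one\<close> of a module record carry no meaning.\<close>

definition hom_module ::
  "('a, 'b) ring_scheme \<Rightarrow> ('a, 'm) module \<Rightarrow> ('a, 'n) module \<Rightarrow> ('a, 'm \<Rightarrow> 'n) module" where
  "hom_module R M N = \<lparr>carrier = module_hom R M N, mult = undefined, one = undefined,
     zero = (\<lambda>x\<in>carrier M. \<zero>\<^bsub>N\<^esub>),
     add = (\<lambda>f g. \<lambda>x\<in>carrier M. f x \<oplus>\<^bsub>N\<^esub> g x),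
     smult = (\<lambda>r f. \<lambda>x\<in>carrier M. r \<odot>\<^bsub>N\<^esub> f x)\<rparr>"

definition quot_module :: "('a, 'm) module \<Rightarrow> 'm set \<Rightarrow> ('a, 'm set) module" where
  "quot_module M N = \<lparr>carrier = a_rcosets\<^bsub>M\<^esub> N, mult = undefined, one = undefined,
     zero = N, add = set_add M,
     smult = (\<lambda>r A. \<Union>a\<in>A. N +>\<^bsub>M\<^esub> (r \<odot>\<^bsub>M\<^esub> a))\<rparr>"

text \<open>\<open>M/xM\<close> as a module over \<open>R/xR\<close>; the scalars are cosets, acting in the style of
  \<^const>\<open>rcoset_mult\<close>.\<close>

definition reduction :: "('a, 'm) module \<Rightarrow> 'a \<Rightarrow> ('a set, 'm set) module" where
  "reduction M x = (let N = (\<lambda>m. x \<odot>\<^bsub>M\<^esub> m) ` carrier M in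
     \<lparr>carrier = a_rcosets\<^bsub>M\<^esub> N, mult = undefined, one = undefined,
      zero = N, add = set_add M,
      smult = (\<lambda>A B. \<Union>a\<in>A. \<Union>b\<in>B. N +>\<^bsub>M\<^esub> (a \<odot>\<^bsub>M\<^esub> b))\<rparr>)"

definition module_ann :: "('a, 'b) ring_scheme \<Rightarrow> ('a, 'm) module \<Rightarrow> 'a set" where
  "module_ann R M = {r \<in> carrier R. \<forall>m\<in>carrier M. r \<odot>\<^bsub>M\<^esub> m = \<zero>\<^bsub>M\<^esub>}"


section \<open>A universe of modules\<close>

text \<open>Every finitely generated module over a ring with elements in \<open>'a\<close> is a quotient of some
  \<open>R\<^sup>n\<close>, hence isomorphic to a module with elements in the following type
  (lemma \<open>fg_module_in_universe\<close> below). Wherever one has to quantify over modules inside a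
  definition, the quantifier ranges over modules with elements in this type.\<close>

type_synonym 'a univ = "(nat \<Rightarrow> 'a) set"

lemma module_transport:
  fixes R :: "('a, 'b) ring_scheme" and M :: "('a, 'm) module" and h :: "'m \<Rightarrow> 'n"
  assumes M: "Module.module R M" and inj: "inj_on h (carrier M)"
  shows "\<exists>N :: ('a, 'n) module. Module.module R N \<and> module_iso R M N"
proof -
  interpret M: Module.module R M by (rule M)
  define k where "k = inv_into (carrier M) h"
  have kh [simp]: "k (h m) = m" if "m \<in> carrier M" for m
    unfolding k_def using inj that by (rule inv_into_f_f)
  define N :: "('a, 'n) module" where
    "N = \<lparr>carrier = h ` carrier M, mult = undefined, one = undefined, zero = h \<zero>\<^bsub>M\<^esub>,
       add = (\<lambda>a b. h (k a \<oplus>\<^bsub>M\<^esub> k b)), smult = (\<lambda>r a. h (r \<odot>\<^bsub>M\<^esub> k a))\<rparr>"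
  have grp: "abelian_group N"
  proof (rule abelian_groupI)
    fix a assume "a \<in> carrier N"
    then obtain m where m: "m \<in> carrier M" "a = h m" by (auto simp: N_def)
    show "\<exists>b\<in>carrier N. b \<oplus>\<^bsub>N\<^esub> a = \<zero>\<^bsub>N\<^esub>"
      by (rule bexI[of _ "h (\<ominus>\<^bsub>M\<^esub> m)"]) (use m in \<open>auto simp: N_def M.M.l_neg\<close>)
  qed (auto simp: N_def M.M.a_ac)
  have "Module.module R N"
  proof (rule Module.moduleI)
    show "cring R" by (rule M.R.is_cring)
  qed (use grp in \<open>auto simp: N_def M.smult_l_distr M.smult_r_distr M.smult_assoc1\<close>)
  moreover have "restrict h (carrier M) \<in> module_hom R M N"
    by (auto simp: module_hom_def N_def)
  moreover have "bij_betw (restrict h (carrier M)) (carrier M) (carrier N)"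
    using inj by (auto simp: bij_betw_def N_def inj_on_def)
  ultimately show ?thesis unfolding module_iso_def by blast
qed

lemma fg_module_in_universe:
  fixes R :: "('a, 'b) ring_scheme" and M :: "('a, 'm) module"
  assumes "fg_module R M"
  shows "\<exists>N :: ('a, 'a univ) module. Module.module R N \<and> module_iso R M N"
proof -
  from assms obtain S where M: "Module.module R M" and S: "finite S" "S \<subseteq> carrier M"
    and gen: "module_span R M S = carrier M"
    by (auto simp: fg_module_def)
  interpret M: Module.module R M by (rule M)
  obtain e :: "'m \<Rightarrow> nat" where e: "inj_on e S"
    using finite_imp_inj_to_nat_seg[OF S(1)] by blast
  define lc where "lc = (\<lambda>c :: nat \<Rightarrow> 'a. \<Oplus>\<^bsub>M\<^esub>s\<in>S. c (e s) \<odot>\<^bsub>M\<^esub> s)"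
  define C where "C = {c :: nat \<Rightarrow> 'a. \<forall>i. c i \<in> carrier R}"
  have fn: "(\<lambda>s. c (e s) \<odot>\<^bsub>M\<^esub> s) \<in> S \<rightarrow> carrier M" if "c \<in> C" for c
    using that S by (auto simp: C_def)
  have lc_in: "lc c \<in> carrier M" if "c \<in> C" for c
    unfolding lc_def by (rule M.M.finsum_closed[OF fn[OF that]])
  have sub: "submodule (lc ` C) R M"
  proof (rule M.submoduleI)
    show "lc ` C \<subseteq> carrier M" using lc_in by blast
    have "lc (\<lambda>_. \<zero>\<^bsub>R\<^esub>) = (\<Oplus>\<^bsub>M\<^esub>s\<in>S. \<zero>\<^bsub>M\<^esub>)"
      unfolding lc_def by (rule M.M.finsum_cong') (use S in auto)
    then show "\<zero>\<^bsub>M\<^esub> \<in> lc ` C"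
      by (auto intro!: image_eqI[of _ _ "\<lambda>_. \<zero>\<^bsub>R\<^esub>"] simp: C_def)
    show sm: "r \<odot>\<^bsub>M\<^esub> m \<in> lc ` C" if "r \<in> carrier R" "m \<in> lc ` C" for r m
    proof -
      from that obtain c where c: "c \<in> C" "m = lc c" by blast
      have "r \<odot>\<^bsub>M\<^esub> lc c = (\<Oplus>\<^bsub>M\<^esub>s\<in>S. r \<odot>\<^bsub>M\<^esub> (c (e s) \<odot>\<^bsub>M\<^esub> s))"
        unfolding lc_def by (rule M.finsum_smult_ldistr[OF S(1) that(1) fn[OF c(1)]])
      also have "\<dots> = lc (\<lambda>i. r \<otimes>\<^bsub>R\<^esub> c i)"
        unfolding lc_def
        by (rule M.M.finsum_cong') (use S c that in \<open>auto simp: C_def M.smult_assoc1\<close>)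
      finally show ?thesis using c that by (auto simp: C_def)
    qed
    show "m \<oplus>\<^bsub>M\<^esub> n \<in> lc ` C" if mn: "m \<in> lc ` C" "n \<in> lc ` C" for m n
    proof -
      from mn obtain c d where c: "c \<in> C" "m = lc c" and d: "d \<in> C" "n = lc d" by blast
      have "lc c \<oplus>\<^bsub>M\<^esub> lc d = (\<Oplus>\<^bsub>M\<^esub>s\<in>S. c (e s) \<odot>\<^bsub>M\<^esub> s \<oplus>\<^bsub>M\<^esub> d (e s) \<odot>\<^bsub>M\<^esub> s)"
        unfolding lc_def by (rule M.M.finsum_addf[OF fn[OF c(1)] fn[OF d(1)], symmetric])
      also have "\<dots> = lc (\<lambda>i. c i \<oplus>\<^bsub>R\<^esub> d i)"
        unfolding lc_def
        by (rule M.M.finsum_cong') (use S c d in \<open>auto simp: C_def M.smult_l_distr\<close>)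
      finally show ?thesis using c d by (auto simp: C_def)
    qed
    show "\<ominus>\<^bsub>M\<^esub> m \<in> lc ` C" if "m \<in> lc ` C" for m
    proof -
      have m: "m \<in> carrier M" using that lc_in by blast
      have "\<ominus>\<^bsub>M\<^esub> m = (\<ominus>\<^bsub>R\<^esub> \<one>\<^bsub>R\<^esub>) \<odot>\<^bsub>M\<^esub> m"
        using m by (simp add: M.smult_l_minus)
      then show ?thesis using sm[of "\<ominus>\<^bsub>R\<^esub> \<one>\<^bsub>R\<^esub>" m] that by simp
    qed
  qed
  have "S \<subseteq> lc ` C"
  proof
    fix t assume t: "t \<in> S"
    define c where "c = (\<lambda>i. if i = e t then \<one>\<^bsub>R\<^esub> else \<zero>\<^bsub>R\<^esub>)"
    have "lc c = (\<Oplus>\<^bsub>M\<^esub>s\<in>S. if t = s then s else \<zero>\<^bsub>M\<^esub>)"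
      unfolding lc_def
      by (rule M.M.finsum_cong') (use S t e in \<open>auto simp: c_def inj_on_def\<close>)
    also have "\<dots> = t"
      by (rule M.M.add.finprod_singleton[OF t S(1), of "\<lambda>s. s"]) (use S in auto)
    finally show "t \<in> lc ` C" by (auto simp: C_def c_def intro!: image_eqI[of _ _ c])
  qed
  with sub gen have surj: "carrier M \<subseteq> lc ` C" by (auto simp: module_span_def)
  have "inj_on (\<lambda>m. {c \<in> C. lc c = m}) (carrier M)"
    using surj by (fastforce simp: inj_on_def)
  from module_transport[OF M this] show ?thesis .
qed


section \<open>Projective and injective modules\<close>

text \<open>Lifting and extension properties are tested on modules from the universe. For a finitely
  generated \<open>P\<close> it suffices to lift along one surjection from some \<open>R\<^sup>n\<close> onto \<open>P\<close>, and for
  injectivity it suffices, by Baer's criterion, to extend from ideals to \<open>R\<close>. So these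
  are the usual notions.\<close>

definition projective_module :: "('a, 'b) ring_scheme \<Rightarrow> ('a, 'm) module \<Rightarrow> bool" where
  "projective_module R P \<longleftrightarrow> Module.module R P \<and>
     (\<forall>(A :: ('a, 'a univ) module) (B :: ('a, 'a univ) module).
        Module.module R A \<longrightarrow> Module.module R B \<longrightarrow>
        (\<forall>g\<in>module_hom R A B. \<forall>f\<in>module_hom R P B. g ` carrier A = carrier B \<longrightarrow>
           (\<exists>h\<in>module_hom R P A. \<forall>p\<in>carrier P. g (h p) = f p)))"

definition injective_module :: "('a, 'b) ring_scheme \<Rightarrow> ('a, 'm) module \<Rightarrow> bool" where
  "injective_module R I \<longleftrightarrow> Module.module R I \<and>
     (\<forall>(A :: ('a, 'a univ) module) (B :: ('a, 'a univ) module).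
        Module.module R A \<longrightarrow> Module.module R B \<longrightarrow>
        (\<forall>g\<in>module_hom R A B. \<forall>f\<in>module_hom R A I. inj_on g (carrier A) \<longrightarrow>
           (\<exists>h\<in>module_hom R B I. \<forall>a\<in>carrier A. h (g a) = f a)))"


section \<open>Gorenstein local rings and maximal Cohen-Macaulay modules\<close>

definition local_ring :: "('a, 'b) ring_scheme \<Rightarrow> bool" where
  "local_ring R \<longleftrightarrow> cring R \<and> (\<exists>!m. maximalideal m R)"

definition max_ideal :: "('a, 'b) ring_scheme \<Rightarrow> 'a set" where
  "max_ideal R = (THE m. maximalideal m R)"

text \<open>An injective resolution \<open>0 \<rightarrow> M \<rightarrow> I\<^sup>0 \<rightarrow> I\<^sup>1 \<rightarrow> \<dots>\<close> whose terms vanish in degrees above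
  some \<open>n\<close>. The terms may be taken in the universe: let \<open>\<kappa>\<close> be the larger of \<open>|R|\<close> and
  \<open>\<aleph>\<^sub>0\<close>. A module \<open>X\<close> with \<open>|X| \<le> 2\<^sup>\<kappa>\<close> embeds into an injective module
  \<open>Hom\<^sub>\<int>(R, D)\<close> with \<open>D\<close> a divisible group of cardinality at most \<open>2\<^sup>\<kappa>\<close>, which has cardinality at
  most \<open>2\<^sup>\<kappa>\<close> again, and \<open>'a univ\<close> has at least \<open>2\<^sup>\<kappa>\<close> elements if \<open>R\<close> is nonzero.\<close>

definition finite_inj_dim :: "('a, 'b) ring_scheme \<Rightarrow> ('a, 'm) module \<Rightarrow> bool" where
  "finite_inj_dim R M \<longleftrightarrow>
     (\<exists>(I :: nat \<Rightarrow> ('a, 'a univ) module) \<epsilon> d n.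
        (\<forall>i. injective_module R (I i)) \<and>
        \<epsilon> \<in> module_hom R M (I 0) \<and> inj_on \<epsilon> (carrier M) \<and>
        (\<forall>i. d i \<in> module_hom R (I i) (I (Suc i))) \<and>
        \<epsilon> ` carrier M = {a \<in> carrier (I 0). d 0 a = \<zero>\<^bsub>I 1\<^esub>} \<and>
        (\<forall>i. d i ` carrier (I i) = {a \<in> carrier (I (Suc i)). d (Suc i) a = \<zero>\<^bsub>I (Suc (Suc i))\<^esub>}) \<and>
        (\<forall>i>n. carrier (I i) = {\<zero>\<^bsub>I i\<^esub>}))"

definition gorenstein_local_ring :: "('a, 'b) ring_scheme \<Rightarrow> bool" where
  "gorenstein_local_ring R \<longleftrightarrow>
     local_ring R \<and> noetherian_ring R \<and> finite_inj_dim R (regular_module R)"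

definition krull_dim :: "('a, 'b) ring_scheme \<Rightarrow> enat" where
  "krull_dim R = Sup {enat n | n. \<exists>P :: nat \<Rightarrow> 'a set.
     (\<forall>i\<le>n. primeideal (P i) R) \<and> (\<forall>i<n. P i \<subset> P (Suc i))}"

definition ideal_mult :: "('a, 'b) ring_scheme \<Rightarrow> 'a set \<Rightarrow> ('a, 'm) module \<Rightarrow> 'm set" where
  "ideal_mult R J M = module_span R M {a \<odot>\<^bsub>M\<^esub> m | a m. a \<in> J \<and> m \<in> carrier M}"

definition nonzerodivisor_on :: "('a, 'm) module \<Rightarrow> 'a \<Rightarrow> bool" where
  "nonzerodivisor_on M x \<longleftrightarrow> (\<forall>m\<in>carrier M. x \<odot>\<^bsub>M\<^esub> m = \<zero>\<^bsub>M\<^esub> \<longrightarrow> m = \<zero>\<^bsub>M\<^esub>)"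

definition regular_sequence :: "('a, 'b) ring_scheme \<Rightarrow> ('a, 'm) module \<Rightarrow> 'a list \<Rightarrow> bool" where
  "regular_sequence R M xs \<longleftrightarrow> set xs \<subseteq> carrier R \<and>
     (\<forall>i<length xs.
        nonzerodivisor_on (quot_module M (ideal_mult R (Idl\<^bsub>R\<^esub> (set (take i xs))) M)) (xs ! i)) \<and>
     ideal_mult R (Idl\<^bsub>R\<^esub> (set xs)) M \<noteq> carrier M"

definition depth :: "('a, 'b) ring_scheme \<Rightarrow> ('a, 'm) module \<Rightarrow> enat" where
  "depth R M = Sup {enat (length xs) | xs. regular_sequence R M xs \<and> set xs \<subseteq> max_ideal R}"

text \<open>For a local ring \<open>R\<close>, and for the zero ring, over which only the zero module exists.\<close>

definition mcm :: "('a, 'b) ring_scheme \<Rightarrow> ('a, 'm) module \<Rightarrow> bool" where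
  "mcm R M \<longleftrightarrow> fg_module R M \<and> (carrier M = {\<zero>\<^bsub>M\<^esub>} \<or> depth R M = krull_dim R)"


section \<open>Stable annihilators\<close>

definition proj_maps ::
  "('a, 'b) ring_scheme \<Rightarrow> ('a, 'm) module \<Rightarrow> ('a, 'n) module \<Rightarrow> ('m \<Rightarrow> 'n) set" where
  "proj_maps R M N = {f \<in> module_hom R M N.
     \<exists>(P :: ('a, 'a univ) module) g h. fg_module R P \<and> projective_module R P \<and>
       g \<in> module_hom R M P \<and> h \<in> module_hom R P N \<and> (\<forall>m\<in>carrier M. f m = h (g m))}"

definition stable_hom ::
  "('a, 'b) ring_scheme \<Rightarrow> ('a, 'm) module \<Rightarrow> ('a, 'n) module \<Rightarrow> ('a, ('m \<Rightarrow> 'n) set) module" where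
  "stable_hom R M N = quot_module (hom_module R M N) (proj_maps R M N)"

definition stable_ann :: "('a, 'b) ring_scheme \<Rightarrow> ('a, 'm) module \<Rightarrow> 'a set" where
  "stable_ann R M = module_ann R (stable_hom R M M)"

definition coh_ann :: "('a, 'b) ring_scheme \<Rightarrow> 'a set" where
  "coh_ann R = \<Inter>{stable_ann R M | M :: ('a, 'a univ) module. mcm R M}"


section \<open>The space of maximal Cohen-Macaulay modules\<close>

definition iso_class ::
  "('a, 'b) ring_scheme \<Rightarrow> ('a, 'm) module \<Rightarrow> ('a, 'a univ) module set" where
  "iso_class R M = {N. Module.module R N \<and> module_iso R M N}"

definition CM :: "('a, 'b) ring_scheme \<Rightarrow> ('a, 'a univ) module set set" where
  "CM R = {iso_class R M | M :: ('a, 'a univ) module. mcm R M}"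

text \<open>Isomorphic modules have the same stable annihilator, so this is the common value on the
  class.\<close>

definition class_ann :: "('a, 'b) ring_scheme \<Rightarrow> ('a, 'a univ) module set \<Rightarrow> 'a set" where
  "class_ann R c = (\<Inter>M\<in>c. stable_ann R M)"

definition cm_cl ::
  "('a, 'b) ring_scheme \<Rightarrow> ('a, 'a univ) module set \<Rightarrow> ('a, 'a univ) module set set" where
  "cm_cl R c = {l \<in> CM R. class_ann R l \<subseteq> class_ann R c}"

definition cm_topology :: "('a, 'b) ring_scheme \<Rightarrow> ('a, 'a univ) module set topology" where
  "cm_topology R = topology (\<lambda>U. U \<subseteq> CM R \<and> CM R - U = (\<Union>c\<in>CM R - U. cm_cl R c))"

lemma openin_cm_topology:
  "openin (cm_topology R) U \<longleftrightarrow> U \<subseteq> CM R \<and> CM R - U = (\<Union>c\<in>CM R - U. cm_cl R c)"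
proof -
  have eq: "CM R - U = (\<Union>c\<in>CM R - U. cm_cl R c) \<longleftrightarrow>
      (\<forall>c\<in>CM R. \<forall>l\<in>CM R. l \<in> U \<longrightarrow> class_ann R l \<subseteq> class_ann R c \<longrightarrow> c \<in> U)" for U
    unfolding cm_cl_def by blast
  have "istopology (\<lambda>U. U \<subseteq> CM R \<and> CM R - U = (\<Union>c\<in>CM R - U. cm_cl R c))"
    unfolding eq istopology_def by blast
  then show ?thesis
    unfolding cm_topology_def by (simp add: topology_inverse')
qed

lemma topspace_cm_topology [simp]: "topspace (cm_topology R) = CM R"
proof -
  have "openin (cm_topology R) (CM R)" by (simp add: openin_cm_topology)
  then show ?thesis
    by (meson openin_cm_topology openin_subset openin_topspace subset_antisym)
qed

lemma closedin_cm_topology: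
  "closedin (cm_topology R) U \<longleftrightarrow> U \<subseteq> CM R \<and> U = (\<Union>c\<in>U. cm_cl R c)"
  by (auto simp: closedin_def openin_cm_topology double_diff)

text \<open>\<open>[M] \<mapsto> [M/xM]\<close>; the union does not depend on the representative, as all of them give the
  same class.\<close>

definition cm_reduction ::
  "('a, 'b) ring_scheme \<Rightarrow> 'a \<Rightarrow> ('a, 'a univ) module set \<Rightarrow> ('a set, 'a set univ) module set" where
  "cm_reduction R x c = (\<Union>M\<in>c. iso_class (R Quot (PIdl\<^bsub>R\<^esub> x)) (reduction M x))"

end

theory Submission
  imports Defs
begin

text \<open>
  For a nonzero maximal Cohen-Macaulay module \<open>M\<close>, every associated prime of \<open>M\<close> starts a chain of
  primes of length \<open>depth M = dim R\<close>, hence is minimal, so the regular element \<open>x\<close> avoids it and is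
  regular on \<open>M\<close>. Passing from \<open>M\<close> to \<open>M/xM\<close> lowers the depth by one (an exchange argument with a
  common nonzerodivisor obtained by prime avoidance), and passing from \<open>R\<close> to \<open>R/xR\<close> lowers the
  dimension by at least one; as depth is bounded by dimension, \<open>M/xM\<close> is again maximal
  Cohen-Macaulay. Only the Noetherian local structure of \<open>R\<close> enters here.

  An element \<open>r\<close> stably annihilates \<open>M\<close> iff \<open>r y = \<Sum>\<^sub>i \<phi>\<^sub>i(y) v\<^sub>i\<close> for finitely many linear forms
  \<open>\<phi>\<^sub>i\<close> and elements \<open>v\<^sub>i\<close>. Reducing modulo \<open>x\<close> shows that the stable annihilator of \<open>M/xM\<close> contains
  the image of that of \<open>M\<close>. Conversely let \<open>x y = \<Sum>\<^sub>k g\<^sub>k(y) h\<^sub>k\<close>, and let \<open>r\<close> act on \<open>M/xM\<close> as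
  \<open>\<Sum>\<^sub>j \<alpha>\<^sub>j l\<^sub>j\<close>. Lift \<open>\<alpha>\<^sub>j(h\<^sub>k)\<close> to \<open>s\<^sub>j\<^sub>k \<in> R\<close>. Then \<open>\<Sum>\<^sub>k g\<^sub>k(y) s\<^sub>j\<^sub>k\<close> lifts \<open>\<alpha>\<^sub>j(x y) = 0\<close>, so it is
  \<open>x a\<^sub>j(y)\<close> for a linear form \<open>a\<^sub>j\<close>, and \<open>\<Sum>\<^sub>j s\<^sub>j\<^sub>k l\<^sub>j = r h\<^sub>k + x \<epsilon>\<^sub>k\<close>; cancelling \<open>x\<close> gives
  \<open>r y = \<Sum>\<^sub>j a\<^sub>j(y) l\<^sub>j - \<Sum>\<^sub>k g\<^sub>k(y) \<epsilon>\<^sub>k\<close>. So the stable annihilators of \<open>M\<close> and \<open>M/xM\<close> determine each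
  other, and the preorder defining the topology is preserved.
\<close>

section \<open>Regular sequences on quotients of a fixed module\<close>

text \<open>The delicate point is the converse comparison of annihilators. A linear form on
  \<open>M/xM\<close> need not lift to \<open>M\<close>; the obstruction lies in Ext^1(M, R). The
  hypothesis on \<open>x\<close> is what gets round it: multiplication by \<open>x\<close> on
  \<open>M\<close> is a composite \<open>M -> R^n -> M\<close>, and the pullback of the form to
  \<open>R^n\<close> does lift because \<open>R^n\<close> is free. The error terms this produces
  again carry the coefficients \<open>g k\<close>, so they stay inside the sums of forms times
  vectors. Depth is a supremum over regular sequences, so a longest sequence must be replaced by an
  equally long one that starts with \<open>x\<close>. The socle comparison behind this is the
  elementary content of the fact that Hom(R/m, L/xL) and Hom(R/m, L/yL) are both Ext^1(R/m, L) when
  \<open>x\<close> and \<open>y\<close> are regular on \<open>L\<close>. The lower bound for the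
  dimension of \<open>R/xR\<close> is not taken from \<open>R\<close>: it comes from the regular
  sequence found on \<open>M/xM\<close>.\<close>

lemma (in Module.module) submodule_mem:
  assumes "submodule K R M"
  shows "\<And>a. a \<in> K \<Longrightarrow> a \<in> carrier M" "\<zero>\<^bsub>M\<^esub> \<in> K"
    and "\<And>a b. a \<in> K \<Longrightarrow> b \<in> K \<Longrightarrow> a \<oplus>\<^bsub>M\<^esub> b \<in> K"
    and "\<And>a. a \<in> K \<Longrightarrow> \<ominus>\<^bsub>M\<^esub> a \<in> K"
    and "\<And>a b. a \<in> K \<Longrightarrow> b \<in> K \<Longrightarrow> a \<ominus>\<^bsub>M\<^esub> b \<in> K"
    and "\<And>r a. r \<in> carrier R \<Longrightarrow> a \<in> K \<Longrightarrow> r \<odot>\<^bsub>M\<^esub> a \<in> K"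
proof -
  show z: "\<zero>\<^bsub>M\<^esub> \<in> K"
    using submodule.axioms(1)[OF assms] by (simp add: subgroup_def)
qed (use submoduleE[OF assms] in \<open>auto simp: a_minus_def\<close>)

lemma (in abelian_group) add_minus_cancel:
  assumes "a \<in> carrier G" "b \<in> carrier G"
  shows "a \<oplus> (b \<ominus> a) = b" "(b \<ominus> a) \<oplus> a = b" "a \<ominus> (a \<ominus> b) = b" "(a \<oplus> b) \<ominus> b = a"
proof -
  have "a \<oplus> (b \<ominus> a) = b \<oplus> (a \<oplus> \<ominus> a)"
    using assms unfolding a_minus_def by (intro a_lcomm) auto
  then show 1: "a \<oplus> (b \<ominus> a) = b" using assms by (simp add: r_neg)
  then show "(b \<ominus> a) \<oplus> a = b" using assms by (simp add: a_comm)
  have "(a \<oplus> b) \<ominus> b = a" using assms by (simp add: a_minus_def a_assoc r_neg)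
  then show "(a \<oplus> b) \<ominus> b = a" .
  have "\<ominus> (a \<ominus> b) = b \<ominus> a" using assms by (simp add: a_minus_def minus_add a_comm)
  then show "a \<ominus> (a \<ominus> b) = b" using 1 by (simp add: a_minus_def)
qed

lemma (in Module.module) submodule_add_cancel:
  assumes "submodule K R M" "a \<in> K" "b \<in> carrier M" "a \<oplus>\<^bsub>M\<^esub> b \<in> K"
  shows "b \<in> K"
proof -
  note K = submodule_mem[OF assms(1)]
  have "b = \<ominus>\<^bsub>M\<^esub> a \<oplus>\<^bsub>M\<^esub> (a \<oplus>\<^bsub>M\<^esub> b)"
    using K(1)[OF assms(2)] assms(3) by (simp add: M.r_neg1)
  then show ?thesis using K(3)[OF K(4)[OF assms(2)] assms(4)] by simp
qed

lemma (in Module.module) smult_r_diff: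
  "r \<in> carrier R \<Longrightarrow> a \<in> carrier M \<Longrightarrow> b \<in> carrier M \<Longrightarrow>
    r \<odot>\<^bsub>M\<^esub> (a \<ominus>\<^bsub>M\<^esub> b) = r \<odot>\<^bsub>M\<^esub> a \<ominus>\<^bsub>M\<^esub> r \<odot>\<^bsub>M\<^esub> b"
  by (simp add: a_minus_def smult_r_distr smult_r_minus)

lemma (in Module.module) smult_l_diff:
  "r \<in> carrier R \<Longrightarrow> s \<in> carrier R \<Longrightarrow> a \<in> carrier M \<Longrightarrow>
    (r \<ominus>\<^bsub>R\<^esub> s) \<odot>\<^bsub>M\<^esub> a = r \<odot>\<^bsub>M\<^esub> a \<ominus>\<^bsub>M\<^esub> s \<odot>\<^bsub>M\<^esub> a"
  by (simp add: a_minus_def smult_l_distr smult_l_minus)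

lemma (in Module.module) smult_commute:
  "r \<in> carrier R \<Longrightarrow> s \<in> carrier R \<Longrightarrow> a \<in> carrier M \<Longrightarrow>
    r \<odot>\<^bsub>M\<^esub> (s \<odot>\<^bsub>M\<^esub> a) = s \<odot>\<^bsub>M\<^esub> (r \<odot>\<^bsub>M\<^esub> a)"
  by (metis smult_assoc1 R.m_comm)

text \<open>Instead of \<open>M/K\<close>, \<open>M/(K + yM)\<close> etc., which have different types, submodules \<open>K\<close> of one fixed
  module \<open>M\<close> are used throughout: \<open>nzd M K y\<close> and \<open>regseq M K ys\<close> are statements about \<open>M/K\<close>.\<close>

definition addm :: "('a, 'm, 'c) module_scheme \<Rightarrow> 'm set \<Rightarrow> 'a \<Rightarrow> 'm set" where
  "addm M K y = {k \<oplus>\<^bsub>M\<^esub> y \<odot>\<^bsub>M\<^esub> m | k m. k \<in> K \<and> m \<in> carrier M}"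

definition nzd :: "('a, 'm, 'c) module_scheme \<Rightarrow> 'm set \<Rightarrow> 'a \<Rightarrow> bool" where
  "nzd M K y \<longleftrightarrow> (\<forall>m\<in>carrier M. y \<odot>\<^bsub>M\<^esub> m \<in> K \<longrightarrow> m \<in> K)"

text \<open>The annihilator of the class of \<open>v\<close> in \<open>M/K\<close>. When it is prime
  and \<open>v\<close> lies outside \<open>K\<close>, it is an associated prime of
  \<open>M/K\<close>; such primes are always handled together with a witness
  \<open>v\<close>.\<close>

definition colon :: "('a, 'b) ring_scheme \<Rightarrow> ('a, 'm, 'c) module_scheme \<Rightarrow> 'm set \<Rightarrow> 'm \<Rightarrow> 'a set" where
  "colon R M K v = {r \<in> carrier R. r \<odot>\<^bsub>M\<^esub> v \<in> K}"

text \<open>Properness of the final quotient is kept apart from the recursion: for entries in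
  \<open>\<mm>\<close> and a proper \<open>K\<close> it follows from \<open>addm_proper\<close>, and
  \<open>depth_eq\<close> restores it that way. Entries are peeled off at the front and absorbed
  into \<open>K\<close>, which suits inductions that vary \<open>K\<close>.\<close>

primrec regseq :: "('a, 'm, 'c) module_scheme \<Rightarrow> 'm set \<Rightarrow> 'a list \<Rightarrow> bool" where
  "regseq M K [] = True"
| "regseq M K (y # ys) = (nzd M K y \<and> regseq M (addm M K y) ys)"

context Module.module
begin

lemma addm_memI:
  "k \<in> K \<Longrightarrow> m \<in> carrier M \<Longrightarrow> a = k \<oplus>\<^bsub>M\<^esub> y \<odot>\<^bsub>M\<^esub> m \<Longrightarrow> a \<in> addm M K y"
  by (auto simp: addm_def)

lemma addm_submodule:
  assumes K: "submodule K R M" and y: "y \<in> carrier R"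
  shows "submodule (addm M K y) R M"
proof (rule submoduleI)
  note Km = submodule_mem[OF K]
  show "addm M K y \<subseteq> carrier M" using Km y by (auto simp: addm_def)
  show "\<zero>\<^bsub>M\<^esub> \<in> addm M K y"
    using Km y by (intro addm_memI[of "\<zero>\<^bsub>M\<^esub>" _ "\<zero>\<^bsub>M\<^esub>"]) auto
  show "\<ominus>\<^bsub>M\<^esub> a \<in> addm M K y" if "a \<in> addm M K y" for a
  proof -
    from that obtain k m where "k \<in> K" "m \<in> carrier M" "a = k \<oplus>\<^bsub>M\<^esub> y \<odot>\<^bsub>M\<^esub> m"
      by (auto simp: addm_def)
    then show ?thesis using Km y
      by (intro addm_memI[of "\<ominus>\<^bsub>M\<^esub> k" _ "\<ominus>\<^bsub>M\<^esub> m"]) (auto simp: M.minus_add smult_r_minus)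
  qed
  show "a \<oplus>\<^bsub>M\<^esub> b \<in> addm M K y" if "a \<in> addm M K y" "b \<in> addm M K y" for a b
  proof -
    from that obtain k m k' m' where "k \<in> K" "m \<in> carrier M" "a = k \<oplus>\<^bsub>M\<^esub> y \<odot>\<^bsub>M\<^esub> m"
      "k' \<in> K" "m' \<in> carrier M" "b = k' \<oplus>\<^bsub>M\<^esub> y \<odot>\<^bsub>M\<^esub> m'" by (auto simp: addm_def)
    then show ?thesis using Km y
      by (intro addm_memI[of "k \<oplus>\<^bsub>M\<^esub> k'" _ "m \<oplus>\<^bsub>M\<^esub> m'"]) (auto simp: smult_r_distr M.a_ac)
  qed
  show "r \<odot>\<^bsub>M\<^esub> a \<in> addm M K y" if "r \<in> carrier R" "a \<in> addm M K y" for r a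
  proof -
    from that obtain k m where "k \<in> K" "m \<in> carrier M" "a = k \<oplus>\<^bsub>M\<^esub> y \<odot>\<^bsub>M\<^esub> m"
      by (auto simp: addm_def)
    then show ?thesis using Km y that(1)
      by (intro addm_memI[of "r \<odot>\<^bsub>M\<^esub> k" _ "r \<odot>\<^bsub>M\<^esub> m"]) (auto simp: smult_r_distr smult_commute[of r y])
  qed
qed

lemma addm_sup:
  assumes K: "submodule K R M" and y: "y \<in> carrier R"
  shows "K \<subseteq> addm M K y" "m \<in> carrier M \<Longrightarrow> y \<odot>\<^bsub>M\<^esub> m \<in> addm M K y"
proof -
  note Km = submodule_mem[OF K]
  show "K \<subseteq> addm M K y"
  proof
    fix k assume "k \<in> K"
    then show "k \<in> addm M K y"
      using Km y by (intro addm_memI[of k _ "\<zero>\<^bsub>M\<^esub>"]) auto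
  qed
  show "m \<in> carrier M \<Longrightarrow> y \<odot>\<^bsub>M\<^esub> m \<in> addm M K y"
    using Km y by (intro addm_memI[of "\<zero>\<^bsub>M\<^esub>" _ m]) auto
qed

lemma addm_least:
  assumes K: "submodule W R M" and "K \<subseteq> W" "\<And>m. m \<in> carrier M \<Longrightarrow> y \<odot>\<^bsub>M\<^esub> m \<in> W"
  shows "addm M K y \<subseteq> W"
  using submodule_mem[OF K] assms by (auto simp: addm_def)

lemma addm_commute:
  assumes K: "submodule K R M" and "y \<in> carrier R" "z \<in> carrier R"
  shows "addm M (addm M K y) z = addm M (addm M K z) y"
proof -
  have "addm M (addm M K y) z \<subseteq> addm M (addm M K z) y" if "y \<in> carrier R" "z \<in> carrier R" for y z
    using addm_submodule[OF K] addm_submodule that addm_sup addm_sup[OF K]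
    by (intro addm_least) (meson addm_submodule[OF K] addm_submodule addm_sup addm_sup[OF K] subsetD order_trans)+
  with assms show ?thesis by blast
qed

lemma colon_ideal:
  assumes K: "submodule K R M" and v: "v \<in> carrier M"
  shows "ideal (colon R M K v) R"
proof (rule idealI)
  note Km = submodule_mem[OF K]
  show "ring R" by (rule R.ring_axioms)
  show "subgroup (colon R M K v) (add_monoid R)"
  proof (rule R.add.subgroupI)
    have "\<zero>\<^bsub>R\<^esub> \<in> colon R M K v" using Km v by (simp add: colon_def)
    then show "colon R M K v \<noteq> {}" by blast
  qed (use Km v in \<open>auto simp: colon_def smult_l_distr smult_l_minus simp flip: a_inv_def\<close>)
  show "x \<otimes> a \<in> colon R M K v" if "a \<in> colon R M K v" "x \<in> carrier R" for a x
    using that Km v by (simp add: colon_def smult_assoc1)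
  then show "a \<otimes> x \<in> colon R M K v" if "a \<in> colon R M K v" "x \<in> carrier R" for a x
    using that by (metis (no_types, lifting) R.m_comm colon_def mem_Collect_eq)
qed

text \<open>One-generator enlargements drive two arguments: \<open>nakayama\<close> picks a maximal
  one, and \<open>wf_submodules_fg\<close> builds up the module by them.\<close>

definition adjoin :: "'c set \<Rightarrow> 'c \<Rightarrow> 'c set" where
  "adjoin K n = {k \<oplus>\<^bsub>M\<^esub> c \<odot>\<^bsub>M\<^esub> n | k c. k \<in> K \<and> c \<in> carrier R}"

lemma adjoin_memI:
  "k \<in> K \<Longrightarrow> c \<in> carrier R \<Longrightarrow> a = k \<oplus>\<^bsub>M\<^esub> c \<odot>\<^bsub>M\<^esub> n \<Longrightarrow> a \<in> adjoin K n"
  by (auto simp: adjoin_def)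

lemma adjoin_submodule:
  assumes K: "submodule K R M" and n: "n \<in> carrier M"
  shows "submodule (adjoin K n) R M" "K \<subseteq> adjoin K n" "n \<in> adjoin K n"
proof -
  note Km = submodule_mem[OF K]
  show "submodule (adjoin K n) R M"
  proof (rule submoduleI)
    show "adjoin K n \<subseteq> carrier M" using Km n by (auto simp: adjoin_def)
    show "\<zero>\<^bsub>M\<^esub> \<in> adjoin K n"
      using Km n by (intro adjoin_memI[of "\<zero>\<^bsub>M\<^esub>" _ "\<zero>\<^bsub>R\<^esub>"]) auto
    show "\<ominus>\<^bsub>M\<^esub> a \<in> adjoin K n" if "a \<in> adjoin K n" for a
    proof -
      from that obtain k c where "k \<in> K" "c \<in> carrier R" "a = k \<oplus>\<^bsub>M\<^esub> c \<odot>\<^bsub>M\<^esub> n"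
        by (auto simp: adjoin_def)
      then show ?thesis using Km n
        by (intro adjoin_memI[of "\<ominus>\<^bsub>M\<^esub> k" _ "\<ominus>\<^bsub>R\<^esub> c"]) (auto simp: M.minus_add smult_l_minus)
    qed
    show "a \<oplus>\<^bsub>M\<^esub> b \<in> adjoin K n" if "a \<in> adjoin K n" "b \<in> adjoin K n" for a b
    proof -
      from that obtain k m k' m' where "k \<in> K" "m \<in> carrier R" "a = k \<oplus>\<^bsub>M\<^esub> m \<odot>\<^bsub>M\<^esub> n"
        "k' \<in> K" "m' \<in> carrier R" "b = k' \<oplus>\<^bsub>M\<^esub> m' \<odot>\<^bsub>M\<^esub> n" by (auto simp: adjoin_def)
      then show ?thesis using Km n
        by (intro adjoin_memI[of "k \<oplus>\<^bsub>M\<^esub> k'" _ "m \<oplus>\<^bsub>R\<^esub> m'"]) (auto simp: smult_l_distr M.a_ac)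
    qed
    show "r \<odot>\<^bsub>M\<^esub> a \<in> adjoin K n" if "r \<in> carrier R" "a \<in> adjoin K n" for r a
    proof -
      from that obtain k m where "k \<in> K" "m \<in> carrier R" "a = k \<oplus>\<^bsub>M\<^esub> m \<odot>\<^bsub>M\<^esub> n"
        by (auto simp: adjoin_def)
      then show ?thesis using Km n that(1)
        by (intro adjoin_memI[of "r \<odot>\<^bsub>M\<^esub> k" _ "r \<otimes>\<^bsub>R\<^esub> m"]) (auto simp: smult_r_distr smult_assoc1)
    qed
  qed
  show "K \<subseteq> adjoin K n"
  proof
    fix k assume "k \<in> K"
    then show "k \<in> adjoin K n"
      using Km n by (intro adjoin_memI[of k _ "\<zero>\<^bsub>R\<^esub>"]) auto
  qed
  show "n \<in> adjoin K n"
    using Km n by (intro adjoin_memI[of "\<zero>\<^bsub>M\<^esub>" _ "\<one>\<^bsub>R\<^esub>"]) auto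
qed

text \<open>The purely formal half of permuting a regular pair. If \<open>y m = k + z m'\<close>,
  then \<open>z m'\<close> vanishes modulo \<open>K + yM\<close>, so \<open>m' = k' + y m''\<close>,
  and cancelling \<open>y\<close> in \<open>y (m - z m'') = k + z k'\<close> puts
  \<open>m - z m''\<close> into \<open>K\<close>.\<close>

lemma nzd_swap:
  assumes K: "submodule K R M" and y: "y \<in> carrier R" and z: "z \<in> carrier R"
    and "nzd M K y" and "nzd M (addm M K y) z"
  shows "nzd M (addm M K z) y"
  unfolding nzd_def
proof (intro ballI impI)
  fix m assume m: "m \<in> carrier M" and "y \<odot>\<^bsub>M\<^esub> m \<in> addm M K z"
  then obtain k m' where k: "k \<in> K" "m' \<in> carrier M" "y \<odot>\<^bsub>M\<^esub> m = k \<oplus>\<^bsub>M\<^esub> z \<odot>\<^bsub>M\<^esub> m'"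
    by (auto simp: addm_def)
  note Km = submodule_mem[OF K] and Ky = addm_submodule[OF K y]
  have "k \<oplus>\<^bsub>M\<^esub> z \<odot>\<^bsub>M\<^esub> m' \<in> addm M K y" using addm_sup[OF K y] m k(3) by metis
  then have "z \<odot>\<^bsub>M\<^esub> m' \<in> addm M K y"
    using submodule_add_cancel[OF Ky, of k "z \<odot>\<^bsub>M\<^esub> m'"] addm_sup[OF K y] k z by blast
  then have "m' \<in> addm M K y" using assms(5) k by (auto simp: nzd_def)
  then obtain k' m'' where k': "k' \<in> K" "m'' \<in> carrier M" "m' = k' \<oplus>\<^bsub>M\<^esub> y \<odot>\<^bsub>M\<^esub> m''"
    by (auto simp: addm_def)
  have "y \<odot>\<^bsub>M\<^esub> m = (k \<oplus>\<^bsub>M\<^esub> z \<odot>\<^bsub>M\<^esub> k') \<oplus>\<^bsub>M\<^esub> y \<odot>\<^bsub>M\<^esub> (z \<odot>\<^bsub>M\<^esub> m'')"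
    using k k' y z Km(1) by (simp add: smult_r_distr smult_commute[of z y] M.a_assoc)
  then have "y \<odot>\<^bsub>M\<^esub> (m \<ominus>\<^bsub>M\<^esub> z \<odot>\<^bsub>M\<^esub> m'') = k \<oplus>\<^bsub>M\<^esub> z \<odot>\<^bsub>M\<^esub> k'"
    using k k' y z m Km(1) by (simp add: smult_r_diff M.add_minus_cancel)
  moreover have "k \<oplus>\<^bsub>M\<^esub> z \<odot>\<^bsub>M\<^esub> k' \<in> K" "m \<ominus>\<^bsub>M\<^esub> z \<odot>\<^bsub>M\<^esub> m'' \<in> carrier M"
    using Km k(1) k'(1,2) m z by auto
  ultimately have "m \<ominus>\<^bsub>M\<^esub> z \<odot>\<^bsub>M\<^esub> m'' \<in> K"
    using assms(4) unfolding nzd_def by metis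
  moreover have "m = (m \<ominus>\<^bsub>M\<^esub> z \<odot>\<^bsub>M\<^esub> m'') \<oplus>\<^bsub>M\<^esub> z \<odot>\<^bsub>M\<^esub> m''"
    using m k' z by (simp add: M.add_minus_cancel)
  ultimately show "m \<in> addm M K z" using k' unfolding addm_def by blast
qed

lemma one_notin_colon:
  assumes K: "submodule K R M" and "v \<in> carrier M" "v \<notin> K"
  shows "\<one>\<^bsub>R\<^esub> \<notin> colon R M K v"
  using assms by (simp add: colon_def)

end

section \<open>Prime avoidance\<close>

lemma (in cring) prime_avoids_Int:
  assumes P: "primeideal P R" and "finite Q" and Q: "\<forall>I\<in>Q. ideal I R \<and> \<not> I \<subseteq> P"
    and J: "ideal J R" "\<not> J \<subseteq> P"
  shows "\<exists>w\<in>J. w \<notin> P \<and> (\<forall>I\<in>Q. w \<in> I)"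
  using assms(2) Q
proof (induction Q)
  case empty
  then show ?case using J by blast
next
  case (insert I Q)
  then obtain w where w: "w \<in> J" "w \<notin> P" "\<forall>I\<in>Q. w \<in> I" by auto
  obtain q where q: "q \<in> I" "q \<notin> P" using insert.prems by blast
  have c: "w \<in> carrier R" "q \<in> carrier R"
    using ideal.Icarr[OF J(1) w(1)] ideal.Icarr[of I R q] insert.prems q(1) by blast+
  \<comment> \<open>Multiplying by \<open>q\<close> keeps \<open>w\<close> in every ideal already
    met and adds \<open>I\<close> to them; the product stays outside \<open>P\<close> because
    \<open>P\<close> is prime.\<close>
  have "q \<otimes> w \<in> J" by (rule ideal.I_l_closed[OF J(1) w(1) c(2)])
  moreover have "q \<otimes> w \<in> L" if "L \<in> Q" for L
    by (rule ideal.I_l_closed[OF _ _ c(2)]) (use that insert.prems w in auto)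
  moreover have "q \<otimes> w \<in> I"
    using ideal.I_r_closed[of I R q w] q(1) c insert.prems by blast
  moreover have "q \<otimes> w \<notin> P" using primeideal.I_prime[OF P c(2,1)] w q by blast
  ultimately show ?case by auto
qed

lemma (in cring) prime_avoidance:
  assumes "finite \<P>" and "\<forall>P\<in>\<P>. primeideal P R \<and> \<not> J \<subseteq> P" and J: "ideal J R"
  shows "\<exists>z\<in>J. \<forall>P\<in>\<P>. z \<notin> P"
  using assms(1,2)
proof (induction \<P> rule: finite_psubset_induct)
  case (psubset \<P>)
  note pi = primeideal.axioms(1)
  show ?case
  proof (cases "\<exists>Q\<in>\<P>. \<exists>P\<in>\<P>. Q \<noteq> P \<and> Q \<subseteq> P")
    case True
    then obtain Q P where QP: "Q \<in> \<P>" "P \<in> \<P>" "Q \<noteq> P" "Q \<subseteq> P" by blast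
    have "\<exists>z\<in>J. \<forall>P\<in>\<P> - {Q}. z \<notin> P"
      by (rule psubset.IH) (use QP psubset.prems in auto)
    then show ?thesis using QP by (metis Diff_iff singletonD subsetD)
  next
    case anti: False
    show ?thesis
    proof (cases "\<P> = {}")
      case True
      then show ?thesis using additive_subgroup.zero_closed[OF ideal.axioms(1)[OF J]] by blast
    next
      case False
      then obtain P where P: "P \<in> \<P>" by blast
      have "\<exists>z\<in>J. \<forall>P\<in>\<P> - {P}. z \<notin> P"
        by (rule psubset.IH) (use P psubset.prems in auto)
      then obtain z where z: "z \<in> J" "\<forall>Q\<in>\<P> - {P}. z \<notin> Q" by blast
      show ?thesis
      proof (cases "z \<in> P")
        case False
        with z show ?thesis by blast
      next
        case zP: True
        have "\<exists>w\<in>J. w \<notin> P \<and> (\<forall>I\<in>\<P> - {P}. w \<in> I)"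
          by (rule prime_avoids_Int) (use P psubset.hyps psubset.prems anti J pi in auto)
        then obtain w where w: "w \<in> J" "w \<notin> P" "\<forall>I\<in>\<P> - {P}. w \<in> I" by blast
        have c: "w \<in> carrier R" "z \<in> carrier R" using ideal.Icarr[OF J] w z by blast+
        have cancel: "a \<in> I" if "ideal I R" "a \<oplus> b \<in> I" "b \<in> I" "a \<in> carrier R" for a b I
        proof -
          interpret ideal I R by fact
          have "(a \<oplus> b) \<oplus> \<ominus> b \<in> I" using that by blast
          moreover have "(a \<oplus> b) \<oplus> \<ominus> b = a"
            using that Icarr by (simp add: a_assoc r_neg)
          ultimately show ?thesis by simp
        qed
        have "z \<oplus> w \<in> J"
          using J z w by (meson additive_subgroup.a_closed ideal.axioms(1))
        moreover have "z \<oplus> w \<notin> P"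
          using cancel[of P w z] zP w(2) c psubset.prems P pi by (metis a_comm)
        moreover have "z \<oplus> w \<notin> Q" if "Q \<in> \<P> - {P}" for Q
          using cancel[of Q z w] z(2) w(3) that c psubset.prems pi by blast
        ultimately show ?thesis by blast
      qed
    qed
  qed
qed

text \<open>Both chain conditions are phrased as well-foundedness, so that maximal members of a
  family come from \<open>wfE_min\<close>. The assumption on \<open>\<mm>\<close> says that it lies
  in the Jacobson radical, the form in which Nakayama uses it; later it is the maximal ideal of a
  local ring.\<close>

locale noeth_module = Module.module R M for R :: "('a, 'b) ring_scheme" (structure)
    and M :: "('a, 'm, 'c) module_scheme" (structure) +
  fixes \<mm> :: "'a set"
  assumes wf_ideals: "wf {(J, I). ideal I R \<and> ideal J R \<and> I \<subset> J}"
    and wf_submodules: "wf {(B, A). submodule A R M \<and> submodule B R M \<and> A \<subset> B}"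
    and mm_ideal: "ideal \<mm> R"
    and mm_unit: "\<And>y. y \<in> \<mm> \<Longrightarrow> \<one>\<^bsub>R\<^esub> \<ominus>\<^bsub>R\<^esub> y \<in> Units R"
begin

lemma maximal_ideal_exists:
  assumes "I \<in> \<F>" "\<And>I. I \<in> \<F> \<Longrightarrow> ideal I R"
  obtains J where "J \<in> \<F>" "\<And>L. L \<in> \<F> \<Longrightarrow> J \<subseteq> L \<Longrightarrow> L = J"
proof -
  obtain J where "J \<in> \<F>" and J: "\<And>L. (L, J) \<in> {(J, I). ideal I R \<and> ideal J R \<and> I \<subset> J} \<Longrightarrow> L \<notin> \<F>"
    by (rule wfE_min[OF wf_ideals assms(1)]) blast
  moreover have "L = J" if "L \<in> \<F>" "J \<subseteq> L" for L
    using J[of L] that assms(2) \<open>J \<in> \<F>\<close> by blast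
  ultimately show ?thesis using that by blast
qed

lemma maximal_submodule_exists:
  assumes "N \<in> \<F>" "\<And>N. N \<in> \<F> \<Longrightarrow> submodule N R M"
  obtains W where "W \<in> \<F>" "\<And>L. L \<in> \<F> \<Longrightarrow> W \<subseteq> L \<Longrightarrow> L = W"
proof -
  obtain W where "W \<in> \<F>" and W: "\<And>L. (L, W) \<in> {(B, A). submodule A R M \<and> submodule B R M \<and> A \<subset> B} \<Longrightarrow> L \<notin> \<F>"
    by (rule wfE_min[OF wf_submodules assms(1)]) blast
  moreover have "L = W" if "L \<in> \<F>" "W \<subseteq> L" for L
    using W[of L] that assms(2) \<open>W \<in> \<F>\<close> by blast
  ultimately show ?thesis using that by blast
qed

lemma mm_carrier: "y \<in> \<mm> \<Longrightarrow> y \<in> carrier R"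
  using ideal.Icarr[OF mm_ideal] .

text \<open>A chain-condition proof: choose \<open>n\<close> in \<open>T - K\<close> with
  \<open>K + Rn\<close> maximal and write \<open>n = k + y n'\<close>. Then \<open>K + Rn\<close>
  lies in \<open>K + Rn'\<close>, so the two agree and \<open>n' = u + c y n'\<close> with
  \<open>u\<close> in \<open>K\<close>; as \<open>1 - c y\<close> is a unit, \<open>n'\<close> lies
  in \<open>K\<close>. The argument stays inside \<open>T\<close>, so it applies to any set on which
  division by \<open>y\<close> modulo \<open>K\<close> is possible, such as the elements killed by
  an ideal modulo \<open>K\<close>.\<close>

lemma nakayama:
  assumes K: "submodule K R M" and y: "y \<in> \<mm>" and T: "T \<subseteq> carrier M"
    and step: "\<And>t. t \<in> T \<Longrightarrow> \<exists>k\<in>K. \<exists>t'\<in>T. t = k \<oplus>\<^bsub>M\<^esub> y \<odot>\<^bsub>M\<^esub> t'"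
  shows "T \<subseteq> K"
proof (rule ccontr)
  note Km = submodule_mem[OF K] and yR = mm_carrier[OF y]
  assume "\<not> T \<subseteq> K"
  then obtain n0 where "n0 \<in> T - K" by blast
  then have "adjoin K n0 \<in> adjoin K ` (T - K)" by blast
  then obtain W where "W \<in> adjoin K ` (T - K)"
    and max: "\<And>L. L \<in> adjoin K ` (T - K) \<Longrightarrow> W \<subseteq> L \<Longrightarrow> L = W"
    by (rule maximal_submodule_exists) (use T adjoin_submodule(1)[OF K] in auto)
  then obtain n where n: "n \<in> T - K" and W: "W = adjoin K n" by blast
  from step n obtain k n' where k: "k \<in> K" "n' \<in> T" "n = k \<oplus>\<^bsub>M\<^esub> y \<odot>\<^bsub>M\<^esub> n'" by blast
  have n': "n' \<in> carrier M" using k T by blast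
  have "n' \<notin> K"
  proof
    assume "n' \<in> K"
    then have "n \<in> K" using k Km(3)[OF k(1) Km(6)[OF yR]] by simp
    with n show False by simp
  qed
  with k have "adjoin K n' \<in> adjoin K ` (T - K)" by blast
  moreover have "n \<in> adjoin K n'" using k yR by (auto intro: adjoin_memI)
  have "adjoin K n \<subseteq> adjoin K n'"
  proof
    fix a assume "a \<in> adjoin K n"
    then obtain k c where "k \<in> K" "c \<in> carrier R" and a: "a = k \<oplus>\<^bsub>M\<^esub> c \<odot>\<^bsub>M\<^esub> n"
      by (auto simp: adjoin_def)
    then show "a \<in> adjoin K n'" unfolding a
      using \<open>n \<in> adjoin K n'\<close> adjoin_submodule(2)[OF K n']
      by (intro submodule_mem(3,6)[OF adjoin_submodule(1)[OF K n']]) auto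
  qed
  ultimately have "adjoin K n' = adjoin K n" using max W by blast
  then have "n' \<in> adjoin K n" using adjoin_submodule(3)[OF K n'] by blast
  then obtain k' c where c: "k' \<in> K" "c \<in> carrier R" "n' = k' \<oplus>\<^bsub>M\<^esub> c \<odot>\<^bsub>M\<^esub> n"
    by (auto simp: adjoin_def)
  define u where "u = k' \<oplus>\<^bsub>M\<^esub> c \<odot>\<^bsub>M\<^esub> k"
  have u: "u \<in> K" using c k Km by (auto simp: u_def)
  have "n' = k' \<oplus>\<^bsub>M\<^esub> (c \<odot>\<^bsub>M\<^esub> k \<oplus>\<^bsub>M\<^esub> c \<odot>\<^bsub>M\<^esub> (y \<odot>\<^bsub>M\<^esub> n'))"
    using c(3) smult_r_distr[OF c(2), of k "y \<odot>\<^bsub>M\<^esub> n'"] k(1,3) Km(1) n' yR by simp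
  then have eq: "n' = u \<oplus>\<^bsub>M\<^esub> (c \<otimes>\<^bsub>R\<^esub> y) \<odot>\<^bsub>M\<^esub> n'"
    using c(1,2) k(1) Km(1) n' yR unfolding u_def by (simp add: M.a_assoc smult_assoc1)
  have cy: "c \<otimes>\<^bsub>R\<^esub> y \<in> \<mm>" using ideal.I_l_closed[OF mm_ideal y] c by blast
  have "(\<one>\<^bsub>R\<^esub> \<ominus>\<^bsub>R\<^esub> c \<otimes>\<^bsub>R\<^esub> y) \<odot>\<^bsub>M\<^esub> n' = n' \<ominus>\<^bsub>M\<^esub> (c \<otimes>\<^bsub>R\<^esub> y) \<odot>\<^bsub>M\<^esub> n'"
    using smult_l_diff[of "\<one>\<^bsub>R\<^esub>" "c \<otimes>\<^bsub>R\<^esub> y" n'] c yR n' by simp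
  also have "\<dots> = u"
    using M.add_minus_cancel(4)[of u "(c \<otimes>\<^bsub>R\<^esub> y) \<odot>\<^bsub>M\<^esub> n'"] eq u Km(1) c(2) yR n'
    by (metis R.m_closed smult_closed)
  finally have w: "(\<one>\<^bsub>R\<^esub> \<ominus>\<^bsub>R\<^esub> c \<otimes>\<^bsub>R\<^esub> y) \<odot>\<^bsub>M\<^esub> n' = u" .
  from mm_unit[OF cy] obtain v where v: "v \<in> carrier R" "v \<otimes>\<^bsub>R\<^esub> (\<one>\<^bsub>R\<^esub> \<ominus>\<^bsub>R\<^esub> c \<otimes>\<^bsub>R\<^esub> y) = \<one>\<^bsub>R\<^esub>"
    unfolding Units_def by blast
  have "n' = v \<odot>\<^bsub>M\<^esub> u"
    using smult_assoc1[OF v(1), of "\<one>\<^bsub>R\<^esub> \<ominus>\<^bsub>R\<^esub> c \<otimes>\<^bsub>R\<^esub> y" n'] v w n' c yR by simp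
  with Km(6)[OF v(1) u] \<open>n' \<notin> K\<close> show False by simp
qed

lemma addm_proper:
  assumes K: "submodule K R M" and y: "y \<in> \<mm>" and "K \<noteq> carrier M"
  shows "addm M K y \<noteq> carrier M"
proof
  assume a: "addm M K y = carrier M"
  have "carrier M \<subseteq> K"
  proof (rule nakayama[OF K y])
    show "\<exists>k\<in>K. \<exists>t'\<in>carrier M. t = k \<oplus>\<^bsub>M\<^esub> y \<odot>\<^bsub>M\<^esub> t'" if "t \<in> carrier M" for t
    proof -
      have "t \<in> addm M K y" using that a by simp
      then show ?thesis by (auto simp: addm_def)
    qed
  qed simp
  with submodule_mem(1)[OF K] assms(3) show False by blast
qed

text \<open>An annihilator that is maximal among those of nonzero classes is prime: for
  \<open>b\<close> outside \<open>P\<close> the annihilator of \<open>b v\<close> contains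
  \<open>P\<close>, hence equals \<open>P\<close>, so \<open>a b\<close> in \<open>P\<close> forces
  \<open>a\<close> into \<open>P\<close>. The last clause records the maximality itself for
  \<open>finite_primes_cover\<close>.\<close>

lemma maximal_colon_above:
  assumes K: "submodule K R M" and u: "u \<in> carrier M" "u \<notin> K"
  obtains v where "v \<in> carrier M" "v \<notin> K" "primeideal (colon R M K v) R"
    "colon R M K u \<subseteq> colon R M K v"
    "\<forall>w\<in>carrier M - K. colon R M K v \<subseteq> colon R M K w \<longrightarrow> colon R M K w = colon R M K v"
proof -
  note Km = submodule_mem[OF K]
  define \<F> where "\<F> = {colon R M K v | v. v \<in> carrier M \<and> v \<notin> K \<and> colon R M K u \<subseteq> colon R M K v}"
  have "colon R M K u \<in> \<F>" using u by (auto simp: \<F>_def)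
  then obtain P where "P \<in> \<F>" and max: "\<And>L. L \<in> \<F> \<Longrightarrow> P \<subseteq> L \<Longrightarrow> L = P"
    by (rule maximal_ideal_exists) (use colon_ideal[OF K] in \<open>auto simp: \<F>_def\<close>)
  then obtain v where v: "v \<in> carrier M" "v \<notin> K" "colon R M K u \<subseteq> colon R M K v"
    and P: "P = colon R M K v" by (auto simp: \<F>_def)
  \<comment> \<open>The family contains only annihilators above that of \<open>u\<close>, but
    whatever lies above \<open>P\<close> lies above that one too, so \<open>P\<close> is maximal
    among the annihilators of all nonzero classes.\<close>
  have maxP: "colon R M K w = P" if "w \<in> carrier M - K" "P \<subseteq> colon R M K w" for w
    using max[of "colon R M K w"] v(3) that unfolding P \<F>_def by blast
  have "primeideal P R"
  proof (rule primeidealI)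
    show "ideal P R" unfolding P by (rule colon_ideal[OF K v(1)])
    show "cring R" by (rule R.is_cring)
    show "carrier R \<noteq> P" using P one_notin_colon[OF K v(1,2)] by auto
    fix a b assume ab: "a \<in> carrier R" "b \<in> carrier R" "a \<otimes>\<^bsub>R\<^esub> b \<in> P"
    show "a \<in> P \<or> b \<in> P"
    proof (rule disjCI)
      assume "b \<notin> P"
      then have bv: "b \<odot>\<^bsub>M\<^esub> v \<in> carrier M - K" using ab v by (auto simp: P colon_def)
      have "P \<subseteq> colon R M K (b \<odot>\<^bsub>M\<^esub> v)"
        using Km ab v by (auto simp: P colon_def smult_commute[of _ b])
      then have "colon R M K (b \<odot>\<^bsub>M\<^esub> v) = P" by (rule maxP[OF bv])
      moreover have "a \<in> colon R M K (b \<odot>\<^bsub>M\<^esub> v)"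
        using ab v by (auto simp: P colon_def smult_assoc1)
      ultimately show "a \<in> P" by blast
    qed
  qed
  then show ?thesis using that[OF v(1,2) _ v(3)] maxP unfolding P by blast
qed

lemma prime_colon_above:
  assumes "submodule K R M" "u \<in> carrier M" "u \<notin> K"
  obtains v where "v \<in> carrier M" "v \<notin> K" "primeideal (colon R M K v) R"
    "colon R M K u \<subseteq> colon R M K v"
  by (rule maximal_colon_above[OF assms]) (rule that)

text \<open>These primes contain every zero divisor on \<open>M/K\<close>. Let \<open>V\<close> be
  the elements with a maximal annihilator. By the chain condition a finite subset \<open>F\<close>
  of \<open>V\<close> spans, together with \<open>K\<close>, a submodule containing all of
  \<open>V\<close>. If the annihilator of some \<open>v\<close> in \<open>V\<close> were new, it
  would by maximality contain no annihilator of a member of \<open>F\<close>, so some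
  \<open>w\<close> outside it would kill \<open>F\<close>, and hence \<open>v\<close>, modulo
  \<open>K\<close>.\<close>

lemma finite_primes_cover:
  assumes K: "submodule K R M"
  obtains F where "finite F" "F \<subseteq> carrier M - K" "\<And>f. f \<in> F \<Longrightarrow> primeideal (colon R M K f) R"
    "\<And>v. v \<in> carrier M \<Longrightarrow> v \<notin> K \<Longrightarrow> \<exists>f\<in>F. colon R M K v \<subseteq> colon R M K f"
proof -
  note Km = submodule_mem[OF K]
  define V where "V = {v \<in> carrier M - K. primeideal (colon R M K v) R \<and>
    (\<forall>w\<in>carrier M - K. colon R M K v \<subseteq> colon R M K w \<longrightarrow> colon R M K w = colon R M K v)}"
  define sp where "sp F = \<Inter>{N. submodule N R M \<and> K \<union> F \<subseteq> N}" for F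
  have sp_sub: "submodule (sp F) R M" if "F \<subseteq> carrier M" for F
  proof (rule submoduleI)
    have ne: "carrier M \<in> {N. submodule N R M \<and> K \<union> F \<subseteq> N}"
      using carrier_is_submodule that Km by auto
    then show "sp F \<subseteq> carrier M" by (auto simp: sp_def)
  qed (auto simp: sp_def dest: submodule_mem)
  have sp_sup: "K \<union> F \<subseteq> sp F" for F by (auto simp: sp_def)
  have sp_least: "sp F \<subseteq> N" if "submodule N R M" "K \<union> F \<subseteq> N" for F N
    using that by (auto simp: sp_def)
  have above: "\<exists>w\<in>V. colon R M K v \<subseteq> colon R M K w" if v: "v \<in> carrier M" "v \<notin> K" for v
  proof -
    obtain w where w: "w \<in> carrier M" "w \<notin> K" "primeideal (colon R M K w) R"
      "colon R M K v \<subseteq> colon R M K w"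
      "\<forall>t\<in>carrier M - K. colon R M K w \<subseteq> colon R M K t \<longrightarrow> colon R M K t = colon R M K w"
      using maximal_colon_above[OF K v] by blast
    then have "w \<in> V" by (simp add: V_def)
    with w(4) show ?thesis by blast
  qed
  have "sp {} \<in> {sp F | F. finite F \<and> F \<subseteq> V}" by blast
  then obtain W where "W \<in> {sp F | F. finite F \<and> F \<subseteq> V}"
    and max: "\<And>L. L \<in> {sp F | F. finite F \<and> F \<subseteq> V} \<Longrightarrow> W \<subseteq> L \<Longrightarrow> L = W"
    by (rule maximal_submodule_exists) (use sp_sub V_def in auto)
  then obtain F where F: "finite F" "F \<subseteq> V" "W = sp F" by blast
  have FM: "F \<subseteq> carrier M - K" using F by (auto simp: V_def)
  have VW: "V \<subseteq> W"
  proof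
    fix v assume v: "v \<in> V"
    have "sp F \<subseteq> sp (insert v F)"
      by (rule sp_least, rule sp_sub) (use sp_sup[of "insert v F"] v FM in \<open>auto simp: V_def\<close>)
    moreover have "sp (insert v F) \<in> {sp F | F. finite F \<and> F \<subseteq> V}" using v F by blast
    ultimately have "sp (insert v F) = W" using max F by blast
    then show "v \<in> W" using sp_sup[of "insert v F"] by blast
  qed
  have cover: "\<exists>f\<in>F. colon R M K v \<subseteq> colon R M K f" if v: "v \<in> V" for v
  proof (rule ccontr)
    assume none: "\<not> ?thesis"
    have vM: "v \<in> carrier M" "v \<notin> K" "primeideal (colon R M K v) R" using v by (auto simp: V_def)
    have "\<exists>w\<in>carrier R. w \<notin> colon R M K v \<and> (\<forall>I\<in>colon R M K ` F. w \<in> I)"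
    proof (rule R.prime_avoids_Int[OF vM(3)])
      show "\<forall>I\<in>colon R M K ` F. ideal I R \<and> \<not> I \<subseteq> colon R M K v"
      proof (intro ballI conjI notI)
        fix I assume "I \<in> colon R M K ` F"
        then obtain f where f: "f \<in> F" "I = colon R M K f" by blast
        then show "ideal I R" using FM colon_ideal[OF K] by blast
        assume "I \<subseteq> colon R M K v"
        then have "colon R M K v = colon R M K f" using f F vM unfolding V_def by blast
        with none f(1) show False by blast
      qed
      show "\<not> carrier R \<subseteq> colon R M K v" using one_notin_colon[OF K vM(1,2)] by auto
    qed (use F R.oneideal in auto)
    then obtain w where w: "w \<in> carrier R" "w \<notin> colon R M K v" "\<forall>f\<in>F. w \<in> colon R M K f" by auto
    \<comment> \<open>The elements that \<open>w\<close> sends into \<open>K\<close> form a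
      submodule containing \<open>K\<close> and \<open>F\<close>, so it contains \<open>v\<close>,
      against the choice of \<open>w\<close>.\<close>
    have "sp F \<subseteq> {m \<in> carrier M. w \<odot>\<^bsub>M\<^esub> m \<in> K}"
    proof (rule sp_least)
      show "submodule {m \<in> carrier M. w \<odot>\<^bsub>M\<^esub> m \<in> K} R M"
        by (rule submoduleI) (use Km w in \<open>auto simp: smult_r_distr smult_r_minus smult_commute[of w]\<close>)
      show "K \<union> F \<subseteq> {m \<in> carrier M. w \<odot>\<^bsub>M\<^esub> m \<in> K}" using Km w FM by (auto simp: colon_def)
    qed
    with v VW F w show False by (auto simp: colon_def)
  qed
  show ?thesis
  proof (rule that[OF F(1) FM])
    show "primeideal (colon R M K f) R" if "f \<in> F" for f using that F by (auto simp: V_def)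
    show "\<exists>f\<in>F. colon R M K v \<subseteq> colon R M K f" if "v \<in> carrier M" "v \<notin> K" for v
      using above[OF that] cover by (meson order_trans)
  qed
qed

text \<open>\<open>no_socle K\<close> says \<open>Hom(R/\<mm>, M/K) = 0\<close>.\<close>

definition no_socle :: "'m set \<Rightarrow> bool" where
  "no_socle K \<longleftrightarrow> (\<forall>u\<in>carrier M. \<mm> \<subseteq> colon R M K u \<longrightarrow> u \<in> K)"

lemma nzd_imp_no_socle: "z \<in> \<mm> \<Longrightarrow> nzd M K z \<Longrightarrow> no_socle K"
  by (auto simp: no_socle_def nzd_def colon_def)

text \<open>Absence of a socle means that none of the finitely many primes covering the zero
  divisors of \<open>M/K\<close> contains \<open>\<mm>\<close>. Pooling these primes over the whole
  family, prime avoidance finds one \<open>z\<close> that works simultaneously.\<close>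

lemma common_nzd:
  assumes "finite \<K>" and \<K>: "\<And>K. K \<in> \<K> \<Longrightarrow> submodule K R M \<and> no_socle K"
  shows "\<exists>z\<in>\<mm>. \<forall>K\<in>\<K>. nzd M K z"
proof -
  \<comment> \<open>Packages the conclusion of \<open>finite_primes_cover\<close> as a predicate, so
    that a cover \<open>F K\<close> can be chosen for every \<open>K\<close> at once.\<close>
  define Q where "Q K F \<longleftrightarrow> finite F \<and> F \<subseteq> carrier M - K \<and> (\<forall>f\<in>F. primeideal (colon R M K f) R) \<and>
      (\<forall>v\<in>carrier M. v \<notin> K \<longrightarrow> (\<exists>f\<in>F. colon R M K v \<subseteq> colon R M K f))" for K F
  have "\<exists>F. Q K F" if "K \<in> \<K>" for K
  proof -
    have "submodule K R M" using \<K>[OF that] by simp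
    then obtain F where "finite F" "F \<subseteq> carrier M - K" "\<And>f. f \<in> F \<Longrightarrow> primeideal (colon R M K f) R"
        "\<And>v. v \<in> carrier M \<Longrightarrow> v \<notin> K \<Longrightarrow> \<exists>f\<in>F. colon R M K v \<subseteq> colon R M K f"
      using finite_primes_cover by metis
    then have "Q K F" by (simp add: Q_def)
    then show ?thesis ..
  qed
  then obtain F where F: "\<And>K. K \<in> \<K> \<Longrightarrow> Q K (F K)" by metis
  have "\<exists>z\<in>\<mm>. \<forall>P\<in>(\<Union>K\<in>\<K>. colon R M K ` F K). z \<notin> P"
  proof (rule R.prime_avoidance[OF _ _ mm_ideal])
    show "finite (\<Union>K\<in>\<K>. colon R M K ` F K)" using assms(1) F by (auto simp: Q_def)
    show "\<forall>P\<in>(\<Union>K\<in>\<K>. colon R M K ` F K). primeideal P R \<and> \<not> \<mm> \<subseteq> P"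
    proof (intro ballI conjI notI)
      fix P assume "P \<in> (\<Union>K\<in>\<K>. colon R M K ` F K)"
      then obtain K f where K: "K \<in> \<K>" and f: "f \<in> F K" "P = colon R M K f" by blast
      have QK: "Q K (F K)" by (rule F[OF K])
      show "primeideal P R" using QK f by (simp add: Q_def)
      assume "\<mm> \<subseteq> P"
      moreover have "f \<in> carrier M" "f \<notin> K" using QK f(1) by (auto simp: Q_def)
      ultimately show False using \<K>[OF K] f(2) by (auto simp: no_socle_def)
    qed
  qed
  then obtain z where z1: "z \<in> \<mm>" and z2: "\<forall>P\<in>(\<Union>K\<in>\<K>. colon R M K ` F K). z \<notin> P" ..
  have z: "z \<notin> colon R M K f" if "K \<in> \<K>" "f \<in> F K" for K f
    using z2 that by simp
  have "nzd M K z" if K: "K \<in> \<K>" for K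
    unfolding nzd_def
  proof (intro ballI impI, rule ccontr)
    fix m assume m: "m \<in> carrier M" "z \<odot>\<^bsub>M\<^esub> m \<in> K" "m \<notin> K"
    then have "z \<in> colon R M K m" using z1 mm_carrier by (auto simp: colon_def)
    moreover obtain f where "f \<in> F K" "colon R M K m \<subseteq> colon R M K f"
      using F[OF K] m unfolding Q_def by meson
    ultimately show False using z[OF K] by blast
  qed
  then show ?thesis using z1 by blast
qed

text \<open>Multiplication by \<open>x\<close> and \<open>y\<close> identifies the socles of \<open>M/(K + xM)\<close> and \<open>M/(K + yM)\<close>.\<close>

lemma no_socle_addm:
  assumes K: "submodule K R M" and x: "x \<in> \<mm>" and y: "y \<in> \<mm>"
    and nx: "nzd M K x" and ny: "nzd M K y" and ns: "no_socle (addm M K y)"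
  shows "no_socle (addm M K x)"
  unfolding no_socle_def
proof (intro ballI impI)
  note Km = submodule_mem[OF K]
  have xR: "x \<in> carrier R" and yR: "y \<in> carrier R" using x y mm_carrier by auto
  fix u assume u: "u \<in> carrier M" and soc: "\<mm> \<subseteq> colon R M (addm M K x) u"
  have ex: "\<exists>k\<in>K. \<exists>w\<in>carrier M. a \<odot>\<^bsub>M\<^esub> u = k \<oplus>\<^bsub>M\<^esub> x \<odot>\<^bsub>M\<^esub> w" if "a \<in> \<mm>" for a
  proof -
    have "a \<odot>\<^bsub>M\<^esub> u \<in> addm M K x" using soc that by (auto simp: colon_def)
    then show ?thesis by (auto simp: addm_def)
  qed
  \<comment> \<open>As \<open>y\<close> lies in \<open>\<mm>\<close>, it sends \<open>u\<close> into
    \<open>K + xM\<close>; the quotient \<open>w\<close> by \<open>x\<close> is the socle class of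
    \<open>M/(K + yM)\<close> that corresponds to the class of \<open>u\<close>.\<close>
  obtain k w where k: "k \<in> K" and w: "w \<in> carrier M" and yu: "y \<odot>\<^bsub>M\<^esub> u = k \<oplus>\<^bsub>M\<^esub> x \<odot>\<^bsub>M\<^esub> w"
    using ex[OF y] by blast
  have "\<mm> \<subseteq> colon R M (addm M K y) w"
  proof
    fix a assume a: "a \<in> \<mm>"
    then have aR: "a \<in> carrier R" by (rule mm_carrier)
    obtain k' v where k': "k' \<in> K" and v: "v \<in> carrier M" and au: "a \<odot>\<^bsub>M\<^esub> u = k' \<oplus>\<^bsub>M\<^esub> x \<odot>\<^bsub>M\<^esub> v"
      using ex[OF a] by blast
    have kk: "k \<in> carrier M" "k' \<in> carrier M" using Km(1) k k' by auto
    \<comment> \<open>Evaluating \<open>a y u\<close> in both orders and cancelling \<open>x\<close>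
      shows that \<open>a w - y v\<close> lies in \<open>K\<close>, so \<open>a\<close> kills
      \<open>w\<close> modulo \<open>K + yM\<close>.\<close>
    have "a \<odot>\<^bsub>M\<^esub> k \<oplus>\<^bsub>M\<^esub> x \<odot>\<^bsub>M\<^esub> (a \<odot>\<^bsub>M\<^esub> w) = a \<odot>\<^bsub>M\<^esub> (y \<odot>\<^bsub>M\<^esub> u)"
      unfolding yu using aR xR w kk by (simp add: smult_r_distr smult_commute[of a x])
    also have "\<dots> = y \<odot>\<^bsub>M\<^esub> (a \<odot>\<^bsub>M\<^esub> u)" using aR yR u by (rule smult_commute)
    also have "\<dots> = y \<odot>\<^bsub>M\<^esub> k' \<oplus>\<^bsub>M\<^esub> x \<odot>\<^bsub>M\<^esub> (y \<odot>\<^bsub>M\<^esub> v)"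
      unfolding au using yR xR v kk by (simp add: smult_r_distr smult_commute[of y x])
    finally have eq: "a \<odot>\<^bsub>M\<^esub> k \<oplus>\<^bsub>M\<^esub> x \<odot>\<^bsub>M\<^esub> (a \<odot>\<^bsub>M\<^esub> w) = y \<odot>\<^bsub>M\<^esub> k' \<oplus>\<^bsub>M\<^esub> x \<odot>\<^bsub>M\<^esub> (y \<odot>\<^bsub>M\<^esub> v)" .
    have "a \<odot>\<^bsub>M\<^esub> k \<oplus>\<^bsub>M\<^esub> x \<odot>\<^bsub>M\<^esub> (a \<odot>\<^bsub>M\<^esub> w \<ominus>\<^bsub>M\<^esub> y \<odot>\<^bsub>M\<^esub> v) =
      (a \<odot>\<^bsub>M\<^esub> k \<oplus>\<^bsub>M\<^esub> x \<odot>\<^bsub>M\<^esub> (a \<odot>\<^bsub>M\<^esub> w)) \<ominus>\<^bsub>M\<^esub> x \<odot>\<^bsub>M\<^esub> (y \<odot>\<^bsub>M\<^esub> v)"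
      using aR xR yR w v kk by (simp add: smult_r_distr smult_r_minus a_minus_def M.a_assoc)
    also have "\<dots> = y \<odot>\<^bsub>M\<^esub> k'"
      unfolding eq using M.add_minus_cancel(4) xR yR v kk by simp
    finally have "a \<odot>\<^bsub>M\<^esub> k \<oplus>\<^bsub>M\<^esub> x \<odot>\<^bsub>M\<^esub> (a \<odot>\<^bsub>M\<^esub> w \<ominus>\<^bsub>M\<^esub> y \<odot>\<^bsub>M\<^esub> v) \<in> K"
      using Km(6)[OF yR k'] by simp
    then have "x \<odot>\<^bsub>M\<^esub> (a \<odot>\<^bsub>M\<^esub> w \<ominus>\<^bsub>M\<^esub> y \<odot>\<^bsub>M\<^esub> v) \<in> K"
      by (rule submodule_add_cancel[OF K Km(6)[OF aR k], rotated]) (use xR yR aR v w in simp)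
    then have "a \<odot>\<^bsub>M\<^esub> w \<ominus>\<^bsub>M\<^esub> y \<odot>\<^bsub>M\<^esub> v \<in> K" using nx aR yR v w by (simp add: nzd_def)
    moreover have "a \<odot>\<^bsub>M\<^esub> w = (a \<odot>\<^bsub>M\<^esub> w \<ominus>\<^bsub>M\<^esub> y \<odot>\<^bsub>M\<^esub> v) \<oplus>\<^bsub>M\<^esub> y \<odot>\<^bsub>M\<^esub> v"
      using aR yR v w by (simp add: M.add_minus_cancel)
    ultimately have "a \<odot>\<^bsub>M\<^esub> w \<in> addm M K y" by (rule addm_memI[OF _ v])
    then show "a \<in> colon R M (addm M K y) w" using aR by (simp add: colon_def)
  qed
  \<comment> \<open>The correspondence run backwards: with \<open>w = k' + y v\<close>, it is now
    \<open>y\<close> that is cancelled, which puts \<open>u - x v\<close> into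
    \<open>K\<close>.\<close>
  then have "w \<in> addm M K y" using ns w by (simp add: no_socle_def)
  then obtain k' v where k': "k' \<in> K" and v: "v \<in> carrier M" and wv: "w = k' \<oplus>\<^bsub>M\<^esub> y \<odot>\<^bsub>M\<^esub> v"
    by (auto simp: addm_def)
  have kk: "k \<in> carrier M" "k' \<in> carrier M" using Km(1) k k' by auto
  have "y \<odot>\<^bsub>M\<^esub> u = (k \<oplus>\<^bsub>M\<^esub> x \<odot>\<^bsub>M\<^esub> k') \<oplus>\<^bsub>M\<^esub> y \<odot>\<^bsub>M\<^esub> (x \<odot>\<^bsub>M\<^esub> v)"
    unfolding yu wv using kk xR yR v by (simp add: smult_r_distr smult_commute[of x y] M.a_assoc)
  then have "y \<odot>\<^bsub>M\<^esub> (u \<ominus>\<^bsub>M\<^esub> x \<odot>\<^bsub>M\<^esub> v) = k \<oplus>\<^bsub>M\<^esub> x \<odot>\<^bsub>M\<^esub> k'"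
    using kk xR yR v u by (simp add: smult_r_diff M.add_minus_cancel)
  then have "y \<odot>\<^bsub>M\<^esub> (u \<ominus>\<^bsub>M\<^esub> x \<odot>\<^bsub>M\<^esub> v) \<in> K" using Km(3)[OF k Km(6)[OF xR k']] by simp
  then have "u \<ominus>\<^bsub>M\<^esub> x \<odot>\<^bsub>M\<^esub> v \<in> K" using ny xR v u by (simp add: nzd_def)
  then show "u \<in> addm M K x"
    by (rule addm_memI[OF _ v]) (use xR v u in \<open>simp add: M.add_minus_cancel\<close>)
qed

text \<open>The sequence is exchanged in two steps through an element \<open>z\<close> that is regular on \<open>M/K\<close>,
  \<open>M/(K + y\<^sub>1M)\<close> and \<open>M/(K + xM)\<close>.\<close>

lemma regseq_exchange:
  assumes "submodule K R M" "length ys = Suc n" "set ys \<subseteq> \<mm>" "regseq M K ys" "x \<in> \<mm>" "nzd M K x"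
  shows "\<exists>zs. length zs = n \<and> set zs \<subseteq> \<mm> \<and> regseq M (addm M K x) zs"
  using assms
proof (induction n arbitrary: K ys x)
  case 0
  show ?case by (rule exI[of _ "[]"]) simp
next
  case (Suc n)
  note K = Suc.prems(1) and x = Suc.prems(5)
  have xR: "x \<in> carrier R" using x by (rule mm_carrier)
  \<comment> \<open>The sequence has \<open>n + 2\<close> entries here. The second one witnesses
    that \<open>M/(K + y1 M)\<close> has no socle, and this is what makes \<open>z\<close>
    available.\<close>
  obtain y1 y2 ys' where ys: "ys = y1 # y2 # ys'"
    using Suc.prems(2) by (metis Suc_length_conv)
  have y1: "y1 \<in> \<mm>" "y1 \<in> carrier R" "nzd M K y1" and y2: "y2 \<in> \<mm>" "nzd M (addm M K y1) y2"
    using Suc.prems(3,4) mm_carrier by (auto simp: ys)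
  have subs: "submodule (addm M K y1) R M" "submodule (addm M K x) R M"
    using addm_submodule[OF K] y1(2) xR by auto
  have ns: "no_socle K" "no_socle (addm M K y1)"
    using nzd_imp_no_socle y1 y2 by auto
  then have "no_socle (addm M K x)" using no_socle_addm[OF K x y1(1) Suc.prems(6) y1(3)] by simp
  then have "\<exists>z\<in>\<mm>. \<forall>L\<in>{K, addm M K y1, addm M K x}. nzd M L z"
    by (intro common_nzd) (use K subs ns in auto)
  then obtain z where z: "z \<in> \<mm>" and nz: "nzd M K z" "nzd M (addm M K y1) z" "nzd M (addm M K x) z"
    by auto
  have zR: "z \<in> carrier R" using z by (rule mm_carrier)
  \<comment> \<open>First exchange, over \<open>K + y1 M\<close>: the tail starting with
    \<open>y2\<close> is traded for a sequence \<open>ws\<close> of length \<open>n\<close> that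
    follows \<open>z\<close>.\<close>
  have "\<exists>ws. length ws = n \<and> set ws \<subseteq> \<mm> \<and> regseq M (addm M (addm M K y1) z) ws"
    by (rule Suc.IH[OF subs(1) _ _ _ z nz(2), of "y2 # ys'"]) (use Suc.prems ys in auto)
  then obtain ws where ws: "length ws = n" "set ws \<subseteq> \<mm>" "regseq M (addm M (addm M K z) y1) ws"
    using addm_commute[OF K y1(2) zR] by auto
  \<comment> \<open>Moving \<open>z\<close> to the front makes \<open>y1 # ws\<close> a sequence of
    length \<open>n + 1\<close> on \<open>M/(K + zM)\<close>, where \<open>x\<close> is regular as
    well; the second exchange trades it for a sequence that follows \<open>x\<close>.\<close>
  have "nzd M (addm M K z) y1" by (rule nzd_swap[OF K y1(2) zR y1(3) nz(2)])
  moreover have "nzd M (addm M K z) x" by (rule nzd_swap[OF K xR zR Suc.prems(6) nz(3)])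
  ultimately have "\<exists>vs. length vs = n \<and> set vs \<subseteq> \<mm> \<and> regseq M (addm M (addm M K z) x) vs"
    by (intro Suc.IH[OF addm_submodule[OF K zR] _ _ _ x, of "y1 # ws"]) (use ws y1 in auto)
  then obtain vs where vs: "length vs = n" "set vs \<subseteq> \<mm>" "regseq M (addm M (addm M K x) z) vs"
    using addm_commute[OF K xR zR] by auto
  show ?case by (rule exI[of _ "z # vs"]) (use vs z nz in auto)
qed

text \<open>Finiteness of depth from the chain condition. Take \<open>W\<close> maximal among the
  proper submodules whose quotients carry sequences of every length, and \<open>y\<close> regular on
  \<open>M/W\<close>. By the exchange lemma \<open>W + yM\<close> is of the same kind, so it equals
  \<open>W\<close>; then \<open>y\<close> both kills \<open>M/W\<close> and is regular on it, which
  is impossible for a proper \<open>W\<close>.\<close>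

lemma regseq_length_bounded:
  assumes "submodule K R M" "K \<noteq> carrier M"
  shows "\<exists>n. \<nexists>ys. length ys = n \<and> set ys \<subseteq> \<mm> \<and> regseq M K ys"
proof (rule ccontr)
  define \<F> where "\<F> = {K. submodule K R M \<and> K \<noteq> carrier M \<and>
    (\<forall>n. \<exists>ys. length ys = n \<and> set ys \<subseteq> \<mm> \<and> regseq M K ys)}"
  assume "\<not> ?thesis"
  then have "K \<in> \<F>" using assms unfolding \<F>_def by blast
  then obtain W where W: "W \<in> \<F>" and max: "\<And>L. L \<in> \<F> \<Longrightarrow> W \<subseteq> L \<Longrightarrow> L = W"
    by (rule maximal_submodule_exists) (auto simp: \<F>_def)
  have Ws: "submodule W R M" "W \<noteq> carrier M" using W by (auto simp: \<F>_def)
  have unb: "\<exists>ys. length ys = n \<and> set ys \<subseteq> \<mm> \<and> regseq M W ys" for n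
    using W by (auto simp: \<F>_def)
  obtain y where y: "y \<in> \<mm>" "nzd M W y"
  proof -
    obtain ys where "length ys = 1" "set ys \<subseteq> \<mm>" "regseq M W ys" using unb by blast
    then show ?thesis using that by (cases ys) auto
  qed
  have yR: "y \<in> carrier R" using y by (intro mm_carrier)
  have "addm M W y \<in> \<F>"
    unfolding \<F>_def
  proof (intro CollectI conjI allI)
    show "submodule (addm M W y) R M" by (rule addm_submodule[OF Ws(1) yR])
    show "addm M W y \<noteq> carrier M" by (rule addm_proper[OF Ws(1) y(1) Ws(2)])
    show "\<exists>ys. length ys = n \<and> set ys \<subseteq> \<mm> \<and> regseq M (addm M W y) ys" for n
    proof -
      obtain ys where "length ys = Suc n" "set ys \<subseteq> \<mm>" "regseq M W ys" using unb by blast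
      then show ?thesis using regseq_exchange[OF Ws(1) _ _ _ y] by blast
    qed
  qed
  then have eq: "addm M W y = W" using max addm_sup(1)[OF Ws(1) yR] by blast
  have "carrier M \<subseteq> W"
  proof
    fix m assume m: "m \<in> carrier M"
    then have "y \<odot>\<^bsub>M\<^esub> m \<in> W" using addm_sup(2)[OF Ws(1) yR] eq by auto
    then show "m \<in> W" using y m by (auto simp: nzd_def)
  qed
  with Ws submodule_mem(1)[OF Ws(1)] show False by blast
qed

text \<open>Each regular element yields one strict step. Let \<open>p\<close> be the annihilator of
  \<open>v\<close> and \<open>T\<close> the elements killed by \<open>p\<close> modulo
  \<open>K\<close>. If \<open>T\<close> lay in \<open>K + yM\<close>, then
  \<open>t = k + y m\<close> would force \<open>m\<close> into \<open>T\<close> because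
  \<open>y\<close> is regular, and Nakayama would put \<open>T\<close> into \<open>K\<close>,
  against \<open>v\<close>. So some \<open>t\<close> in \<open>T\<close> survives in
  \<open>M/(K + yM)\<close>; its annihilator there contains \<open>p\<close> and \<open>y\<close>,
  and a prime annihilator above it starts the rest of the chain.\<close>

lemma regseq_prime_chain:
  assumes "submodule K R M" "set ys \<subseteq> \<mm>" "regseq M K ys" "v \<in> carrier M" "v \<notin> K"
    "primeideal (colon R M K v) R"
  shows "\<exists>P :: nat \<Rightarrow> 'a set. P 0 = colon R M K v \<and> (\<forall>i\<le>length ys. primeideal (P i) R) \<and>
    (\<forall>i<length ys. P i \<subset> P (Suc i))"
  using assms
proof (induction ys arbitrary: K v)
  case Nil
  then show ?case by (intro exI[of _ "\<lambda>_. colon R M K v"]) simp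
next
  case (Cons y ys)
  note K = Cons.prems(1) and v = Cons.prems(4,5)
  note Km = submodule_mem[OF K]
  let ?p = "colon R M K v"
  have y: "y \<in> \<mm>" "nzd M K y" using Cons.prems by auto
  have yR: "y \<in> carrier R" using y(1) by (rule mm_carrier)
  note Ky = addm_submodule[OF K yR]
  define T where "T = {t \<in> carrier M. \<forall>r\<in>?p. r \<odot>\<^bsub>M\<^esub> t \<in> K}"
  have pR: "r \<in> carrier R" if "r \<in> ?p" for r using that by (simp add: colon_def)
  have "\<not> T \<subseteq> addm M K y"
  proof
    assume sub: "T \<subseteq> addm M K y"
    have "T \<subseteq> K"
    proof (rule nakayama[OF K y(1)])
      show "T \<subseteq> carrier M" by (auto simp: T_def)
      fix t assume t: "t \<in> T"
      then obtain k m where k: "k \<in> K" and m: "m \<in> carrier M" and tk: "t = k \<oplus>\<^bsub>M\<^esub> y \<odot>\<^bsub>M\<^esub> m"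
        using sub by (auto simp: addm_def)
      have "r \<odot>\<^bsub>M\<^esub> m \<in> K" if r: "r \<in> ?p" for r
      proof -
        have "r \<odot>\<^bsub>M\<^esub> k \<oplus>\<^bsub>M\<^esub> r \<odot>\<^bsub>M\<^esub> (y \<odot>\<^bsub>M\<^esub> m) \<in> K"
          using t r pR[OF r] k m yR Km(1) unfolding tk T_def by (auto simp: smult_r_distr)
        then have "r \<odot>\<^bsub>M\<^esub> (y \<odot>\<^bsub>M\<^esub> m) \<in> K"
          by (rule submodule_add_cancel[OF K Km(6)[OF pR[OF r] k], rotated]) (use pR[OF r] m yR in simp)
        then have "y \<odot>\<^bsub>M\<^esub> (r \<odot>\<^bsub>M\<^esub> m) \<in> K" using smult_commute[OF pR[OF r] yR m] by simp
        then show ?thesis using y(2) pR[OF r] m by (simp add: nzd_def)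
      qed
      then have "m \<in> T" using m by (simp add: T_def)
      with k tk show "\<exists>k\<in>K. \<exists>t'\<in>T. t = k \<oplus>\<^bsub>M\<^esub> y \<odot>\<^bsub>M\<^esub> t'" by blast
    qed
    moreover have "v \<in> T" using v by (auto simp: T_def colon_def)
    ultimately show False using v by blast
  qed
  then obtain t where t: "t \<in> T" "t \<notin> addm M K y" by blast
  then have tM: "t \<in> carrier M" by (simp add: T_def)
  obtain w where w: "w \<in> carrier M" "w \<notin> addm M K y" "primeideal (colon R M (addm M K y) w) R"
    "colon R M (addm M K y) t \<subseteq> colon R M (addm M K y) w"
    using prime_colon_above[OF Ky tM t(2)] by blast
  have "?p \<subseteq> colon R M (addm M K y) t"
  proof
    fix r assume r: "r \<in> ?p"
    then have "r \<odot>\<^bsub>M\<^esub> t \<in> K" using t(1) by (simp add: T_def)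
    then show "r \<in> colon R M (addm M K y) t"
      using addm_sup(1)[OF K yR] pR[OF r] by (auto simp: colon_def)
  qed
  moreover have "y \<in> colon R M (addm M K y) t" using addm_sup(2)[OF K yR tM] yR by (simp add: colon_def)
  \<comment> \<open>This makes the step strict: \<open>y v\<close> in \<open>K\<close> would put
    \<open>v\<close> into \<open>K\<close>.\<close>
  moreover have "y \<notin> ?p" using y(2) v by (auto simp: colon_def nzd_def)
  ultimately have lt: "?p \<subset> colon R M (addm M K y) w" using w(4) by blast
  obtain P where P: "P 0 = colon R M (addm M K y) w" "\<forall>i\<le>length ys. primeideal (P i) R"
    "\<forall>i<length ys. P i \<subset> P (Suc i)"
  proof -
    have "set ys \<subseteq> \<mm>" "regseq M (addm M K y) ys" using Cons.prems(2,3) by auto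
    from Cons.IH[OF Ky this w(1,2,3)] that show ?thesis by blast
  qed
  show ?case
    by (rule exI[of _ "case_nat ?p P"])
      (use P lt Cons.prems(6) in \<open>auto split: nat.split simp: less_Suc_eq_0_disj le_Suc_eq\<close>)
qed

end

section \<open>Noetherian modules and local rings\<close>

lemma (in noetherian_ring) wf_ideals: "wf {(J, I). ideal I R \<and> ideal J R \<and> I \<subset> J}"
  unfolding wf_iff_no_infinite_down_chain
proof
  assume "\<exists>f. \<forall>i. (f (Suc i), f i) \<in> {(J, I). ideal I R \<and> ideal J R \<and> I \<subset> J}"
  then obtain f where f0: "\<forall>i. (f (Suc i), f i) \<in> {(J, I). ideal I R \<and> ideal J R \<and> I \<subset> J}" ..
  have f: "ideal (f i) R" "f i \<subset> f (Suc i)" for i using f0 by auto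
  have "f i \<subseteq> f j" if "i \<le> j" for i j
    using lift_Suc_mono_le[of f i j] f(2) that by blast
  then have "f i \<subseteq> f j \<or> f j \<subseteq> f i" for i j by (meson nle_le)
  then have "subset.chain {I. ideal I R} (range f)"
    using f(1) by (auto simp: pred_on.chain_def)
  then have "\<Union>(range f) \<in> range f" by (intro ideal_chain_is_trivial) auto
  then obtain n where "\<Union>(range f) = f n" by blast
  then have "f (Suc n) \<subseteq> f n" by blast
  with f(2)[of n] show False by blast
qed

section \<open>Chain condition for finitely generated modules\<close>

context Module.module
begin

text \<open>A submodule \<open>N\<close> of \<open>W + Rg\<close> is measured by the ideal of all
  \<open>c\<close> with \<open>c g\<close> in \<open>N + W\<close>, and by
  \<open>N \<inter> W\<close>. A strict inclusion enlarges the ideal, or leaves it fixed and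
  enlarges the intersection, so the lexicographic product of the two given relations
  applies.\<close>

lemma wf_submodules_adjoin:
  assumes wfR: "wf {(J, I). ideal I R \<and> ideal J R \<and> I \<subset> J}"
    and W: "submodule W R M" and g: "g \<in> carrier M"
    and wfW: "wf {(B, A). submodule A R M \<and> submodule B R M \<and> A \<subset> B \<and> B \<subseteq> W}"
  shows "wf {(B, A). submodule A R M \<and> submodule B R M \<and> A \<subset> B \<and> B \<subseteq> adjoin W g}"
proof -
  define L where "L N = {c \<in> carrier R. \<exists>w\<in>W. w \<oplus>\<^bsub>M\<^esub> c \<odot>\<^bsub>M\<^esub> g \<in> N}" for N
  note Wm = submodule_mem[OF W]
  have LI: "c \<in> L N" if "w \<in> W" "n \<in> N" "c \<in> carrier R" "w \<oplus>\<^bsub>M\<^esub> c \<odot>\<^bsub>M\<^esub> g = n" for c w n N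
    using that by (auto simp: L_def)
  have Lid: "ideal (L N) R" if N: "submodule N R M" for N
  proof (rule idealI)
    note Nm = submodule_mem[OF N]
    show "ring R" by (rule R.ring_axioms)
    have z: "\<zero> \<in> L N" by (rule LI[OF Wm(2) Nm(2)]) (use g in auto)
    show "subgroup (L N) (add_monoid R)"
    proof (rule R.add.subgroupI)
      show "L N \<noteq> {}" using z by blast
      show "L N \<subseteq> carrier R" by (auto simp: L_def)
    next
      fix a assume "a \<in> L N"
      then obtain w where a: "a \<in> carrier R" "w \<in> W" "w \<oplus>\<^bsub>M\<^esub> a \<odot>\<^bsub>M\<^esub> g \<in> N" by (auto simp: L_def)
      have "\<ominus>\<^bsub>M\<^esub> w \<oplus>\<^bsub>M\<^esub> (\<ominus> a) \<odot>\<^bsub>M\<^esub> g = \<ominus>\<^bsub>M\<^esub> (w \<oplus>\<^bsub>M\<^esub> a \<odot>\<^bsub>M\<^esub> g)"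
        using a(1) Wm(1)[OF a(2)] g by (simp add: smult_l_minus M.minus_add)
      then show "\<ominus> a \<in> L N" by (rule LI[OF Wm(4)[OF a(2)] Nm(4)[OF a(3)] R.a_inv_closed[OF a(1)]])
    next
      fix a b assume "a \<in> L N" "b \<in> L N"
      then obtain w v where a: "a \<in> carrier R" "w \<in> W" "w \<oplus>\<^bsub>M\<^esub> a \<odot>\<^bsub>M\<^esub> g \<in> N"
        and b: "b \<in> carrier R" "v \<in> W" "v \<oplus>\<^bsub>M\<^esub> b \<odot>\<^bsub>M\<^esub> g \<in> N" by (auto simp: L_def)
      have "(w \<oplus>\<^bsub>M\<^esub> v) \<oplus>\<^bsub>M\<^esub> (a \<oplus> b) \<odot>\<^bsub>M\<^esub> g = (w \<oplus>\<^bsub>M\<^esub> a \<odot>\<^bsub>M\<^esub> g) \<oplus>\<^bsub>M\<^esub> (v \<oplus>\<^bsub>M\<^esub> b \<odot>\<^bsub>M\<^esub> g)"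
        using a(1) Wm(1)[OF a(2)] b(1) Wm(1)[OF b(2)] g by (simp add: smult_l_distr M.a_ac)
      then show "a \<oplus> b \<in> L N"
        by (rule LI[OF Wm(3)[OF a(2) b(2)] Nm(3)[OF a(3) b(3)] R.a_closed[OF a(1) b(1)]])
    qed
    show l: "x \<otimes> a \<in> L N" if aL: "a \<in> L N" and x: "x \<in> carrier R" for a x
    proof -
      obtain w where a: "a \<in> carrier R" "w \<in> W" "w \<oplus>\<^bsub>M\<^esub> a \<odot>\<^bsub>M\<^esub> g \<in> N"
        using aL by (auto simp: L_def)
      have "x \<odot>\<^bsub>M\<^esub> w \<oplus>\<^bsub>M\<^esub> (x \<otimes> a) \<odot>\<^bsub>M\<^esub> g = x \<odot>\<^bsub>M\<^esub> (w \<oplus>\<^bsub>M\<^esub> a \<odot>\<^bsub>M\<^esub> g)"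
        using a(1) Wm(1)[OF a(2)] x g by (simp add: smult_assoc1 smult_r_distr)
      then show ?thesis by (rule LI[OF Wm(6)[OF x a(2)] Nm(6)[OF x a(3)] R.m_closed[OF x a(1)]])
    qed
    show "a \<otimes> x \<in> L N" if "a \<in> L N" and x: "x \<in> carrier R" for a x
      using l[OF that] that by (simp add: R.m_comm L_def)
  qed
  have NW: "submodule (N \<inter> W) R M" if "submodule N R M" for N
    by (rule submoduleI) (use Wm submodule_mem[OF that] in auto)
  have strict: "L A \<subset> L B \<or> L A = L B \<and> A \<inter> W \<subset> B \<inter> W"
    if A: "submodule A R M" and B: "submodule B R M" and AB: "A \<subset> B" and BW: "B \<subseteq> adjoin W g" for A B
  proof (rule ccontr)
    assume neg: "\<not> ?thesis"
    have "L A \<subseteq> L B" "A \<inter> W \<subseteq> B \<inter> W" using AB by (auto simp: L_def)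
    with neg have eqs: "L A = L B" "A \<inter> W = B \<inter> W" by auto
    \<comment> \<open>If both invariants agree, write \<open>b = w + c g\<close> and take
      \<open>v + c g\<close> in \<open>A\<close> with the same \<open>c\<close>. The difference
      \<open>v - w\<close> lies in \<open>B \<inter> W = A \<inter> W\<close>, so \<open>b\<close>
      lies in \<open>A\<close>.\<close>
    have "B \<subseteq> A"
    proof
      fix b assume b: "b \<in> B"
      then obtain w c where w: "w \<in> W" "c \<in> carrier R" "b = w \<oplus>\<^bsub>M\<^esub> c \<odot>\<^bsub>M\<^esub> g"
        using BW by (auto simp: adjoin_def)
      have "c \<in> L A" unfolding eqs(1) by (rule LI[OF w(1) b w(2) w(3)[symmetric]])
      then obtain v where v: "v \<in> W" "v \<oplus>\<^bsub>M\<^esub> c \<odot>\<^bsub>M\<^esub> g \<in> A" by (auto simp: L_def)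
      have wv: "w \<in> carrier M" "v \<in> carrier M" using Wm(1) w v by auto
      have d: "v \<ominus>\<^bsub>M\<^esub> w \<in> W" using Wm(5)[OF v(1) w(1)] .
      have e: "(v \<ominus>\<^bsub>M\<^esub> w) \<oplus>\<^bsub>M\<^esub> b = v \<oplus>\<^bsub>M\<^esub> c \<odot>\<^bsub>M\<^esub> g"
        unfolding w(3) using wv w(2) g M.a_assoc[of "v \<ominus>\<^bsub>M\<^esub> w" w "c \<odot>\<^bsub>M\<^esub> g"]
        by (simp add: M.add_minus_cancel)
      then have "(v \<ominus>\<^bsub>M\<^esub> w) \<oplus>\<^bsub>M\<^esub> b \<in> B" using v AB by auto
      then have "b \<oplus>\<^bsub>M\<^esub> (v \<ominus>\<^bsub>M\<^esub> w) \<in> B"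
        using wv submodule_mem(1)[OF B b] by (simp add: M.a_comm)
      then have "v \<ominus>\<^bsub>M\<^esub> w \<in> B"
        by (rule submodule_add_cancel[OF B b, rotated]) (use wv in simp)
      then have "v \<ominus>\<^bsub>M\<^esub> w \<in> A" using d eqs(2) by auto
      then show "b \<in> A"
        by (rule submodule_add_cancel[OF A]) (use e v submodule_mem(1)[OF B b] in auto)
    qed
    with AB show False by blast
  qed
  let ?r = "{(J, I). ideal I R \<and> ideal J R \<and> I \<subset> J} <*lex*>
      {(B, A). submodule A R M \<and> submodule B R M \<and> A \<subset> B \<and> B \<subseteq> W}"
  have "wf (inv_image ?r (\<lambda>N. (L N, N \<inter> W)))"
    by (intro wf_inv_image wf_lex_prod wfR wfW)
  then show ?thesis
  proof (rule wf_subset)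
    show "{(B, A). submodule A R M \<and> submodule B R M \<and> A \<subset> B \<and> B \<subseteq> adjoin W g}
        \<subseteq> inv_image ?r (\<lambda>N. (L N, N \<inter> W))"
    proof
      fix p assume "p \<in> {(B, A). submodule A R M \<and> submodule B R M \<and> A \<subset> B \<and> B \<subseteq> adjoin W g}"
      then obtain B A where p: "p = (B, A)" and A: "submodule A R M" and B: "submodule B R M"
        and AB: "A \<subset> B" "B \<subseteq> adjoin W g" by blast
      show "p \<in> inv_image ?r (\<lambda>N. (L N, N \<inter> W))"
        unfolding p in_inv_image in_lex_prod mem_Collect_eq prod.case
        using strict[OF A B AB] Lid[OF A] Lid[OF B] NW[OF A] NW[OF B] by blast
    qed
  qed
qed

text \<open>Generators are adjoined one at a time, starting from the zero submodule. The relation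
  \<open>P W\<close> is confined to submodules of \<open>W\<close>, so that the induction statement
  makes sense before all generators are present.\<close>

lemma wf_submodules_fg:
  assumes wfR: "wf {(J, I). ideal I R \<and> ideal J R \<and> I \<subset> J}"
    and S: "finite S" "S \<subseteq> carrier M" and span: "\<And>W. submodule W R M \<Longrightarrow> S \<subseteq> W \<Longrightarrow> W = carrier M"
  shows "wf {(B, A). submodule A R M \<and> submodule B R M \<and> A \<subset> B}"
proof -
  define P where "P W \<longleftrightarrow> wf {(B, A). submodule A R M \<and> submodule B R M \<and> A \<subset> B \<and> B \<subseteq> W}" for W
  have "\<exists>W. submodule W R M \<and> S \<subseteq> W \<and> P W"
    using S
  proof (induction S)
    case empty
    have "submodule {\<zero>\<^bsub>M\<^esub>} R M" by (rule submoduleI) auto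
    moreover have "P {\<zero>\<^bsub>M\<^esub>}"
      unfolding P_def
    proof (rule wf_subset, rule wf_on_bot, rule subsetI)
      fix p
      assume "p \<in> {(B, A). submodule A R M \<and> submodule B R M \<and> A \<subset> B \<and> B \<subseteq> {\<zero>\<^bsub>M\<^esub>}}"
      then obtain A B where "submodule A R M" "A \<subset> B" "B \<subseteq> {\<zero>\<^bsub>M\<^esub>}" by blast
      then show "p \<in> {}" using submodule_mem(2)[of A] by blast
    qed
    ultimately show ?case by (intro exI[of _ "{\<zero>\<^bsub>M\<^esub>}"] conjI empty_subsetI)
  next
    case (insert g S)
    then obtain W where W: "submodule W R M" "S \<subseteq> W" "P W" by auto
    have g: "g \<in> carrier M" using insert by simp
    have "P (adjoin W g)"
      using wf_submodules_adjoin[OF wfR W(1) g] W(3) unfolding P_def by blast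
    then show ?case
      using adjoin_submodule[OF W(1) g] W(2) by blast
  qed
  then obtain W where W: "submodule W R M" "S \<subseteq> W" and wf: "P W" by blast
  have eq: "W = carrier M" by (rule span[OF W])
  show ?thesis
    by (rule wf_subset[OF wf[unfolded P_def]]) (use eq submodule_mem(1) in blast)
qed

end

lemma fg_module_span_eq:
  assumes "fg_module R M"
  shows "\<exists>S. finite S \<and> S \<subseteq> carrier M \<and> (\<forall>W. submodule W R M \<longrightarrow> S \<subseteq> W \<longrightarrow> W = carrier M)"
proof -
  from assms obtain S where M: "Module.module R M" and S: "finite S" "S \<subseteq> carrier M"
    and gen: "module_span R M S = carrier M"
    by (auto simp: fg_module_def)
  have "W = carrier M" if "submodule W R M" "S \<subseteq> W" for W
    using gen that Module.module.submoduleE(1)[OF M that(1)] by (auto simp: module_span_def)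
  then show ?thesis using S by blast
qed

locale noeth_local = cring R + noetherian_ring R for R :: "('a, 'b) ring_scheme" (structure) +
  assumes local: "local_ring R"
begin

lemma maximal_above:
  assumes I: "ideal I R" "\<one> \<notin> I"
  shows "\<exists>m. maximalideal m R \<and> I \<subseteq> m"
proof -
  define \<F> where "\<F> = {J. ideal J R \<and> \<one> \<notin> J \<and> I \<subseteq> J}"
  have "I \<in> \<F>" using I by (simp add: \<F>_def)
  then obtain J where J: "J \<in> \<F>"
    and max: "\<And>L. (L, J) \<in> {(J, I). ideal I R \<and> ideal J R \<and> I \<subset> J} \<Longrightarrow> L \<notin> \<F>"
    by (rule wfE_min[OF wf_ideals]) blast
  have "maximalideal J R"
  proof (rule maximalidealI)
    show "ideal J R" using J by (simp add: \<F>_def)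
    show "carrier R \<noteq> J" using J by (auto simp: \<F>_def)
    fix L assume L: "ideal L R" "J \<subseteq> L" "L \<subseteq> carrier R"
    show "L = J \<or> L = carrier R"
    proof (rule disjCI)
      assume "L \<noteq> carrier R"
      then have "\<one> \<notin> L" using ideal.one_imp_carrier[OF L(1)] by blast
      then have "L \<in> \<F>" using L J by (auto simp: \<F>_def)
      then show "L = J" using max[of L] L J by (auto simp: \<F>_def)
    qed
  qed
  then show ?thesis using J by (auto simp: \<F>_def)
qed

lemma max_ideal_maximal: "maximalideal (max_ideal R) R"
  and max_ideal_unique: "maximalideal m R \<Longrightarrow> m = max_ideal R"
proof -
  have ex1: "\<exists>!m. maximalideal m R" using local by (simp add: local_ring_def)
  show "maximalideal (max_ideal R) R" unfolding max_ideal_def by (rule theI'[OF ex1])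
  then show "maximalideal m R \<Longrightarrow> m = max_ideal R" using ex1 by blast
qed

lemma max_ideal_ideal: "ideal (max_ideal R) R"
  using max_ideal_maximal by (simp add: maximalideal_def)

lemma one_not_in_max_ideal: "\<one> \<notin> max_ideal R"
  using maximalideal.I_notcarr[OF max_ideal_maximal] ideal.one_imp_carrier[OF max_ideal_ideal] by blast

lemma nonunit_in_max_ideal:
  assumes "a \<in> carrier R" "a \<notin> Units R"
  shows "a \<in> max_ideal R"
proof -
  have "\<one> \<notin> PIdl a"
  proof
    assume "\<one> \<in> PIdl a"
    then obtain b where "b \<in> carrier R" "\<one> = b \<otimes> a" by (auto simp: cgenideal_def)
    then have "a \<in> Units R" using assms(1) unfolding Units_def by (auto simp: m_comm intro!: bexI[of _ b])
    with assms(2) show False ..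
  qed
  then obtain m where "maximalideal m R" "PIdl a \<subseteq> m"
    using maximal_above[OF cgenideal_ideal[OF assms(1)]] by blast
  then show ?thesis using max_ideal_unique cgenideal_self[OF assms(1)] by blast
qed

lemma one_minus_unit:
  assumes "a \<in> max_ideal R"
  shows "\<one> \<ominus> a \<in> Units R"
proof (rule ccontr)
  assume n: "\<one> \<ominus> a \<notin> Units R"
  have a: "a \<in> carrier R" using ideal.Icarr[OF max_ideal_ideal assms] .
  have "(\<one> \<ominus> a) \<oplus> a \<in> max_ideal R"
    using nonunit_in_max_ideal[OF _ n] a assms max_ideal_ideal
    by (meson additive_subgroup.a_closed ideal.axioms(1) minus_closed one_closed)
  then show False using a one_not_in_max_ideal by (simp add: add_minus_cancel)
qed

lemma noeth_module_fg:
  assumes "fg_module R M"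
  shows "noeth_module R M (max_ideal R)"
proof -
  interpret M: Module.module R M using assms by (simp add: fg_module_def)
  obtain S where S: "finite S" "S \<subseteq> carrier M"
    and span: "\<forall>W. submodule W R M \<longrightarrow> S \<subseteq> W \<longrightarrow> W = carrier M"
    using fg_module_span_eq[OF assms] by metis
  have "wf {(B, A). submodule A R M \<and> submodule B R M \<and> A \<subset> B}"
    by (rule M.wf_submodules_fg[OF wf_ideals S]) (use span in simp)
  then show ?thesis
    by (intro noeth_module.intro noeth_module_axioms.intro M.module_axioms wf_ideals max_ideal_ideal one_minus_unit)
qed

end

section \<open>Linear forms and stable annihilators\<close>

text \<open>\<open>module_hom\<close> without extensionality, so that lambda terms and compositions
  qualify directly; \<open>lin_map_restrict\<close> converts back.\<close>

definition lin_map ::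
  "('a, 'b) ring_scheme \<Rightarrow> ('a, 'm, 'c) module_scheme \<Rightarrow> ('a, 'n, 'd) module_scheme \<Rightarrow> ('m \<Rightarrow> 'n) \<Rightarrow> bool" where
  "lin_map R M N f \<longleftrightarrow> (\<forall>x\<in>carrier M. f x \<in> carrier N) \<and>
     (\<forall>x\<in>carrier M. \<forall>y\<in>carrier M. f (x \<oplus>\<^bsub>M\<^esub> y) = f x \<oplus>\<^bsub>N\<^esub> f y) \<and>
     (\<forall>r\<in>carrier R. \<forall>x\<in>carrier M. f (r \<odot>\<^bsub>M\<^esub> x) = r \<odot>\<^bsub>N\<^esub> f x)"

lemma lin_mapD:
  assumes "lin_map R M N f"
  shows "x \<in> carrier M \<Longrightarrow> f x \<in> carrier N"
    and "x \<in> carrier M \<Longrightarrow> y \<in> carrier M \<Longrightarrow> f (x \<oplus>\<^bsub>M\<^esub> y) = f x \<oplus>\<^bsub>N\<^esub> f y"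
    and "r \<in> carrier R \<Longrightarrow> x \<in> carrier M \<Longrightarrow> f (r \<odot>\<^bsub>M\<^esub> x) = r \<odot>\<^bsub>N\<^esub> f x"
  using assms by (auto simp: lin_map_def)

lemma module_hom_iff: "f \<in> module_hom R M N \<longleftrightarrow> lin_map R M N f \<and> f \<in> extensional (carrier M)"
  by (auto simp: module_hom_def lin_map_def PiE_iff)

lemma lin_map_restrict:
  assumes "Module.module R M" "lin_map R M N f"
  shows "restrict f (carrier M) \<in> module_hom R M N"
proof -
  interpret Module.module R M by fact
  show ?thesis using assms(2) by (auto simp: module_hom_iff lin_map_def)
qed

lemma lin_map_comp:
  assumes "lin_map R M N f" "lin_map R N L g"
  shows "lin_map R M L (\<lambda>x. g (f x))"
  using assms by (simp add: lin_map_def)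

lemma regular_module_simps [simp]:
  "carrier (regular_module R) = carrier R" "add (regular_module R) = add R"
  "zero (regular_module R) = zero R" "smult (regular_module R) = mult R"
  by (simp_all add: regular_module_def)

lemma regular_module_module:
  assumes "cring R"
  shows "Module.module R (regular_module R)"
proof -
  interpret cring R by fact
  show ?thesis
  proof (rule Module.moduleI)
    show "abelian_group (regular_module R)"
      by (rule abelian_groupI) (auto simp: a_ac intro: bexI[of _ "\<ominus>\<^bsub>R\<^esub> x" for x] l_neg)
  qed (use assms in \<open>auto simp: l_distr r_distr m_assoc\<close>)
qed

text \<open>Stated for additive rather than linear maps, so that it also applies to the reductions
  \<open>\<rho>\<close> and \<open>\<psi>\<close>, which change the ring of scalars.\<close>

lemma finsum_additive:
  assumes "abelian_group M" "abelian_group N" "finite A"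
    and f: "\<And>x. x \<in> carrier M \<Longrightarrow> f x \<in> carrier N"
    "\<And>x y. x \<in> carrier M \<Longrightarrow> y \<in> carrier M \<Longrightarrow> f (x \<oplus>\<^bsub>M\<^esub> y) = f x \<oplus>\<^bsub>N\<^esub> f y"
    and "\<And>i. i \<in> A \<Longrightarrow> v i \<in> carrier M"
  shows "f (\<Oplus>\<^bsub>M\<^esub>i\<in>A. v i) = (\<Oplus>\<^bsub>N\<^esub>i\<in>A. f (v i))"
  using assms(3,6)
proof (induction A)
  case empty
  interpret M: abelian_group M by fact
  interpret N: abelian_group N by fact
  have "f \<zero>\<^bsub>M\<^esub> \<oplus>\<^bsub>N\<^esub> f \<zero>\<^bsub>M\<^esub> = f \<zero>\<^bsub>M\<^esub>" using f(2)[of "\<zero>\<^bsub>M\<^esub>" "\<zero>\<^bsub>M\<^esub>"] by simp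
  then show ?case using f(1)[of "\<zero>\<^bsub>M\<^esub>"] by simp
next
  case (insert a A)
  interpret M: abelian_group M by fact
  interpret N: abelian_group N by fact
  have m: "v \<in> A \<rightarrow> carrier M" "v a \<in> carrier M" using insert.prems by auto
  have n: "(\<lambda>i. f (v i)) \<in> A \<rightarrow> carrier N" "f (v a) \<in> carrier N"
    using insert.prems f(1) by auto
  have "f (\<Oplus>\<^bsub>M\<^esub>i\<in>insert a A. v i) = f (v a \<oplus>\<^bsub>M\<^esub> (\<Oplus>\<^bsub>M\<^esub>i\<in>A. v i))"
    by (simp add: M.finsum_insert[OF insert.hyps m])
  also have "\<dots> = f (v a) \<oplus>\<^bsub>N\<^esub> f (\<Oplus>\<^bsub>M\<^esub>i\<in>A. v i)"
    by (rule f(2)[OF m(2) M.finsum_closed[OF m(1)]])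
  also have "f (\<Oplus>\<^bsub>M\<^esub>i\<in>A. v i) = (\<Oplus>\<^bsub>N\<^esub>i\<in>A. f (v i))" using insert.IH insert.prems by simp
  finally show ?case by (simp add: N.finsum_insert[OF insert.hyps n])
qed

context Module.module
begin

lemma lin_map_zero:
  assumes "Module.module R N" "lin_map R M N f"
  shows "f \<zero>\<^bsub>M\<^esub> = \<zero>\<^bsub>N\<^esub>"
proof -
  interpret N: Module.module R N by fact
  have "f (\<zero>\<^bsub>R\<^esub> \<odot>\<^bsub>M\<^esub> \<zero>\<^bsub>M\<^esub>) = \<zero>\<^bsub>R\<^esub> \<odot>\<^bsub>N\<^esub> f \<zero>\<^bsub>M\<^esub>"
    by (rule lin_mapD(3)[OF assms(2)]) auto
  then show ?thesis using lin_mapD(1)[OF assms(2), of "\<zero>\<^bsub>M\<^esub>"] by simp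
qed

lemma lin_map_finsum:
  assumes N: "Module.module R N" and f: "lin_map R M N f" and "finite A" "\<And>i. i \<in> A \<Longrightarrow> v i \<in> carrier M"
  shows "f (\<Oplus>\<^bsub>M\<^esub>i\<in>A. v i) = (\<Oplus>\<^bsub>N\<^esub>i\<in>A. f (v i))"
proof -
  interpret N: Module.module R N by (rule N)
  show ?thesis
    by (rule finsum_additive[OF M.abelian_group_axioms N.abelian_group_axioms assms(3)
          lin_mapD(1,2)[OF f] assms(4)])
qed

lemma submodule_finsum:
  assumes W: "submodule W R M" and "finite A" "\<And>i. i \<in> A \<Longrightarrow> v i \<in> W"
  shows "(\<Oplus>\<^bsub>M\<^esub>i\<in>A. v i) \<in> W"
  using assms(2,3)
proof (induction A)
  case empty
  show ?case using submodule_mem(2)[OF W] by simp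
next
  case (insert a A)
  then have "v \<in> A \<rightarrow> carrier M" "v a \<in> carrier M" using submodule_mem(1)[OF W] by auto
  then show ?case using insert submodule_mem(3)[OF W] by (simp add: M.finsum_insert)
qed

lemma lin_map_image_submodule:
  assumes N: "Module.module R N" and f: "lin_map R M N f"
  shows "submodule (f ` carrier M) R N"
proof -
  interpret N: Module.module R N by (rule N)
  show ?thesis
  proof (rule N.submoduleI)
    show "f ` carrier M \<subseteq> carrier N" using lin_mapD(1)[OF f] by blast
    show "\<zero>\<^bsub>N\<^esub> \<in> f ` carrier M" using lin_map_zero[OF N f] by (metis M.zero_closed imageI)
    show s: "r \<odot>\<^bsub>N\<^esub> a \<in> f ` carrier M" if "r \<in> carrier R" "a \<in> f ` carrier M" for r a
      using that lin_mapD(3)[OF f that(1), symmetric] by auto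
    show "a \<oplus>\<^bsub>N\<^esub> b \<in> f ` carrier M" if "a \<in> f ` carrier M" "b \<in> f ` carrier M" for a b
      using that lin_mapD(2)[OF f, symmetric] by auto
    show "\<ominus>\<^bsub>N\<^esub> a \<in> f ` carrier M" if a: "a \<in> f ` carrier M" for a
    proof -
      have "a \<in> carrier N" using a lin_mapD(1)[OF f] by blast
      then have "\<ominus>\<^bsub>N\<^esub> a = (\<ominus>\<^bsub>R\<^esub> \<one>\<^bsub>R\<^esub>) \<odot>\<^bsub>N\<^esub> a" by (simp add: N.smult_l_minus)
      then show ?thesis using s[OF _ a, of "\<ominus>\<^bsub>R\<^esub> \<one>\<^bsub>R\<^esub>"] by simp
    qed
  qed
qed

lemma lin_map_inverse:
  assumes f: "lin_map R M N f" and bij: "bij_betw f (carrier M) (carrier N)"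
  defines "g \<equiv> inv_into (carrier M) f"
  shows "lin_map R N M g" "\<And>x. x \<in> carrier M \<Longrightarrow> g (f x) = x" "\<And>y. y \<in> carrier N \<Longrightarrow> f (g y) = y"
proof -
  show gf: "g (f x) = x" if "x \<in> carrier M" for x
    using bij that unfolding g_def by (simp add: bij_betw_inv_into_left)
  show fg: "f (g y) = y" if "y \<in> carrier N" for y
    using bij that unfolding g_def by (simp add: bij_betw_inv_into_right)
  have gc: "g y \<in> carrier M" if "y \<in> carrier N" for y
    using bij that unfolding g_def by (metis bij_betw_def inv_into_into)
  have "g (a \<oplus>\<^bsub>N\<^esub> b) = g a \<oplus>\<^bsub>M\<^esub> g b" if "a \<in> carrier N" "b \<in> carrier N" for a b
  proof -
    have "f (g a \<oplus>\<^bsub>M\<^esub> g b) = a \<oplus>\<^bsub>N\<^esub> b" using lin_mapD(2)[OF f] gc fg that by simp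
    then show ?thesis using gf[of "g a \<oplus>\<^bsub>M\<^esub> g b"] gc that by simp
  qed
  moreover have "g (r \<odot>\<^bsub>N\<^esub> a) = r \<odot>\<^bsub>M\<^esub> g a" if "r \<in> carrier R" "a \<in> carrier N" for r a
  proof -
    have "f (r \<odot>\<^bsub>M\<^esub> g a) = r \<odot>\<^bsub>N\<^esub> a" using lin_mapD(3)[OF f] gc fg that by simp
    then show ?thesis using gf[of "r \<odot>\<^bsub>M\<^esub> g a"] gc that by simp
  qed
  ultimately show "lin_map R N M g" using gc by (simp add: lin_map_def)
qed

end

lemma lin_map_combination:
  assumes M: "Module.module R M" and N: "Module.module R N"
    and \<phi>: "\<And>i. i < (n::nat) \<Longrightarrow> lin_map R M (regular_module R) (\<phi> i)" and v: "\<And>i. i < n \<Longrightarrow> v i \<in> carrier N"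
  shows "lin_map R M N (\<lambda>y. \<Oplus>\<^bsub>N\<^esub>i\<in>{..<n}. \<phi> i y \<odot>\<^bsub>N\<^esub> v i)"
proof -
  interpret M: Module.module R M by (rule M)
  interpret N: Module.module R N by (rule N)
  have c: "\<phi> i y \<in> carrier R" if "i < n" "y \<in> carrier M" for i y
    using lin_mapD(1)[OF \<phi>] that by simp
  have f: "(\<lambda>i. \<phi> i y \<odot>\<^bsub>N\<^esub> v i) \<in> {..<n} \<rightarrow> carrier N" if "y \<in> carrier M" for y
    using c v that by auto
  show ?thesis
    unfolding lin_map_def
  proof (intro conjI ballI)
    fix y assume y: "y \<in> carrier M"
    show "(\<Oplus>\<^bsub>N\<^esub>i\<in>{..<n}. \<phi> i y \<odot>\<^bsub>N\<^esub> v i) \<in> carrier N" by (rule N.M.finsum_closed[OF f[OF y]])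
    fix z assume z: "z \<in> carrier M"
    show "(\<Oplus>\<^bsub>N\<^esub>i\<in>{..<n}. \<phi> i (y \<oplus>\<^bsub>M\<^esub> z) \<odot>\<^bsub>N\<^esub> v i) =
        (\<Oplus>\<^bsub>N\<^esub>i\<in>{..<n}. \<phi> i y \<odot>\<^bsub>N\<^esub> v i) \<oplus>\<^bsub>N\<^esub> (\<Oplus>\<^bsub>N\<^esub>i\<in>{..<n}. \<phi> i z \<odot>\<^bsub>N\<^esub> v i)"
      unfolding N.M.finsum_addf[OF f[OF y] f[OF z], symmetric]
      by (rule N.M.finsum_cong')
        (use y z c v lin_mapD(2)[OF \<phi>] in \<open>auto simp: N.smult_l_distr\<close>)
  next
    fix r y assume r: "r \<in> carrier R" and y: "y \<in> carrier M"
    show "(\<Oplus>\<^bsub>N\<^esub>i\<in>{..<n}. \<phi> i (r \<odot>\<^bsub>M\<^esub> y) \<odot>\<^bsub>N\<^esub> v i) = r \<odot>\<^bsub>N\<^esub> (\<Oplus>\<^bsub>N\<^esub>i\<in>{..<n}. \<phi> i y \<odot>\<^bsub>N\<^esub> v i)"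
      unfolding N.finsum_smult_ldistr[OF finite_lessThan r f[OF y]]
      by (rule N.M.finsum_cong')
        (use y r c v lin_mapD(3)[OF \<phi>] in \<open>auto simp: N.smult_assoc1\<close>)
  qed
qed

text \<open>The canonical map from \<open>Hom(M, R) \<otimes> N\<close> to \<open>Hom(M, N)\<close>
  sends the sum of the tensors \<open>\<phi> i \<otimes> v i\<close> to \<open>f\<close>. Only the
  values of \<open>f\<close> on the carrier are constrained.\<close>

definition rep_by ::
  "('a, 'b) ring_scheme \<Rightarrow> ('a, 'm, 'c) module_scheme \<Rightarrow> ('a, 'n, 'd) module_scheme \<Rightarrow>
    nat \<Rightarrow> (nat \<Rightarrow> 'm \<Rightarrow> 'a) \<Rightarrow> (nat \<Rightarrow> 'n) \<Rightarrow> ('m \<Rightarrow> 'n) \<Rightarrow> bool" where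
  "rep_by R M N n \<phi> v f \<longleftrightarrow>
     (\<forall>i<n. lin_map R M (regular_module R) (\<phi> i)) \<and> (\<forall>i<n. v i \<in> carrier N) \<and>
     (\<forall>y\<in>carrier M. f y = (\<Oplus>\<^bsub>N\<^esub>i\<in>{..<n}. \<phi> i y \<odot>\<^bsub>N\<^esub> v i))"

text \<open>Membership in the image of that canonical map, an explicit form of factoring through a
  finite free module. By \<open>proj_maps_iff\<close> it describes the maps that vanish in the
  stable category.\<close>

definition dual_rep ::
  "('a, 'b) ring_scheme \<Rightarrow> ('a, 'm, 'c) module_scheme \<Rightarrow> ('a, 'n, 'd) module_scheme \<Rightarrow> ('m \<Rightarrow> 'n) \<Rightarrow> bool" where
  "dual_rep R M N f \<longleftrightarrow> (\<exists>n \<phi> v. rep_by R M N n \<phi> v f)"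

lemma rep_byD:
  assumes "rep_by R M N n \<phi> v f"
  shows "\<And>i. i < n \<Longrightarrow> lin_map R M (regular_module R) (\<phi> i)" "\<And>i. i < n \<Longrightarrow> v i \<in> carrier N"
    "\<And>y. y \<in> carrier M \<Longrightarrow> f y = (\<Oplus>\<^bsub>N\<^esub>i\<in>{..<n}. \<phi> i y \<odot>\<^bsub>N\<^esub> v i)"
    "\<And>i y. i < n \<Longrightarrow> y \<in> carrier M \<Longrightarrow> \<phi> i y \<in> carrier R"
proof -
  show 1: "\<And>i. i < n \<Longrightarrow> lin_map R M (regular_module R) (\<phi> i)" using assms by (simp add: rep_by_def)
  show "\<And>i. i < n \<Longrightarrow> v i \<in> carrier N" using assms by (simp add: rep_by_def)
  show "\<And>y. y \<in> carrier M \<Longrightarrow> f y = (\<Oplus>\<^bsub>N\<^esub>i\<in>{..<n}. \<phi> i y \<odot>\<^bsub>N\<^esub> v i)" using assms by (simp add: rep_by_def)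
  show "\<phi> i y \<in> carrier R" if "i < n" "y \<in> carrier M" for i y
    using lin_mapD(1)[OF 1[OF that(1)] that(2)] by simp
qed

lemma dual_repI:
  assumes "\<And>i. i < (n::nat) \<Longrightarrow> lin_map R M (regular_module R) (\<phi> i)" "\<And>i. i < n \<Longrightarrow> v i \<in> carrier N"
    "\<And>y. y \<in> carrier M \<Longrightarrow> f y = (\<Oplus>\<^bsub>N\<^esub>i\<in>{..<n}. \<phi> i y \<odot>\<^bsub>N\<^esub> v i)"
  shows "dual_rep R M N f"
  unfolding dual_rep_def rep_by_def using assms by blast

lemma dual_rep_cong:
  assumes "dual_rep R M N f" "\<And>y. y \<in> carrier M \<Longrightarrow> g y = f y"
  shows "dual_rep R M N g"
  using assms unfolding dual_rep_def rep_by_def by simp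

lemma dual_rep_zero:
  assumes "Module.module R N" "\<And>y. y \<in> carrier M \<Longrightarrow> f y = \<zero>\<^bsub>N\<^esub>"
  shows "dual_rep R M N f"
proof -
  interpret N: Module.module R N by fact
  show ?thesis by (rule dual_repI[where n = 0]) (use assms(2) in auto)
qed

text \<open>Composition is absorbed on both sides: \<open>u\<close> is composed into the forms, and
  \<open>g\<close> is applied to the vectors.\<close>

lemma dual_rep_comp:
  assumes N: "Module.module R N" "Module.module R N'"
    and f: "dual_rep R M N f" and u: "lin_map R M' M u" and g: "lin_map R N N' g"
  shows "dual_rep R M' N' (\<lambda>y. g (f (u y)))"
proof -
  interpret N: Module.module R N by fact
  interpret N': Module.module R N' by fact
  from f obtain n \<phi> v where "rep_by R M N n \<phi> v f" unfolding dual_rep_def by blast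
  note \<phi> = rep_byD(1)[OF this] and v = rep_byD(2)[OF this] and fe = rep_byD(3)[OF this]
  show ?thesis
  proof (rule dual_repI[where n = n and \<phi> = "\<lambda>i y. \<phi> i (u y)" and v = "\<lambda>i. g (v i)"])
    show "lin_map R M' (regular_module R) (\<lambda>y. \<phi> i (u y))" if "i < n" for i
      by (rule lin_map_comp[OF u \<phi>[OF that]])
    show "g (v i) \<in> carrier N'" if "i < n" for i using lin_mapD(1)[OF g v[OF that]] .
    fix y assume y: "y \<in> carrier M'"
    have c: "\<phi> i (u y) \<in> carrier R" if "i < n" for i
      using lin_mapD(1)[OF \<phi>[OF that]] lin_mapD(1)[OF u y] by simp
    have "g (f (u y)) = (\<Oplus>\<^bsub>N'\<^esub>i\<in>{..<n}. g (\<phi> i (u y) \<odot>\<^bsub>N\<^esub> v i))"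
      unfolding fe[OF lin_mapD(1)[OF u y]]
      by (rule N.lin_map_finsum[OF N(2) g]) (use c v in auto)
    also have "\<dots> = (\<Oplus>\<^bsub>N'\<^esub>i\<in>{..<n}. \<phi> i (u y) \<odot>\<^bsub>N'\<^esub> g (v i))"
      by (rule N'.M.finsum_cong') (use c v lin_mapD(1,3)[OF g] in auto)
    finally show "g (f (u y)) = (\<Oplus>\<^bsub>N'\<^esub>i\<in>{..<n}. \<phi> i (u y) \<odot>\<^bsub>N'\<^esub> g (v i))" .
  qed
qed

lemma dual_rep_smult:
  assumes N: "Module.module R N" and f: "dual_rep R M N f" and M: "Module.module R M" and r: "r \<in> carrier R"
  shows "dual_rep R M N (\<lambda>y. r \<odot>\<^bsub>N\<^esub> f y)"
proof -
  interpret N: Module.module R N by fact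
  have "lin_map R N N (\<lambda>y. r \<odot>\<^bsub>N\<^esub> y)"
    using r by (auto simp: lin_map_def N.smult_r_distr N.smult_commute[of r])
  moreover have "lin_map R M M (\<lambda>y. y)"
    using M by (simp add: lin_map_def)
  ultimately show ?thesis using dual_rep_comp[OF N N f] by blast
qed

lemma dual_rep_add_term:
  assumes N: "Module.module R N" and f: "dual_rep R M N f"
    and \<psi>: "lin_map R M (regular_module R) \<psi>" and w: "w \<in> carrier N"
  shows "dual_rep R M N (\<lambda>y. \<psi> y \<odot>\<^bsub>N\<^esub> w \<oplus>\<^bsub>N\<^esub> f y)"
proof -
  interpret N: Module.module R N by fact
  from f obtain n \<phi> v where "rep_by R M N n \<phi> v f" unfolding dual_rep_def by blast
  note \<phi> = rep_byD(1)[OF this] and v = rep_byD(2)[OF this] and fe = rep_byD(3)[OF this]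
  show ?thesis
  proof (rule dual_repI[where n = "Suc n" and \<phi> = "\<phi>(n := \<psi>)" and v = "v(n := w)"])
    show "lin_map R M (regular_module R) ((\<phi>(n := \<psi>)) i)" if "i < Suc n" for i
      using that \<phi> \<psi> by (auto simp: less_Suc_eq)
    show "(v(n := w)) i \<in> carrier N" if "i < Suc n" for i
      using that v w by (auto simp: less_Suc_eq)
    fix y assume y: "y \<in> carrier M"
    have c: "\<phi> i y \<in> carrier R" if "i < n" for i using lin_mapD(1)[OF \<phi>[OF that] y] by simp
    have cy: "\<psi> y \<in> carrier R" using lin_mapD(1)[OF \<psi> y] by simp
    have "(\<Oplus>\<^bsub>N\<^esub>i\<in>{..<Suc n}. (\<phi>(n := \<psi>)) i y \<odot>\<^bsub>N\<^esub> (v(n := w)) i) =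
      \<psi> y \<odot>\<^bsub>N\<^esub> w \<oplus>\<^bsub>N\<^esub> (\<Oplus>\<^bsub>N\<^esub>i\<in>{..<n}. (\<phi>(n := \<psi>)) i y \<odot>\<^bsub>N\<^esub> (v(n := w)) i)"
      unfolding lessThan_Suc by (subst N.M.finsum_insert) (use c v cy w in auto)
    also have "(\<Oplus>\<^bsub>N\<^esub>i\<in>{..<n}. (\<phi>(n := \<psi>)) i y \<odot>\<^bsub>N\<^esub> (v(n := w)) i) = f y"
      unfolding fe[OF y] by (rule N.M.finsum_cong') (use c v in auto)
    finally show "\<psi> y \<odot>\<^bsub>N\<^esub> w \<oplus>\<^bsub>N\<^esub> f y =
      (\<Oplus>\<^bsub>N\<^esub>i\<in>{..<Suc n}. (\<phi>(n := \<psi>)) i y \<odot>\<^bsub>N\<^esub> (v(n := w)) i)" ..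
  qed
qed

lemma dual_rep_add:
  assumes N: "Module.module R N" and f: "dual_rep R M N f" and g: "dual_rep R M N g"
  shows "dual_rep R M N (\<lambda>y. f y \<oplus>\<^bsub>N\<^esub> g y)"
proof -
  interpret N: Module.module R N by fact
  from f obtain n \<phi> v where "rep_by R M N n \<phi> v f" unfolding dual_rep_def by blast
  note \<phi> = rep_byD(1)[OF this] and v = rep_byD(2)[OF this] and fe = rep_byD(3)[OF this]
  have gc: "g y \<in> carrier N" if y: "y \<in> carrier M" for y
  proof -
    from g obtain k \<psi> w where "rep_by R M N k \<psi> w g" unfolding dual_rep_def by blast
  note \<psi> = rep_byD(1)[OF this] and w = rep_byD(2)[OF this] and ge = rep_byD(3)[OF this]
    show ?thesis unfolding ge[OF y]
      by (rule N.M.finsum_closed) (use lin_mapD(1)[OF \<psi> y] w in auto)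
  qed
  \<comment> \<open>The terms of \<open>f\<close> are put on top of \<open>g\<close> one by one with
    \<open>dual_rep_add_term\<close>, which avoids joining two index ranges.\<close>
  have "dual_rep R M N (\<lambda>y. (\<Oplus>\<^bsub>N\<^esub>i\<in>{..<m}. \<phi> i y \<odot>\<^bsub>N\<^esub> v i) \<oplus>\<^bsub>N\<^esub> g y)" if "m \<le> n" for m
    using that
  proof (induction m)
    case 0
    show ?case by (rule dual_rep_cong[OF g]) (use gc in auto)
  next
    case (Suc m)
    have c: "\<phi> i y \<in> carrier R" "v i \<in> carrier N" if "i < Suc m" "y \<in> carrier M" for i y
      using lin_mapD(1)[OF \<phi>, of i y] v[of i] that Suc.prems by auto
    have "dual_rep R M N (\<lambda>y. \<phi> m y \<odot>\<^bsub>N\<^esub> v m \<oplus>\<^bsub>N\<^esub> ((\<Oplus>\<^bsub>N\<^esub>i\<in>{..<m}. \<phi> i y \<odot>\<^bsub>N\<^esub> v i) \<oplus>\<^bsub>N\<^esub> g y))"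
      by (rule dual_rep_add_term[OF N]) (use Suc \<phi> v in auto)
    then show ?case
    proof (rule dual_rep_cong)
      fix y assume y: "y \<in> carrier M"
      have s: "(\<Oplus>\<^bsub>N\<^esub>i\<in>{..<m}. \<phi> i y \<odot>\<^bsub>N\<^esub> v i) \<in> carrier N"
        by (rule N.M.finsum_closed) (use c y in auto)
      have "(\<Oplus>\<^bsub>N\<^esub>i\<in>{..<Suc m}. \<phi> i y \<odot>\<^bsub>N\<^esub> v i) = \<phi> m y \<odot>\<^bsub>N\<^esub> v m \<oplus>\<^bsub>N\<^esub> (\<Oplus>\<^bsub>N\<^esub>i\<in>{..<m}. \<phi> i y \<odot>\<^bsub>N\<^esub> v i)"
        unfolding lessThan_Suc by (subst N.M.finsum_insert) (use c y in auto)
      then show "(\<Oplus>\<^bsub>N\<^esub>i\<in>{..<Suc m}. \<phi> i y \<odot>\<^bsub>N\<^esub> v i) \<oplus>\<^bsub>N\<^esub> g y =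
        \<phi> m y \<odot>\<^bsub>N\<^esub> v m \<oplus>\<^bsub>N\<^esub> ((\<Oplus>\<^bsub>N\<^esub>i\<in>{..<m}. \<phi> i y \<odot>\<^bsub>N\<^esub> v i) \<oplus>\<^bsub>N\<^esub> g y)"
        using s gc[OF y] c[OF _ y, of m] by (simp add: N.M.a_assoc)
    qed
  qed
  from this[of n] show ?thesis by (rule dual_rep_cong[OF _]) (simp_all add: fe)
qed

text \<open>\<open>R^n\<close> as sequences that vanish from \<open>n\<close> on: equality of
  vectors is equality of functions, and \<open>nat => 'a\<close> is the type whose sets form the
  universe, which \<open>free_in_universe\<close> exploits.\<close>

definition free_mod :: "('a, 'b) ring_scheme \<Rightarrow> nat \<Rightarrow> ('a, nat \<Rightarrow> 'a) module" where
  "free_mod R n = \<lparr>carrier = {c. (\<forall>i. c i \<in> carrier R) \<and> (\<forall>i\<ge>n. c i = \<zero>\<^bsub>R\<^esub>)},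
     mult = undefined, one = undefined, zero = (\<lambda>i. \<zero>\<^bsub>R\<^esub>),
     add = (\<lambda>c d i. c i \<oplus>\<^bsub>R\<^esub> d i), smult = (\<lambda>r c i. r \<otimes>\<^bsub>R\<^esub> c i)\<rparr>"

lemma free_mod_simps [simp]:
  "c \<in> carrier (free_mod R n) \<longleftrightarrow> (\<forall>i. c i \<in> carrier R) \<and> (\<forall>i\<ge>n. c i = \<zero>\<^bsub>R\<^esub>)"
  "zero (free_mod R n) = (\<lambda>i. \<zero>\<^bsub>R\<^esub>)"
  "add (free_mod R n) c d = (\<lambda>i. c i \<oplus>\<^bsub>R\<^esub> d i)"
  "smult (free_mod R n) r c = (\<lambda>i. r \<otimes>\<^bsub>R\<^esub> c i)"
  by (simp_all add: free_mod_def)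

section \<open>Dual bases, projective modules and stable annihilators\<close>

context cring
begin

lemma free_mod_module: "Module.module R (free_mod R n)"
proof (rule Module.moduleI)
  show "cring R" by (rule is_cring)
  show "abelian_group (free_mod R n)"
  proof (rule abelian_groupI)
    fix c assume c: "c \<in> carrier (free_mod R n)"
    show "\<exists>d\<in>carrier (free_mod R n). d \<oplus>\<^bsub>free_mod R n\<^esub> c = \<zero>\<^bsub>free_mod R n\<^esub>"
      by (rule bexI[of _ "\<lambda>i. \<ominus> c i"]) (use c in \<open>auto simp: l_neg\<close>)
  qed (auto simp: a_ac)
qed (auto simp: l_distr r_distr m_assoc)

lemma free_mod_proj: "lin_map R (free_mod R n) (regular_module R) (\<lambda>c. c i)"
  by (auto simp: lin_map_def)

definition unit_vec :: "nat \<Rightarrow> nat \<Rightarrow> 'a" where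
  "unit_vec i = (\<lambda>j. if i = j then \<one> else \<zero>)"

lemma unit_vec_in: "i < n \<Longrightarrow> unit_vec i \<in> carrier (free_mod R n)"
  by (auto simp: unit_vec_def)

lemma free_mod_rep: "dual_rep R (free_mod R n) (free_mod R n) (\<lambda>c. c)"
proof (rule dual_repI[where n = n and \<phi> = "\<lambda>i c. c i" and v = unit_vec])
  interpret F: Module.module R "free_mod R n" by (rule free_mod_module)
  fix c assume c: "c \<in> carrier (free_mod R n)"
  have cl: "c i \<odot>\<^bsub>free_mod R n\<^esub> unit_vec i \<in> carrier (free_mod R n)" if "i < n" for i
    by (rule F.smult_closed[OF _ unit_vec_in[OF that]]) (use c in auto)
  \<comment> \<open>Coordinates are linear, so the sum may be evaluated at each \<open>j\<close>,
    where only the term \<open>i = j\<close> survives; for \<open>j \<ge> n\<close> both sides are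
    zero.\<close>
  have "(\<Oplus>\<^bsub>free_mod R n\<^esub>i\<in>{..<n}. c i \<odot>\<^bsub>free_mod R n\<^esub> unit_vec i) j = c j" for j
  proof -
    have "(\<Oplus>\<^bsub>free_mod R n\<^esub>i\<in>{..<n}. c i \<odot>\<^bsub>free_mod R n\<^esub> unit_vec i) j =
        (\<Oplus>\<^bsub>regular_module R\<^esub>i\<in>{..<n}. (c i \<odot>\<^bsub>free_mod R n\<^esub> unit_vec i) j)"
      by (rule F.lin_map_finsum[OF regular_module_module[OF is_cring] free_mod_proj])
        (simp_all only: lessThan_iff cl finite_lessThan)
    also have "\<dots> = (\<Oplus>\<^bsub>regular_module R\<^esub>i\<in>{..<n}. if j = i then c i else \<zero>\<^bsub>regular_module R\<^esub>)"
    proof -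
      interpret G: Module.module R "regular_module R" by (rule regular_module_module[OF is_cring])
      show ?thesis by (rule G.M.finsum_cong') (use c in \<open>auto simp: unit_vec_def\<close>)
    qed
    also have "\<dots> = c j"
    proof -
      interpret G: Module.module R "regular_module R" by (rule regular_module_module[OF is_cring])
      show ?thesis
      proof (cases "j < n")
        case True
        then show ?thesis by (intro G.M.finsum_singleton) (use c in auto)
      next
        case False
        have "(\<Oplus>\<^bsub>regular_module R\<^esub>i\<in>{..<n}. if j = i then c i else \<zero>\<^bsub>regular_module R\<^esub>) =
          (\<Oplus>\<^bsub>regular_module R\<^esub>i\<in>{..<n}. \<zero>\<^bsub>regular_module R\<^esub>)"
          by (rule G.M.finsum_cong') (use False in auto)
        then show ?thesis using c False unfolding G.M.finsum_zero by simp
      qed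
    qed
    finally show ?thesis .
  qed
  then show "c = (\<Oplus>\<^bsub>free_mod R n\<^esub>i\<in>{..<n}. c i \<odot>\<^bsub>free_mod R n\<^esub> unit_vec i)" by auto
qed (rule free_mod_proj, rule unit_vec_in)

text \<open>\<open>proj_maps\<close> and \<open>projective_module\<close> quantify over modules with
  elements in the universe, while vectors have type \<open>nat => 'a\<close>. The passage to
  singletons provides a copy of the right type.\<close>

lemma free_in_universe:
  obtains F :: "('a, 'a univ) module" and \<theta> \<theta>' where
    "Module.module R F" "lin_map R (free_mod R n) F \<theta>" "lin_map R F (free_mod R n) \<theta>'"
    "\<forall>c\<in>carrier (free_mod R n). \<theta>' (\<theta> c) = c" "\<forall>z\<in>carrier F. \<theta> (\<theta>' z) = z"
proof -
  interpret F: Module.module R "free_mod R n" by (rule free_mod_module)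
  have "inj_on (\<lambda>c. {c}) (carrier (free_mod R n))" by (rule inj_onI) blast
  from module_transport[OF free_mod_module this] obtain F :: "('a, 'a univ) module" where
    F: "Module.module R F" "module_iso R (free_mod R n) F" by blast
  then obtain \<theta> where \<theta>: "lin_map R (free_mod R n) F \<theta>" "bij_betw \<theta> (carrier (free_mod R n)) (carrier F)"
    by (auto simp: module_iso_def module_hom_iff)
  show ?thesis
    by (rule that[OF F(1) \<theta>(1) F.lin_map_inverse(1)[OF \<theta>]])
      (use F.lin_map_inverse(2,3)[OF \<theta>] in blast)+
qed

lemma rep_id_fg:
  assumes P: "Module.module R P" and rep: "dual_rep R P P (\<lambda>y. y)"
  shows "fg_module R P"
proof -
  interpret P: Module.module R P by (rule P)
  from rep obtain n \<phi> v where "rep_by R P P n \<phi> v (\<lambda>y. y)" unfolding dual_rep_def by blast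
  note D = rep_byD[OF this]
  have "W = carrier P" if W: "submodule W R P" "v ` {..<n} \<subseteq> W" for W
  proof
    show "W \<subseteq> carrier P" using P.submodule_mem(1)[OF W(1)] by blast
    show "carrier P \<subseteq> W"
    proof
      fix y assume y: "y \<in> carrier P"
      have "(\<Oplus>\<^bsub>P\<^esub>i\<in>{..<n}. \<phi> i y \<odot>\<^bsub>P\<^esub> v i) \<in> W"
        by (rule P.submodule_finsum[OF W(1)]) (use D(4) y W P.submodule_mem(6)[OF W(1)] in auto)
      then show "y \<in> W" using D(3)[OF y] by simp
    qed
  qed
  moreover have "v ` {..<n} \<subseteq> carrier P" using D(2) by auto
  ultimately have "module_span R P (v ` {..<n}) = carrier P"
    using P.carrier_is_submodule unfolding module_span_def by blast
  then show ?thesis unfolding fg_module_def using P \<open>v ` {..<n} \<subseteq> carrier P\<close> by blast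
qed

text \<open>One half of the dual basis lemma: a map out of \<open>P\<close> is lifted by lifting the
  images of the vectors \<open>v i\<close> and recombining the lifts with the forms
  \<open>\<phi> i\<close>.\<close>

lemma rep_id_projective:
  assumes P: "Module.module R P" and rep: "dual_rep R P P (\<lambda>y. y)"
  shows "projective_module R P"
  unfolding projective_module_def
proof (intro conjI allI impI ballI)
  show "Module.module R P" by (rule P)
  interpret P: Module.module R P by (rule P)
  fix A B :: "('a, 'a univ) module" and g f
  assume A: "Module.module R A" and B: "Module.module R B" and g: "g \<in> module_hom R A B"
    and f: "f \<in> module_hom R P B" and surj: "g ` carrier A = carrier B"
  interpret A: Module.module R A by (rule A)
  from rep obtain n \<phi> v where "rep_by R P P n \<phi> v (\<lambda>y. y)" unfolding dual_rep_def by blast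
  note D = rep_byD[OF this]
  have fl: "lin_map R P B f" and gl: "lin_map R A B g" using f g by (auto simp: module_hom_iff)
  have "\<exists>a\<in>carrier A. g a = f (v i)" if "i < n" for i
  proof -
    have "f (v i) \<in> g ` carrier A" using lin_mapD(1)[OF fl D(2)[OF that]] surj by simp
    then show ?thesis by auto
  qed
  then obtain a where a: "\<And>i. i < n \<Longrightarrow> a i \<in> carrier A \<and> g (a i) = f (v i)" by metis
  define h where "h y = (\<Oplus>\<^bsub>A\<^esub>i\<in>{..<n}. \<phi> i y \<odot>\<^bsub>A\<^esub> a i)" for y
  have h: "lin_map R P A h"
    unfolding h_def by (rule lin_map_combination[OF P A]) (use D(1) a in auto)
  have "g (h y) = f y" if y: "y \<in> carrier P" for y
  proof -
    interpret B: Module.module R B by (rule B)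
    have "g (h y) = (\<Oplus>\<^bsub>B\<^esub>i\<in>{..<n}. g (\<phi> i y \<odot>\<^bsub>A\<^esub> a i))"
      unfolding h_def by (rule A.lin_map_finsum[OF B gl]) (use D(4) y a in auto)
    also have "\<dots> = (\<Oplus>\<^bsub>B\<^esub>i\<in>{..<n}. f (\<phi> i y \<odot>\<^bsub>P\<^esub> v i))"
    proof (rule B.M.finsum_cong')
      show "(\<lambda>i. f (\<phi> i y \<odot>\<^bsub>P\<^esub> v i)) \<in> {..<n} \<rightarrow> carrier B"
        using lin_mapD(1)[OF fl] D(2,4) y by auto
      fix i assume "i \<in> {..<n}"
      then have i: "i < n" by simp
      show "g (\<phi> i y \<odot>\<^bsub>A\<^esub> a i) = f (\<phi> i y \<odot>\<^bsub>P\<^esub> v i)"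
        using lin_mapD(3)[OF gl D(4)[OF i y]] lin_mapD(3)[OF fl D(4)[OF i y] D(2)[OF i]] a[OF i] by simp
    qed simp
    also have "\<dots> = f (\<Oplus>\<^bsub>P\<^esub>i\<in>{..<n}. \<phi> i y \<odot>\<^bsub>P\<^esub> v i)"
      by (rule P.lin_map_finsum[OF B fl, symmetric]) (use D(2,4) y in auto)
    also have "\<dots> = f y" using D(3)[OF y] by simp
    finally show ?thesis .
  qed
  then show "\<exists>h\<in>module_hom R P A. \<forall>p\<in>carrier P. g (h p) = f p"
    using lin_map_restrict[OF P h] by (intro bexI[of _ "restrict h (carrier P)"]) auto
qed

text \<open>The other half of the dual basis lemma: the coordinates of a section of a surjection
  from \<open>R^n\<close> are the required forms. \<open>P\<close> itself lives in the universe,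
  because \<open>projective_module\<close> tests lifting only against such targets.\<close>

lemma projective_fg_rep:
  fixes P :: "('a, 'a univ) module"
  assumes fg: "fg_module R P" and proj: "projective_module R P"
  shows "dual_rep R P P (\<lambda>y. y)"
proof -
  have P: "Module.module R P" using fg by (simp add: fg_module_def)
  interpret P: Module.module R P by (rule P)
  obtain S where S: "finite S" "S \<subseteq> carrier P"
    and span: "\<forall>W. submodule W R P \<longrightarrow> S \<subseteq> W \<longrightarrow> W = carrier P"
    using fg_module_span_eq[OF fg] by metis
  obtain p n where Sp: "S = p ` {i::nat. i < n}"
    using finite_imp_nat_seg_image_inj_on[OF S(1)] by blast
  have p: "p i \<in> carrier P" if "i < n" for i using that S Sp by blast
  define L where "L c = (\<Oplus>\<^bsub>P\<^esub>i\<in>{..<n}. c i \<odot>\<^bsub>P\<^esub> p i)" for c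
  have fm: "Module.module R (free_mod R n)" by (rule free_mod_module)
  interpret fr: Module.module R "free_mod R n" by (rule fm)
  have L: "lin_map R (free_mod R n) P L"
    unfolding L_def by (rule lin_map_combination[OF fm P free_mod_proj p])
  have surj: "L ` carrier (free_mod R n) = carrier P"
  proof -
    have "p j \<in> L ` carrier (free_mod R n)" if j: "j < n" for j
    proof -
      have "L (unit_vec j) = (\<Oplus>\<^bsub>P\<^esub>i\<in>{..<n}. if j = i then p i else \<zero>\<^bsub>P\<^esub>)"
        unfolding L_def by (rule P.M.finsum_cong') (use p in \<open>auto simp: unit_vec_def\<close>)
      also have "\<dots> = p j" by (intro P.M.finsum_singleton) (use j p in auto)
      finally show ?thesis using unit_vec_in[OF j] by (metis imageI)
    qed
    then have "S \<subseteq> L ` carrier (free_mod R n)" unfolding Sp by blast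
    then show ?thesis using span fr.lin_map_image_submodule[OF P L] by blast
  qed
  obtain F :: "('a, 'a univ) module" and \<theta> \<theta>' where F: "Module.module R F"
    and \<theta>: "lin_map R (free_mod R n) F \<theta>" "lin_map R F (free_mod R n) \<theta>'"
    "\<forall>c\<in>carrier (free_mod R n). \<theta>' (\<theta> c) = c" "\<forall>z\<in>carrier F. \<theta> (\<theta>' z) = z"
    by (rule free_in_universe)
  \<comment> \<open>The surjection from \<open>R^n\<close> is moved to its copy \<open>F\<close> in
    the universe before the identity of \<open>P\<close> is lifted along it.\<close>
  define g where "g = restrict (\<lambda>z. L (\<theta>' z)) (carrier F)"
  have g: "g \<in> module_hom R F P"
    unfolding g_def by (rule lin_map_restrict[OF F lin_map_comp[OF \<theta>(2) L]])
  have gs: "g ` carrier F = carrier P"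
  proof
    show "g ` carrier F \<subseteq> carrier P" using g by (auto simp: module_hom_def)
    show "carrier P \<subseteq> g ` carrier F"
    proof
      fix y assume "y \<in> carrier P"
      then obtain c where c: "c \<in> carrier (free_mod R n)" "y = L c" using surj by blast
      have "\<theta> c \<in> carrier F" by (rule lin_mapD(1)[OF \<theta>(1) c(1)])
      moreover have "g (\<theta> c) = y" using calculation c \<theta>(3) by (simp add: g_def)
      ultimately show "y \<in> g ` carrier F" by blast
    qed
  qed
  have idl: "lin_map R P P (\<lambda>y. y)" by (simp add: lin_map_def)
  have "\<exists>h\<in>module_hom R P F. \<forall>y\<in>carrier P. g (h y) = restrict (\<lambda>y. y) (carrier P) y"
    using proj F P g gs lin_map_restrict[OF P idl] unfolding projective_module_def by blast
  then obtain h where h: "lin_map R P F h" and gh: "\<forall>y\<in>carrier P. g (h y) = y"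
    by (auto simp: module_hom_iff)
  show ?thesis
  proof (rule dual_repI[where n = n and \<phi> = "\<lambda>i y. \<theta>' (h y) i" and v = p])
    show "lin_map R P (regular_module R) (\<lambda>y. \<theta>' (h y) i)" for i
      by (rule lin_map_comp[OF lin_map_comp[OF h \<theta>(2)] free_mod_proj])
    fix y assume y: "y \<in> carrier P"
    have "y = g (h y)" using gh y by simp
    also have "\<dots> = L (\<theta>' (h y))" using lin_mapD(1)[OF h y] by (simp add: g_def)
    finally show "y = (\<Oplus>\<^bsub>P\<^esub>i\<in>{..<n}. \<theta>' (h y) i \<odot>\<^bsub>P\<^esub> p i)" by (simp add: L_def)
  qed (use p in auto)
qed

text \<open>A map through \<open>P\<close> inherits the dual basis of \<open>P\<close> by
  composition; conversely, \<open>n\<close> forms and \<open>n\<close> vectors factor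
  \<open>f\<close> through \<open>R^n\<close>. This removes the quantifier over projective modules
  from all later arguments.\<close>

lemma proj_maps_iff:
  assumes M: "Module.module R M" and N: "Module.module R N"
  shows "f \<in> proj_maps R M N \<longleftrightarrow> f \<in> module_hom R M N \<and> dual_rep R M N f"
proof (intro iffI conjI)
  interpret M: Module.module R M by (rule M)
  interpret N: Module.module R N by (rule N)
  show "f \<in> module_hom R M N" if "f \<in> proj_maps R M N" using that by (simp add: proj_maps_def)
  show "dual_rep R M N f" if fp: "f \<in> proj_maps R M N"
  proof -
    from fp obtain P :: "('a, 'a univ) module" and g h where P: "fg_module R P" "projective_module R P"
      and g: "g \<in> module_hom R M P" and h: "h \<in> module_hom R P N"
      and eq: "\<forall>m\<in>carrier M. f m = h (g m)"
      unfolding proj_maps_def by blast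
    have Pm: "Module.module R P" using P by (simp add: fg_module_def)
    have "dual_rep R M N (\<lambda>y. h (g y))"
      by (rule dual_rep_comp[OF Pm N projective_fg_rep[OF P]]) (use g h in \<open>auto simp: module_hom_iff\<close>)
    then show ?thesis by (rule dual_rep_cong) (use eq in simp)
  qed
  assume "f \<in> module_hom R M N \<and> dual_rep R M N f"
  then have f: "f \<in> module_hom R M N" and rep: "dual_rep R M N f" by auto
  from rep obtain n \<phi> v where "rep_by R M N n \<phi> v f" unfolding dual_rep_def by blast
  note D = rep_byD[OF this]
  obtain F :: "('a, 'a univ) module" and \<theta> \<theta>' where F: "Module.module R F"
    and \<theta>: "lin_map R (free_mod R n) F \<theta>" "lin_map R F (free_mod R n) \<theta>'"
    "\<forall>c\<in>carrier (free_mod R n). \<theta>' (\<theta> c) = c" "\<forall>z\<in>carrier F. \<theta> (\<theta>' z) = z"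
    by (rule free_in_universe)
  have repF: "dual_rep R F F (\<lambda>y. y)"
    by (rule dual_rep_cong[OF dual_rep_comp[OF free_mod_module F free_mod_rep \<theta>(2,1)]]) (use \<theta>(4) in simp)
  \<comment> \<open>Cut off at \<open>n\<close>, since vectors of \<open>free_mod R n\<close> vanish
    from there on and \<open>\<phi>\<close> is unconstrained beyond \<open>n\<close>.\<close>
  define u where "u y = (\<lambda>i. if i < n then \<phi> i y else \<zero>)" for y
  have u: "lin_map R M (free_mod R n) u"
    unfolding lin_map_def u_def
    using D(4) lin_mapD(2,3)[OF D(1)] by auto
  define L where "L c = (\<Oplus>\<^bsub>N\<^esub>i\<in>{..<n}. c i \<odot>\<^bsub>N\<^esub> v i)" for c
  have L: "lin_map R (free_mod R n) N L"
    unfolding L_def by (rule lin_map_combination[OF free_mod_module N free_mod_proj D(2)])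
  have 1: "restrict (\<lambda>y. \<theta> (u y)) (carrier M) \<in> module_hom R M F"
    by (rule lin_map_restrict[OF M lin_map_comp[OF u \<theta>(1)]])
  have 2: "restrict (\<lambda>z. L (\<theta>' z)) (carrier F) \<in> module_hom R F N"
    by (rule lin_map_restrict[OF F lin_map_comp[OF \<theta>(2) L]])
  have "f y = L (u y)" if y: "y \<in> carrier M" for y
    unfolding D(3)[OF y] L_def by (rule N.M.finsum_cong') (use D(2,4) y in \<open>auto simp: u_def\<close>)
  moreover have "\<theta>' (\<theta> (u y)) = u y" "\<theta> (u y) \<in> carrier F" if "y \<in> carrier M" for y
    using \<theta>(3) lin_mapD(1)[OF u that] lin_mapD(1)[OF \<theta>(1)] by blast+
  ultimately have "\<forall>m\<in>carrier M. f m = restrict (\<lambda>z. L (\<theta>' z)) (carrier F) (restrict (\<lambda>y. \<theta> (u y)) (carrier M) m)"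
    by simp
  with 1 2 f rep_id_fg[OF F repF] rep_id_projective[OF F repF] show "f \<in> proj_maps R M N"
    unfolding proj_maps_def by blast
qed

text \<open>It is enough to test \<open>r\<close> on the identity, because maps with a dual
  representation absorb composition. The rest is about cosets: a scalar acts on
  \<open>quot_module\<close> by a union over representatives, which has to collapse to a single
  coset.\<close>

lemma stable_ann_iff:
  assumes M: "Module.module R M"
  shows "r \<in> stable_ann R M \<longleftrightarrow> r \<in> carrier R \<and> dual_rep R M M (\<lambda>y. r \<odot>\<^bsub>M\<^esub> y)"
proof -
  interpret M: Module.module R M by (rule M)
  let ?H = "hom_module R M M" and ?N = "proj_maps R M M"
  note iff = proj_maps_iff[OF M M]
  have H_simps: "carrier ?H = module_hom R M M" "add ?H = (\<lambda>f g. \<lambda>x\<in>carrier M. f x \<oplus>\<^bsub>M\<^esub> g x)"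
    "smult ?H = (\<lambda>r f. \<lambda>x\<in>carrier M. r \<odot>\<^bsub>M\<^esub> f x)"
    by (simp_all add: hom_module_def)
  have hD: "f x \<in> carrier M" if "f \<in> module_hom R M M" "x \<in> carrier M" for f x
    using that by (auto simp: module_hom_def)
  have hext: "f \<in> extensional (carrier M)" if "f \<in> module_hom R M M" for f
    using that by (simp add: module_hom_iff)
  have addH: "(\<lambda>x\<in>carrier M. f x \<oplus>\<^bsub>M\<^esub> g x) \<in> module_hom R M M"
    if "f \<in> module_hom R M M" "g \<in> module_hom R M M" for f g
  proof (rule lin_map_restrict[OF M])
    show "lin_map R M M (\<lambda>x. f x \<oplus>\<^bsub>M\<^esub> g x)"
      using that by (auto simp: module_hom_iff lin_map_def M.smult_r_distr M.M.a_ac)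
  qed
  have smH: "(\<lambda>x\<in>carrier M. s \<odot>\<^bsub>M\<^esub> f x) \<in> module_hom R M M"
    if "s \<in> carrier R" "f \<in> module_hom R M M" for s f
  proof (rule lin_map_restrict[OF M])
    show "lin_map R M M (\<lambda>x. s \<odot>\<^bsub>M\<^esub> f x)"
      using that by (auto simp: module_hom_iff lin_map_def M.smult_r_distr M.smult_commute[of s])
  qed
  have addN: "(\<lambda>x\<in>carrier M. f x \<oplus>\<^bsub>M\<^esub> g x) \<in> ?N" if "f \<in> ?N" "g \<in> ?N" for f g
    using that dual_rep_add[OF M, of M f g] addH[of f g]
    by (auto simp: iff intro: dual_rep_cong)
  have smN: "(\<lambda>x\<in>carrier M. s \<odot>\<^bsub>M\<^esub> f x) \<in> ?N" if "s \<in> carrier R" "f \<in> ?N" for s f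
    using that dual_rep_smult[OF M, of M f s] M smH[of s f]
    by (auto simp: iff intro: dual_rep_cong)
  have zeroN: "(\<lambda>x\<in>carrier M. \<zero>\<^bsub>M\<^esub>) \<in> ?N"
    unfolding iff using M
    by (auto intro!: lin_map_restrict[OF M] dual_rep_zero simp: lin_map_def)
  have cos: "?N +>\<^bsub>?H\<^esub> f = {\<lambda>x\<in>carrier M. g x \<oplus>\<^bsub>M\<^esub> f x | g. g \<in> ?N}" for f
    by (auto simp: a_r_coset_def' H_simps)
  have NH: "f \<in> module_hom R M M" if "f \<in> ?N" for f using that by (simp add: iff)
  have coset_self: "f \<in> ?N +>\<^bsub>?H\<^esub> f" if "f \<in> module_hom R M M" for f
  proof -
    have "f = (\<lambda>x\<in>carrier M. (\<lambda>x\<in>carrier M. \<zero>\<^bsub>M\<^esub>) x \<oplus>\<^bsub>M\<^esub> f x)"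
      using hD[OF that] hext[OF that] by (intro extensionalityI[of f "carrier M"]) auto
    then show ?thesis unfolding cos using zeroN by blast
  qed
  have coset_N: "?N +>\<^bsub>?H\<^esub> k = ?N" if k: "k \<in> ?N" for k
  proof
    show "?N +>\<^bsub>?H\<^esub> k \<subseteq> ?N" unfolding cos using addN k by auto
    show "?N \<subseteq> ?N +>\<^bsub>?H\<^esub> k"
    proof
      fix g assume g: "g \<in> ?N"
      \<comment> \<open>The difference \<open>g - k\<close> is built with the scalar
        \<open>-1\<close>, so that the closure properties \<open>addN\<close> and \<open>smN\<close>
        apply.\<close>
      let ?k = "\<lambda>x\<in>carrier M. (\<ominus> \<one>) \<odot>\<^bsub>M\<^esub> k x"
      let ?d = "\<lambda>x\<in>carrier M. g x \<oplus>\<^bsub>M\<^esub> ?k x"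
      have d: "?d \<in> ?N" by (rule addN[OF g smN]) (use k in auto)
      have "g = (\<lambda>x\<in>carrier M. ?d x \<oplus>\<^bsub>M\<^esub> k x)"
        using hD[OF NH[OF g]] hD[OF NH[OF k]] hext[OF NH[OF g]]
        by (intro extensionalityI[of g "carrier M"])
          (auto simp: M.smult_l_minus M.M.a_assoc M.M.l_neg)
      then show "g \<in> ?N +>\<^bsub>?H\<^esub> k" unfolding cos using d by blast
    qed
  qed
  have idH: "(\<lambda>x\<in>carrier M. x) \<in> module_hom R M M"
    by (rule lin_map_restrict[OF M]) (simp add: lin_map_def)
  have ann: "r \<in> stable_ann R M \<longleftrightarrow> r \<in> carrier R \<and>
    (\<forall>f\<in>module_hom R M M. (\<Union>a\<in>?N +>\<^bsub>?H\<^esub> f. ?N +>\<^bsub>?H\<^esub> (r \<odot>\<^bsub>?H\<^esub> a)) = ?N)"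
    by (auto simp: stable_ann_def stable_hom_def module_ann_def quot_module_def A_RCOSETS_def' H_simps)
  show ?thesis
  proof
    assume "r \<in> stable_ann R M"
    then have r: "r \<in> carrier R"
      and "(\<Union>a\<in>?N +>\<^bsub>?H\<^esub> (\<lambda>x\<in>carrier M. x). ?N +>\<^bsub>?H\<^esub> (r \<odot>\<^bsub>?H\<^esub> a)) = ?N"
      using ann idH by auto
    then have "?N +>\<^bsub>?H\<^esub> (r \<odot>\<^bsub>?H\<^esub> (\<lambda>x\<in>carrier M. x)) \<subseteq> ?N" using coset_self[OF idH] by blast
    moreover have "r \<odot>\<^bsub>?H\<^esub> (\<lambda>x\<in>carrier M. x) \<in> ?N +>\<^bsub>?H\<^esub> (r \<odot>\<^bsub>?H\<^esub> (\<lambda>x\<in>carrier M. x))"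
      by (rule coset_self) (use smH[OF r idH] in \<open>simp add: H_simps\<close>)
    ultimately have "r \<odot>\<^bsub>?H\<^esub> (\<lambda>x\<in>carrier M. x) \<in> ?N" by blast
    then have "dual_rep R M M (\<lambda>x\<in>carrier M. r \<odot>\<^bsub>M\<^esub> (\<lambda>x\<in>carrier M. x) x)" by (simp add: iff H_simps)
    then have "dual_rep R M M (\<lambda>y. r \<odot>\<^bsub>M\<^esub> y)" by (rule dual_rep_cong) simp
    with r show "r \<in> carrier R \<and> dual_rep R M M (\<lambda>y. r \<odot>\<^bsub>M\<^esub> y)" by blast
  next
    assume "r \<in> carrier R \<and> dual_rep R M M (\<lambda>y. r \<odot>\<^bsub>M\<^esub> y)"
    then have r: "r \<in> carrier R" and rep: "dual_rep R M M (\<lambda>y. r \<odot>\<^bsub>M\<^esub> y)" by auto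
    have rN: "r \<odot>\<^bsub>?H\<^esub> a \<in> ?N" if a: "a \<in> module_hom R M M" for a
    proof -
      have "dual_rep R M M (\<lambda>y. r \<odot>\<^bsub>M\<^esub> a y)"
        using dual_rep_comp[OF M M rep, of M a "\<lambda>y. y"] a by (simp add: module_hom_iff lin_map_def)
      then have "dual_rep R M M (\<lambda>x\<in>carrier M. r \<odot>\<^bsub>M\<^esub> a x)" by (rule dual_rep_cong) simp
      then show ?thesis using smH[OF r a] by (simp add: iff H_simps)
    qed
    have "(\<Union>a\<in>?N +>\<^bsub>?H\<^esub> f. ?N +>\<^bsub>?H\<^esub> (r \<odot>\<^bsub>?H\<^esub> a)) = ?N" if f: "f \<in> module_hom R M M" for f
    proof -
      have "a \<in> module_hom R M M" if "a \<in> ?N +>\<^bsub>?H\<^esub> f" for a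
        using that addH NH f unfolding cos by auto
      then have "?N +>\<^bsub>?H\<^esub> (r \<odot>\<^bsub>?H\<^esub> a) = ?N" if "a \<in> ?N +>\<^bsub>?H\<^esub> f" for a
        using coset_N[OF rN] that by blast
      then show ?thesis using coset_self[OF f] by blast
    qed
    then show "r \<in> stable_ann R M" using ann r by blast
  qed
qed

end

section \<open>Depth and dimension modulo a regular element\<close>

text \<open>Fixes the record type of \<open>M\<close> to the one for which
  \<open>quot_module\<close>, \<open>ideal_mult\<close> and \<open>depth\<close> are
  declared.\<close>

locale plain_module = Module.module R M
  for R :: "('a, 'b) ring_scheme" (structure) and M :: "('a, 'm) module" (structure)

text \<open>Translates statements on \<open>N\<close> over \<open>R'\<close> into statements on
  submodules of \<open>M\<close> that contain \<open>ker\<close>. It is used for the identity of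
  \<open>M\<close> and for the reduction modulo \<open>x\<close>.\<close>

locale semilinear = M: plain_module R M + N: plain_module R' N
  for R :: "('a, 'b) ring_scheme" and M :: "('a, 'm) module"
    and R' :: "('c, 'd) ring_scheme" and N :: "('c, 'n) module" +
  fixes \<rho> :: "'a \<Rightarrow> 'c" and \<psi> :: "'m \<Rightarrow> 'n"
  assumes rho_hom: "\<rho> \<in> ring_hom R R'" and rho_surj: "\<rho> ` carrier R = carrier R'"
    and psi_surj: "\<psi> ` carrier M = carrier N"
    and psi_add: "\<And>m m'. m \<in> carrier M \<Longrightarrow> m' \<in> carrier M \<Longrightarrow> \<psi> (m \<oplus>\<^bsub>M\<^esub> m') = \<psi> m \<oplus>\<^bsub>N\<^esub> \<psi> m'"
    and psi_smult: "\<And>r m. r \<in> carrier R \<Longrightarrow> m \<in> carrier M \<Longrightarrow> \<psi> (r \<odot>\<^bsub>M\<^esub> m) = \<rho> r \<odot>\<^bsub>N\<^esub> \<psi> m"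
begin

definition ker :: "'m set" where "ker = {m \<in> carrier M. \<psi> m = \<zero>\<^bsub>N\<^esub>}"

lemma psi_closed: "m \<in> carrier M \<Longrightarrow> \<psi> m \<in> carrier N"
  using psi_surj by blast

lemma rho_closed: "r \<in> carrier R \<Longrightarrow> \<rho> r \<in> carrier R'"
  using rho_surj by blast

lemma psi_zero: "\<psi> \<zero>\<^bsub>M\<^esub> = \<zero>\<^bsub>N\<^esub>"
proof -
  have "\<psi> \<zero>\<^bsub>M\<^esub> \<oplus>\<^bsub>N\<^esub> \<psi> \<zero>\<^bsub>M\<^esub> = \<psi> \<zero>\<^bsub>M\<^esub>"
    using psi_add[of "\<zero>\<^bsub>M\<^esub>" "\<zero>\<^bsub>M\<^esub>"] by simp
  then show ?thesis using psi_closed[of "\<zero>\<^bsub>M\<^esub>"] by simp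
qed

lemma psi_minus: "m \<in> carrier M \<Longrightarrow> \<psi> (\<ominus>\<^bsub>M\<^esub> m) = \<ominus>\<^bsub>N\<^esub> \<psi> m"
proof -
  assume m: "m \<in> carrier M"
  have "\<psi> (\<ominus>\<^bsub>M\<^esub> m) \<oplus>\<^bsub>N\<^esub> \<psi> m = \<zero>\<^bsub>N\<^esub>"
    using psi_add[of "\<ominus>\<^bsub>M\<^esub> m" m] m psi_zero by (simp add: M.M.l_neg)
  then show ?thesis using psi_closed[OF m] psi_closed[of "\<ominus>\<^bsub>M\<^esub> m"] m
    by (simp add: N.M.minus_equality)
qed

lemma submodule_vimage:
  assumes "submodule W R' N"
  shows "submodule {m \<in> carrier M. \<psi> m \<in> W} R M"
proof (rule M.submoduleI)
  note W = N.submodule_mem[OF assms]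
  show "\<zero>\<^bsub>M\<^esub> \<in> {m \<in> carrier M. \<psi> m \<in> W}" using W(2) psi_zero by simp
  show "\<ominus>\<^bsub>M\<^esub> a \<in> {m \<in> carrier M. \<psi> m \<in> W}" if "a \<in> {m \<in> carrier M. \<psi> m \<in> W}" for a
    using that W(4) psi_minus by simp
  show "a \<oplus>\<^bsub>M\<^esub> b \<in> {m \<in> carrier M. \<psi> m \<in> W}"
    if "a \<in> {m \<in> carrier M. \<psi> m \<in> W}" "b \<in> {m \<in> carrier M. \<psi> m \<in> W}" for a b
    using that W(3) psi_add by simp
  show "r \<odot>\<^bsub>M\<^esub> a \<in> {m \<in> carrier M. \<psi> m \<in> W}"
    if "r \<in> carrier R" "a \<in> {m \<in> carrier M. \<psi> m \<in> W}" for r a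
    using that W(6) psi_smult rho_closed by simp
qed auto

lemma submodule_image:
  assumes "submodule W R M"
  shows "submodule (\<psi> ` W) R' N"
proof (rule N.submoduleI)
  note W = M.submodule_mem[OF assms]
  show "\<psi> ` W \<subseteq> carrier N" using W(1) psi_closed by blast
  show "\<zero>\<^bsub>N\<^esub> \<in> \<psi> ` W" using W(2) psi_zero by (metis imageI)
  show "\<ominus>\<^bsub>N\<^esub> a \<in> \<psi> ` W" if "a \<in> \<psi> ` W" for a
    using that W(1,4) psi_minus[symmetric] by auto
  show "a \<oplus>\<^bsub>N\<^esub> b \<in> \<psi> ` W" if ab: "a \<in> \<psi> ` W" "b \<in> \<psi> ` W" for a b
  proof -
    obtain m m' where "m \<in> W" "m' \<in> W" "a = \<psi> m" "b = \<psi> m'" using ab by blast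
    then show ?thesis using W(1,3) psi_add[of m m'] by (metis imageI)
  qed
  show "r \<odot>\<^bsub>N\<^esub> a \<in> \<psi> ` W" if r: "r \<in> carrier R'" and a: "a \<in> \<psi> ` W" for r a
  proof -
    obtain s where s: "s \<in> carrier R" "r = \<rho> s" using r rho_surj by blast
    obtain m where m: "m \<in> W" "a = \<psi> m" using a by blast
    show ?thesis using W(1,6) s m psi_smult[of s m] by (metis imageI)
  qed
qed

lemma ker_submodule: "submodule ker R M"
proof -
  have "submodule {\<zero>\<^bsub>N\<^esub>} R' N" by (rule N.submoduleI) auto
  then show ?thesis using submodule_vimage unfolding ker_def by force
qed

lemma image_mem_iff:
  assumes W: "submodule W R M" "ker \<subseteq> W" and m: "m \<in> carrier M"
  shows "\<psi> m \<in> \<psi> ` W \<longleftrightarrow> m \<in> W"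
proof
  assume "\<psi> m \<in> \<psi> ` W"
  then obtain w where w: "w \<in> W" "\<psi> m = \<psi> w" by blast
  have wM: "w \<in> carrier M" using M.submodule_mem(1)[OF W(1)] w(1) .
  have "\<psi> (m \<ominus>\<^bsub>M\<^esub> w) = \<zero>\<^bsub>N\<^esub>"
    using m wM w(2) psi_add[of m "\<ominus>\<^bsub>M\<^esub> w"] psi_minus[of w] psi_closed[OF wM]
    by (simp add: a_minus_def N.M.r_neg)
  then have "m \<ominus>\<^bsub>M\<^esub> w \<in> W" using m wM W(2) by (auto simp: ker_def)
  then have "(m \<ominus>\<^bsub>M\<^esub> w) \<oplus>\<^bsub>M\<^esub> w \<in> W" using M.submodule_mem(3)[OF W(1)] w(1) by blast
  then show "m \<in> W" using m wM by (simp add: M.M.add_minus_cancel)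
qed blast

end

section \<open>Regular sequences and depth of an image, computed on the source\<close>

context Module.module
begin

lemma foldl_addm_submodule:
  "submodule K R M \<Longrightarrow> set ys \<subseteq> carrier R \<Longrightarrow> submodule (foldl (addm M) K ys) R M"
  by (induction ys arbitrary: K) (simp_all add: addm_submodule)

lemma foldl_addm_sup:
  "submodule K R M \<Longrightarrow> set ys \<subseteq> carrier R \<Longrightarrow> K \<subseteq> foldl (addm M) K ys"
proof (induction ys arbitrary: K)
  case (Cons z ys)
  then have z: "z \<in> carrier R" and ys: "set ys \<subseteq> carrier R" by auto
  have "addm M K z \<subseteq> foldl (addm M) (addm M K z) ys"
    by (rule Cons.IH[OF addm_submodule[OF Cons.prems(1) z] ys])
  then show ?case using addm_sup(1)[OF Cons.prems(1) z] by simp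
qed simp

lemma foldl_addm_smult:
  "submodule K R M \<Longrightarrow> set ys \<subseteq> carrier R \<Longrightarrow> y \<in> set ys \<Longrightarrow> m \<in> carrier M \<Longrightarrow>
    y \<odot>\<^bsub>M\<^esub> m \<in> foldl (addm M) K ys"
proof (induction ys arbitrary: K)
  case (Cons z ys)
  then have z: "z \<in> carrier R" and ys: "set ys \<subseteq> carrier R" by auto
  note Kz = addm_submodule[OF Cons.prems(1) z]
  show ?case
  proof (cases "y = z")
    case True
    then show ?thesis
      using addm_sup(2)[OF Cons.prems(1) z Cons.prems(4)] foldl_addm_sup[OF Kz ys] by auto
  next
    case False
    then show ?thesis using Cons.IH[OF Kz ys] Cons.prems by simp
  qed
qed simp

lemma foldl_addm_least:
  "submodule W R M \<Longrightarrow> K \<subseteq> W \<Longrightarrow> (\<And>y m. y \<in> set ys \<Longrightarrow> m \<in> carrier M \<Longrightarrow> y \<odot>\<^bsub>M\<^esub> m \<in> W) \<Longrightarrow>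
    foldl (addm M) K ys \<subseteq> W"
proof (induction ys arbitrary: K)
  case (Cons z ys)
  have "addm M K z \<subseteq> W" by (rule addm_least[OF Cons.prems(1,2)]) (simp add: Cons.prems(3))
  then have "foldl (addm M) (addm M K z) ys \<subseteq> W"
    by (rule Cons.IH[OF Cons.prems(1)]) (simp add: Cons.prems(3))
  then show ?case by simp
qed simp

text \<open>Bridges the recursive \<open>regseq\<close> and the indexed condition in
  \<open>regular_sequence\<close>.\<close>

lemma regseq_iff_all:
  "regseq M K ys \<longleftrightarrow> (\<forall>i<length ys. nzd M (foldl (addm M) K (take i ys)) (ys ! i))"
proof (induction ys arbitrary: K)
  case (Cons y ys)
  show ?case by (simp add: Cons.IH All_less_Suc2)
qed simp

end

context plain_module
begin

text \<open>For the last claim, the ring elements that send \<open>M\<close> into \<open>W\<close>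
  form an ideal, which contains \<open>Idl S\<close> as soon as it contains \<open>S\<close>.
  Together the three facts trade the generated ideal for its generators.\<close>

lemma ideal_mult_facts:
  assumes S: "S \<subseteq> carrier R"
  shows "submodule (ideal_mult R (Idl\<^bsub>R\<^esub> S) M) R M"
    "s \<in> S \<Longrightarrow> m \<in> carrier M \<Longrightarrow> s \<odot>\<^bsub>M\<^esub> m \<in> ideal_mult R (Idl\<^bsub>R\<^esub> S) M"
    "submodule W R M \<Longrightarrow> (\<And>s m. s \<in> S \<Longrightarrow> m \<in> carrier M \<Longrightarrow> s \<odot>\<^bsub>M\<^esub> m \<in> W) \<Longrightarrow>
      ideal_mult R (Idl\<^bsub>R\<^esub> S) M \<subseteq> W"
proof -
  let ?G = "{a \<odot>\<^bsub>M\<^esub> m | a m. a \<in> Idl\<^bsub>R\<^esub> S \<and> m \<in> carrier M}"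
  have Ic: "a \<in> carrier R" if "a \<in> Idl\<^bsub>R\<^esub> S" for a
    using ideal.Icarr[OF R.genideal_ideal[OF S] that] .
  then have G: "?G \<subseteq> carrier M" by auto
  have span: "ideal_mult R (Idl\<^bsub>R\<^esub> S) M = \<Inter>{N. submodule N R M \<and> ?G \<subseteq> N}"
    by (simp add: ideal_mult_def module_span_def)
  show "submodule (ideal_mult R (Idl\<^bsub>R\<^esub> S) M) R M"
    unfolding span
  proof (rule submoduleI)
    show "\<Inter>{N. submodule N R M \<and> ?G \<subseteq> N} \<subseteq> carrier M" using carrier_is_submodule G by blast
  qed (auto dest: submodule_mem)
  show "s \<odot>\<^bsub>M\<^esub> m \<in> ideal_mult R (Idl\<^bsub>R\<^esub> S) M" if "s \<in> S" "m \<in> carrier M"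
    unfolding span using that R.genideal_self[OF S] by blast
  show "ideal_mult R (Idl\<^bsub>R\<^esub> S) M \<subseteq> W"
    if W: "submodule W R M" and gen: "\<And>s m. s \<in> S \<Longrightarrow> m \<in> carrier M \<Longrightarrow> s \<odot>\<^bsub>M\<^esub> m \<in> W"
  proof -
    note Wm = submodule_mem[OF W]
    let ?I = "{r \<in> carrier R. \<forall>m\<in>carrier M. r \<odot>\<^bsub>M\<^esub> m \<in> W}"
    have "ideal ?I R"
    proof (rule idealI)
      show "ring R" by (rule R.ring_axioms)
      show "subgroup ?I (add_monoid R)"
      proof (rule R.add.subgroupI)
        have "\<zero>\<^bsub>R\<^esub> \<in> ?I" using Wm(2) by simp
        then show "?I \<noteq> {}" by blast
      qed (use Wm in \<open>auto simp: smult_l_distr smult_l_minus\<close>)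
      show l: "x \<otimes> a \<in> ?I" if "a \<in> ?I" "x \<in> carrier R" for a x
        using that Wm(6) by (simp add: smult_assoc1)
      show "a \<otimes> x \<in> ?I" if "a \<in> ?I" "x \<in> carrier R" for a x
        using l[OF that] that by (simp add: R.m_comm)
    qed
    moreover have "S \<subseteq> ?I" using S gen by blast
    ultimately have "Idl\<^bsub>R\<^esub> S \<subseteq> ?I" by (rule R.genideal_minimal)
    then have "?G \<subseteq> W" by blast
    then show ?thesis unfolding span using W by blast
  qed
qed

lemma submodule_abelian_subgroup:
  assumes "submodule J R M"
  shows "abelian_subgroup J M"
  by (intro abelian_subgroupI3 additive_subgroupI submodule.axioms(1)[OF assms] M.abelian_group_axioms)

lemma coset_simps:
  assumes J: "submodule J R M" and a: "a \<in> carrier M"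
  shows "J +>\<^bsub>M\<^esub> a = J \<longleftrightarrow> a \<in> J" "a \<in> J +>\<^bsub>M\<^esub> a"
proof -
  interpret J: abelian_subgroup J M by (rule submodule_abelian_subgroup[OF J])
  show "a \<in> J +>\<^bsub>M\<^esub> a" by (rule J.a_rcos_self[OF a])
  then show "J +>\<^bsub>M\<^esub> a = J \<longleftrightarrow> a \<in> J" using J.a_rcos_const by blast
qed

lemma nonzerodivisor_on_quot_iff:
  assumes J: "submodule J R M" and z: "z \<in> carrier R"
  shows "nonzerodivisor_on (quot_module M J) z \<longleftrightarrow> nzd M J z"
proof -
  note Jm = submodule_mem[OF J]
  \<comment> \<open>The zero of the quotient is \<open>J\<close>, and a multiple of a coset is a
    union of cosets; it equals \<open>J\<close> exactly when one representative is sent into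
    \<open>J\<close>.\<close>
  have eq: "(\<Union>a\<in>J +>\<^bsub>M\<^esub> n. J +>\<^bsub>M\<^esub> (z \<odot>\<^bsub>M\<^esub> a)) = J \<longleftrightarrow> z \<odot>\<^bsub>M\<^esub> n \<in> J" if n: "n \<in> carrier M" for n
  proof
    assume "(\<Union>a\<in>J +>\<^bsub>M\<^esub> n. J +>\<^bsub>M\<^esub> (z \<odot>\<^bsub>M\<^esub> a)) = J"
    moreover have "z \<odot>\<^bsub>M\<^esub> n \<in> J +>\<^bsub>M\<^esub> (z \<odot>\<^bsub>M\<^esub> n)" using coset_simps(2)[OF J] z n by simp
    ultimately show "z \<odot>\<^bsub>M\<^esub> n \<in> J" using coset_simps(2)[OF J n] by blast
  next
    assume zn: "z \<odot>\<^bsub>M\<^esub> n \<in> J"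
    have "J +>\<^bsub>M\<^esub> (z \<odot>\<^bsub>M\<^esub> a) = J" if "a \<in> J +>\<^bsub>M\<^esub> n" for a
    proof -
      from that obtain j where j: "j \<in> J" "a = j \<oplus>\<^bsub>M\<^esub> n" by (auto simp: a_r_coset_def')
      have "z \<odot>\<^bsub>M\<^esub> a = z \<odot>\<^bsub>M\<^esub> j \<oplus>\<^bsub>M\<^esub> z \<odot>\<^bsub>M\<^esub> n" using j n z Jm(1) by (simp add: smult_r_distr)
      then have "z \<odot>\<^bsub>M\<^esub> a \<in> J" using Jm(3)[OF Jm(6)[OF z j(1)] zn] by simp
      then show ?thesis using coset_simps(1)[OF J] Jm(1) by blast
    qed
    then show "(\<Union>a\<in>J +>\<^bsub>M\<^esub> n. J +>\<^bsub>M\<^esub> (z \<odot>\<^bsub>M\<^esub> a)) = J" using coset_simps(2)[OF J n] by blast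
  qed
  show ?thesis
    unfolding nonzerodivisor_on_def nzd_def quot_module_def
    using eq coset_simps(1)[OF J] by (auto simp: A_RCOSETS_def')
qed

end

context semilinear
begin

text \<open>Both constructions are least submodules, so each inclusion is checked on generators. For
  the inclusion from left to right, the image of the right-hand side serves as the competitor in
  \<open>N\<close>.\<close>

lemma vimage_ideal_mult:
  assumes ys: "set ys \<subseteq> carrier R"
  shows "{m \<in> carrier M. \<psi> m \<in> ideal_mult R' (Idl\<^bsub>R'\<^esub> (set (map \<rho> ys))) N} = foldl (addm M) ker ys"
    (is "{m \<in> carrier M. \<psi> m \<in> ?J} = ?K")
proof
  have S: "set (map \<rho> ys) \<subseteq> carrier R'" using ys rho_closed by auto
  note J = N.ideal_mult_facts[OF S] and K = M.foldl_addm_submodule[OF ker_submodule ys]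
    M.foldl_addm_sup[OF ker_submodule ys] M.foldl_addm_smult[OF ker_submodule ys]
  show "?K \<subseteq> {m \<in> carrier M. \<psi> m \<in> ?J}"
  proof (rule M.foldl_addm_least)
    show "submodule {m \<in> carrier M. \<psi> m \<in> ?J} R M" by (rule submodule_vimage[OF J(1)])
    show "ker \<subseteq> {m \<in> carrier M. \<psi> m \<in> ?J}" using N.submodule_mem(2)[OF J(1)] by (auto simp: ker_def)
    show "y \<odot>\<^bsub>M\<^esub> m \<in> {m \<in> carrier M. \<psi> m \<in> ?J}" if "y \<in> set ys" "m \<in> carrier M" for y m
      using J(2)[of "\<rho> y" "\<psi> m"] that ys psi_smult[of y m] psi_closed by auto
  qed
  have "?J \<subseteq> \<psi> ` ?K"
  proof (rule J(3))
    show "submodule (\<psi> ` ?K) R' N" by (rule submodule_image[OF K(1)])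
    show "s \<odot>\<^bsub>N\<^esub> n \<in> \<psi> ` ?K" if s: "s \<in> set (map \<rho> ys)" and n: "n \<in> carrier N" for s n
    proof -
      obtain y where y: "y \<in> set ys" "s = \<rho> y" using s by auto
      obtain m where m: "m \<in> carrier M" "n = \<psi> m" using n psi_surj by blast
      have "s \<odot>\<^bsub>N\<^esub> n = \<psi> (y \<odot>\<^bsub>M\<^esub> m)" using psi_smult[of y m] y m ys by auto
      then show ?thesis using K(3)[OF y(1) m(1)] by blast
    qed
  qed
  then show "{m \<in> carrier M. \<psi> m \<in> ?J} \<subseteq> ?K"
    using image_mem_iff[OF K(1,2)] by blast
qed

lemma regular_sequence_iff:
  assumes ys: "set ys \<subseteq> carrier R"
  shows "regular_sequence R' N (map \<rho> ys) \<longleftrightarrow> regseq M ker ys \<and> foldl (addm M) ker ys \<noteq> carrier M"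
proof -
  have nz: "nonzerodivisor_on (quot_module N (ideal_mult R' (Idl\<^bsub>R'\<^esub> (set (take i (map \<rho> ys)))) N)) (map \<rho> ys ! i)
      \<longleftrightarrow> nzd M (foldl (addm M) ker (take i ys)) (ys ! i)" if i: "i < length ys" for i
  proof -
    have t: "set (take i ys) \<subseteq> carrier R" using ys set_take_subset by (metis order_trans)
    have y: "ys ! i \<in> carrier R" using ys i by auto
    have S: "set (map \<rho> (take i ys)) \<subseteq> carrier R'" using t rho_closed by auto
    let ?J = "ideal_mult R' (Idl\<^bsub>R'\<^esub> (set (map \<rho> (take i ys)))) N"
    note J = N.ideal_mult_facts(1)[OF S]
    have "nonzerodivisor_on (quot_module N ?J) (\<rho> (ys ! i)) \<longleftrightarrow> nzd N ?J (\<rho> (ys ! i))"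
      by (rule N.nonzerodivisor_on_quot_iff[OF J rho_closed[OF y]])
    also have "\<dots> \<longleftrightarrow> nzd M {m \<in> carrier M. \<psi> m \<in> ?J} (ys ! i)"
      unfolding nzd_def psi_surj[symmetric] using y psi_smult by auto
    finally show ?thesis using i unfolding vimage_ideal_mult[OF t] by (simp add: take_map)
  qed
  let ?J = "ideal_mult R' (Idl\<^bsub>R'\<^esub> (set (map \<rho> ys))) N"
  have S: "set (map \<rho> ys) \<subseteq> carrier R'" using ys rho_closed by auto
  have "?J = carrier N \<longleftrightarrow> {m \<in> carrier M. \<psi> m \<in> ?J} = carrier M"
  proof
    assume "?J = carrier N"
    then show "{m \<in> carrier M. \<psi> m \<in> ?J} = carrier M" using psi_closed by auto
  next
    assume "{m \<in> carrier M. \<psi> m \<in> ?J} = carrier M"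
    then have "carrier N \<subseteq> ?J" unfolding psi_surj[symmetric] by blast
    then show "?J = carrier N" using N.submodule_mem(1)[OF N.ideal_mult_facts(1)[OF S]] by blast
  qed
  then have pr: "?J \<noteq> carrier N \<longleftrightarrow> foldl (addm M) ker ys \<noteq> carrier M"
    unfolding vimage_ideal_mult[OF ys] by simp
  show ?thesis
    unfolding regular_sequence_def M.regseq_iff_all using S nz pr by auto
qed

text \<open>The entries of a sequence over \<open>R'\<close> lift one by one, because the maximal
  ideal of \<open>R'\<close> is the image of \<open>\<mm>\<close>. The properness clause of
  \<open>regular_sequence\<close> then holds automatically, since adding \<open>yM\<close> with
  \<open>y\<close> in \<open>\<mm>\<close> keeps a proper submodule proper.\<close>

lemma depth_eq:
  assumes nm: "noeth_module R M \<mm>" and mm: "max_ideal R' = \<rho> ` \<mm>" and ne: "ker \<noteq> carrier M"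
  shows "depth R' N = Sup {enat n | n. \<exists>ys. length ys = n \<and> set ys \<subseteq> \<mm> \<and> regseq M ker ys}"
proof -
  interpret noeth_module R M \<mm> by (rule nm)
  have mc: "\<mm> \<subseteq> carrier R" using mm_carrier by blast
  have proper: "foldl (addm M) K ys \<noteq> carrier M" if "submodule K R M" "K \<noteq> carrier M" "set ys \<subseteq> \<mm>" for K ys
    using that
  proof (induction ys arbitrary: K)
    case (Cons y ys)
    then show ?case using addm_proper[of K y] M.addm_submodule[of K y] mm_carrier by simp
  qed simp
  have "{enat (length xs) | xs. regular_sequence R' N xs \<and> set xs \<subseteq> max_ideal R'} =
    {enat n | n. \<exists>ys. length ys = n \<and> set ys \<subseteq> \<mm> \<and> regseq M ker ys}"
  proof (intro equalityI subsetI)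
    fix e assume "e \<in> {enat (length xs) | xs. regular_sequence R' N xs \<and> set xs \<subseteq> max_ideal R'}"
    then obtain xs where xs: "e = enat (length xs)" "regular_sequence R' N xs" "set xs \<subseteq> \<rho> ` \<mm>"
      using mm by auto
    then have "xs \<in> map \<rho> ` lists \<mm>" by (simp add: lists_image[symmetric] in_lists_conv_set subset_iff)
    then obtain ys where ys: "xs = map \<rho> ys" "set ys \<subseteq> \<mm>" by auto
    then have "regseq M ker ys" using regular_sequence_iff[of ys] xs mc by auto
    with ys xs show "e \<in> {enat n | n. \<exists>ys. length ys = n \<and> set ys \<subseteq> \<mm> \<and> regseq M ker ys}" by auto
  next
    fix e assume "e \<in> {enat n | n. \<exists>ys. length ys = n \<and> set ys \<subseteq> \<mm> \<and> regseq M ker ys}"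
    then obtain ys where ys: "e = enat (length ys)" "set ys \<subseteq> \<mm>" "regseq M ker ys" by auto
    then have "regular_sequence R' N (map \<rho> ys)"
      using regular_sequence_iff[of ys] proper[OF ker_submodule ne] mc by auto
    moreover have "set (map \<rho> ys) \<subseteq> max_ideal R'" using ys mm by auto
    ultimately show "e \<in> {enat (length xs) | xs. regular_sequence R' N xs \<and> set xs \<subseteq> max_ideal R'}"
      using ys(1) by (metis (mono_tags, lifting) length_map mem_Collect_eq)
  qed
  then show ?thesis by (simp add: depth_def)
qed

end

section \<open>Chains of primes in \<open>R\<close> and in \<open>R/xR\<close>\<close>

definition prime_chain :: "('a, 'b) ring_scheme \<Rightarrow> nat \<Rightarrow> bool" where
  "prime_chain R n \<longleftrightarrow> (\<exists>P :: nat \<Rightarrow> 'a set. (\<forall>i\<le>n. primeideal (P i) R) \<and> (\<forall>i<n. P i \<subset> P (Suc i)))"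

lemma krull_dim_eq: "krull_dim R = Sup {enat n | n. prime_chain R n}"
  by (simp add: krull_dim_def prime_chain_def)

lemma prime_chain_le: "prime_chain R n \<Longrightarrow> enat n \<le> krull_dim R"
  unfolding krull_dim_eq by (rule Sup_upper) blast

lemma prime_chain_Cons:
  assumes "primeideal q R" "q \<subset> P 0" "\<forall>i\<le>n. primeideal (P i) R" "\<forall>i<n. P i \<subset> P (Suc i)"
  shows "prime_chain R (Suc n)"
  unfolding prime_chain_def
  by (rule exI[of _ "case_nat q P"])
    (use assms in \<open>auto split: nat.split simp: less_Suc_eq_0_disj le_Suc_eq\<close>)

text \<open>Lets \<open>depth_eq\<close> compute the depth of \<open>M\<close> itself, with the zero
  submodule as kernel.\<close>

lemma semilinear_id:
  assumes "Module.module R M"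
  shows "semilinear R M R M (\<lambda>r. r) (\<lambda>m. m)" "semilinear.ker M M (\<lambda>m. m) = {\<zero>\<^bsub>M\<^esub>}"
proof -
  interpret Module.module R M by fact
  show *: "semilinear R M R M (\<lambda>r. r) (\<lambda>m. m)"
    by (intro semilinear.intro semilinear_axioms.intro plain_module.intro assms)
      (auto simp: ring_hom_def)
  show "semilinear.ker M M (\<lambda>m. m) = {\<zero>\<^bsub>M\<^esub>}"
    unfolding semilinear.ker_def[OF *] using M.zero_closed by blast
qed

lemma (in cring) regular_module_fg: "fg_module R (regular_module R)"
proof -
  interpret G: Module.module R "regular_module R" by (rule regular_module_module[OF is_cring])
  have *: "W = carrier R" if W: "submodule W R (regular_module R)" "\<one> \<in> W" for W
  proof
    show "W \<subseteq> carrier R" using G.submodule_mem(1)[OF W(1)] by auto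
    show "carrier R \<subseteq> W"
    proof
      fix a assume "a \<in> carrier R"
      then show "a \<in> W" using G.submodule_mem(6)[OF W(1) _ W(2), of a] by simp
    qed
  qed
  have "module_span R (regular_module R) {\<one>} = carrier (regular_module R)"
  proof -
    have "submodule (carrier R) R (regular_module R)" using G.carrier_is_submodule by simp
    then have "carrier R \<in> {N. submodule N R (regular_module R) \<and> {\<one>} \<subseteq> N}" by simp
    moreover have "N = carrier R" if "N \<in> {N. submodule N R (regular_module R) \<and> {\<one>} \<subseteq> N}" for N
      using * that by simp
    ultimately have "{N. submodule N R (regular_module R) \<and> {\<one>} \<subseteq> N} = {carrier R}" by fast
    then show ?thesis unfolding module_span_def by simp
  qed
  then show ?thesis
    unfolding fg_module_def
    by (intro conjI G.module_axioms exI[of _ "{\<one>}"]) simp_all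
qed

text \<open>In the localisation at \<open>P\<close> the element \<open>x\<close> stays a
  nonzerodivisor, so associated primes there avoid it. Such a prime is found inside
  \<open>R/K\<close>: a prime annihilator of some \<open>v\<close> modulo \<open>K\<close> lies in
  \<open>P\<close>, and it does not contain \<open>x\<close> because \<open>s x v = 0\<close> gives
  \<open>s v = 0\<close>.\<close>

lemma (in noeth_local) prime_below:
  assumes x: "x \<in> carrier R" and nz: "\<And>a. a \<in> carrier R \<Longrightarrow> x \<otimes> a = \<zero> \<Longrightarrow> a = \<zero>"
    and P: "primeideal P R"
  obtains q where "primeideal q R" "q \<subseteq> P" "x \<notin> q"
proof -
  interpret noeth_module R "regular_module R" "max_ideal R" by (rule noeth_module_fg[OF regular_module_fg])
  interpret P: primeideal P R by (rule P)
  \<comment> \<open>the kernel of the localisation \<open>R \<rightarrow> R\<^sub>P\<close>\<close>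
  define K where "K = {a \<in> carrier R. \<exists>s\<in>carrier R - P. s \<otimes> a = \<zero>}"
  have KI: "a \<in> K" if "a \<in> carrier R" "s \<in> carrier R" "s \<notin> P" "s \<otimes> a = \<zero>" for a s
    using that by (auto simp: K_def)
  have smult: "r \<otimes> a \<in> K" if r: "r \<in> carrier R" and aK: "a \<in> K" for r a
  proof -
    obtain s where s: "a \<in> carrier R" "s \<in> carrier R" "s \<notin> P" "s \<otimes> a = \<zero>" using aK by (auto simp: K_def)
    have "s \<otimes> (r \<otimes> a) = r \<otimes> (s \<otimes> a)" using s r by (simp add: m_lcomm)
    then show ?thesis using s r by (intro KI[of _ s]) auto
  qed
  have K: "submodule K R (regular_module R)"
  proof (rule submoduleI)
    show "K \<subseteq> carrier (regular_module R)" by (auto simp: K_def)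
    have "\<one> \<notin> P" using P.I_notcarr P.one_imp_carrier by blast
    then show "\<zero>\<^bsub>regular_module R\<^esub> \<in> K" using KI[of \<zero> \<one>] by simp
    show "r \<odot>\<^bsub>regular_module R\<^esub> a \<in> K" if "r \<in> carrier R" "a \<in> K" for r a using smult that by simp
    show "\<ominus>\<^bsub>regular_module R\<^esub> a \<in> K" if a: "a \<in> K" for a
    proof -
      have aR: "a \<in> carrier R" using a by (simp add: K_def)
      have "\<ominus>\<^bsub>regular_module R\<^esub> a = (\<ominus> \<one>) \<odot>\<^bsub>regular_module R\<^esub> a"
        using smult_l_minus[of \<one> a] smult_one[of a] aR by simp
      then show ?thesis using smult[OF _ a, of "\<ominus> \<one>"] by simp
    qed
    show "a \<oplus>\<^bsub>regular_module R\<^esub> b \<in> K" if ab: "a \<in> K" "b \<in> K" for a b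
    proof -
      obtain s t where s: "a \<in> carrier R" "s \<in> carrier R" "s \<notin> P" "s \<otimes> a = \<zero>"
        and t: "b \<in> carrier R" "t \<in> carrier R" "t \<notin> P" "t \<otimes> b = \<zero>" using ab by (auto simp: K_def)
      have "(s \<otimes> t) \<otimes> (a \<oplus> b) = t \<otimes> (s \<otimes> a) \<oplus> s \<otimes> (t \<otimes> b)"
        using s(1,2) t(1,2) by (simp add: r_distr m_ac)
      also have "\<dots> = \<zero>" using s t by simp
      finally have "(s \<otimes> t) \<otimes> (a \<oplus> b) = \<zero>" .
      moreover have "s \<otimes> t \<notin> P" using P.I_prime[of s t] s t by blast
      ultimately have "a \<oplus> b \<in> K" using s t by (intro KI[of _ "s \<otimes> t"]) auto
      then show ?thesis by simp
    qed
  qed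
  have 1: "\<one> \<in> carrier (regular_module R)" "\<one> \<notin> K"
    using P.zero_closed by (auto simp: K_def)
  obtain v where v0: "v \<in> carrier (regular_module R)"
    and v1: "v \<notin> K" "primeideal (colon R (regular_module R) K v) R"
    using prime_colon_above[OF K 1] by blast
  then have v: "v \<in> carrier R" "v \<notin> K" "primeideal (colon R (regular_module R) K v) R" by simp_all
  have "colon R (regular_module R) K v \<subseteq> P"
  proof
    fix r assume r: "r \<in> colon R (regular_module R) K v"
    then obtain s where s: "r \<in> carrier R" "s \<in> carrier R" "s \<notin> P" "s \<otimes> (r \<otimes> v) = \<zero>"
      by (auto simp: colon_def K_def)
    show "r \<in> P"
    proof (rule ccontr)
      assume "r \<notin> P"
      then have "s \<otimes> r \<notin> P" using P.I_prime s by blast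
      then have "v \<in> K" using s v(1) by (intro KI[of _ "s \<otimes> r"]) (auto simp: m_assoc)
      with v(2) show False ..
    qed
  qed
  moreover have "x \<notin> colon R (regular_module R) K v"
  proof
    assume "x \<in> colon R (regular_module R) K v"
    then obtain s where s: "s \<in> carrier R" "s \<notin> P" "s \<otimes> (x \<otimes> v) = \<zero>" by (auto simp: colon_def K_def)
    have "x \<otimes> (s \<otimes> v) = \<zero>" using s x v(1) by (simp add: m_lcomm)
    then have "s \<otimes> v = \<zero>" using nz s v(1) by simp
    then have "v \<in> K" using s v(1) by (intro KI[of _ s]) auto
    with v(2) show False ..
  qed
  ultimately show ?thesis using that v(3) by blast
qed

locale noeth_local_quot = noeth_local R for R :: "('a, 'b) ring_scheme" (structure) +
  fixes x :: 'a
  assumes x_max: "x \<in> max_ideal R" and x_nzd: "\<And>a. a \<in> carrier R \<Longrightarrow> x \<otimes> a = \<zero> \<Longrightarrow> a = \<zero>"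
begin

abbreviation "I \<equiv> PIdl x"
abbreviation "Q \<equiv> R Quot I"

lemma x_carrier: "x \<in> carrier R"
  using ideal.Icarr[OF max_ideal_ideal x_max] .

lemma I_ideal: "ideal I R"
  by (rule cgenideal_ideal[OF x_carrier])

lemma x_in_I: "x \<in> I"
  by (rule cgenideal_self[OF x_carrier])

lemma I_minimal: "ideal J R \<Longrightarrow> x \<in> J \<Longrightarrow> I \<subseteq> J"
  by (rule cgenideal_minimal)

lemma Q_cring: "cring Q"
  by (rule ideal.quotient_is_cring[OF I_ideal is_cring])

lemma rho_hom: "(+>) I \<in> ring_hom R Q"
  by (rule ideal.rcos_ring_hom[OF I_ideal])

lemma rho_hom_ring: "ring_hom_ring R Q ((+>) I)"
  by (rule ideal.rcos_ring_hom_ring[OF I_ideal])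

lemma rho_surj: "(+>) I ` carrier R = carrier Q"
  by (auto simp: FactRing_def A_RCOSETS_def')

lemma rho_obtain: "a \<in> carrier Q \<Longrightarrow> \<exists>r\<in>carrier R. a = I +> r"
  using rho_surj by (metis imageE)

lemma rho_mem_iff:
  assumes J: "ideal J R" "I \<subseteq> J" and r: "r \<in> carrier R"
  shows "I +> r \<in> (+>) I ` J \<longleftrightarrow> r \<in> J"
proof
  assume "I +> r \<in> (+>) I ` J"
  then obtain p where p: "p \<in> J" "I +> r = I +> p" by blast
  have pR: "p \<in> carrier R" using ideal.Icarr[OF J(1) p(1)] .
  have "r \<ominus> p \<in> J" using quotient_eq_iff_same_a_r_cos[OF I_ideal r pR] p J(2) by blast
  then have "(r \<ominus> p) \<oplus> p \<in> J"
    using additive_subgroup.a_closed[OF ideal.axioms(1)[OF J(1)]] p(1) by blast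
  then show "r \<in> J" using r pR by (simp add: add_minus_cancel)
qed blast

lemma image_ideal: "ideal J R \<Longrightarrow> ideal ((+>) I ` J) Q"
  by (rule ring_ideal_imp_quot_ideal[OF I_ideal])

lemma vimage_ideal:
  assumes "ideal J Q"
  shows "ideal {r \<in> carrier R. I +> r \<in> J} R" "I \<subseteq> {r \<in> carrier R. I +> r \<in> J}"
    "J = (+>) I ` {r \<in> carrier R. I +> r \<in> J}"
proof -
  show *: "ideal {r \<in> carrier R. I +> r \<in> J} R"
    by (rule ring_hom_ring.ideal_vimage[OF rho_hom_ring assms])
  have "I +> x = I" by (rule a_rcos_zero[OF I_ideal x_in_I])
  moreover have "I \<in> J"
    using additive_subgroup.zero_closed[OF ideal.axioms(1)[OF assms]] by (simp add: FactRing_def)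
  ultimately show "I \<subseteq> {r \<in> carrier R. I +> r \<in> J}" using x_carrier by (intro I_minimal[OF *]) simp
  show "J = (+>) I ` {r \<in> carrier R. I +> r \<in> J}"
  proof (intro equalityI subsetI)
    fix a assume a: "a \<in> J"
    then obtain r where "r \<in> carrier R" "a = I +> r" using rho_obtain ideal.Icarr[OF assms] by metis
    with a show "a \<in> (+>) I ` {r \<in> carrier R. I +> r \<in> J}" by simp
  qed auto
qed

text \<open>A maximal ideal of \<open>Q\<close> pulls back to an ideal without \<open>1\<close>,
  hence into the maximal ideal of \<open>R\<close>. This is the hypothesis of
  \<open>depth_eq\<close> for the reduction modulo \<open>x\<close>.\<close>

lemma max_ideal_quot: "max_ideal Q = (+>) I ` max_ideal R"
proof -
  let ?m = "max_ideal R"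
  have Im: "I \<subseteq> ?m" by (rule I_minimal[OF max_ideal_ideal x_max])
  have proper: "carrier Q \<noteq> (+>) I ` ?m"
  proof
    assume "carrier Q = (+>) I ` ?m"
    then have "I +> \<one> \<in> (+>) I ` ?m" using rho_surj by (metis imageI one_closed)
    then show False using rho_mem_iff[OF max_ideal_ideal Im one_closed] one_not_in_max_ideal by simp
  qed
  have max: "J = (+>) I ` ?m \<or> J = carrier Q"
    if J: "ideal J Q" "(+>) I ` ?m \<subseteq> J" for J
  proof -
    note V = vimage_ideal[OF J(1)]
    have "?m \<subseteq> {r \<in> carrier R. I +> r \<in> J}"
    proof
      fix a assume "a \<in> ?m"
      then show "a \<in> {r \<in> carrier R. I +> r \<in> J}"
        using J(2) ideal.Icarr[OF max_ideal_ideal] by auto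
    qed
    then have "{r \<in> carrier R. I +> r \<in> J} = ?m \<or> {r \<in> carrier R. I +> r \<in> J} = carrier R"
      by (rule maximalideal.I_maximal[OF max_ideal_maximal V(1)]) simp
    then show ?thesis
    proof
      assume "{r \<in> carrier R. I +> r \<in> J} = ?m"
      with V(3) show ?thesis by simp
    next
      assume "{r \<in> carrier R. I +> r \<in> J} = carrier R"
      with V(3) rho_surj show ?thesis by simp
    qed
  qed
  have m: "maximalideal ((+>) I ` ?m) Q"
    by (rule maximalidealI[OF image_ideal[OF max_ideal_ideal] proper max])
  show ?thesis
    unfolding max_ideal_def[of Q]
  proof (rule the_equality)
    show "maximalideal ((+>) I ` ?m) Q" by (rule m)
  next
    fix n assume n: "maximalideal n Q"
    have ni: "ideal n Q" using n by (simp add: maximalideal_def)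
    note V = vimage_ideal[OF ni]
    have "\<one> \<notin> {r \<in> carrier R. I +> r \<in> n}"
    proof
      assume "\<one> \<in> {r \<in> carrier R. I +> r \<in> n}"
      then have "\<one>\<^bsub>Q\<^esub> \<in> n" using ring_hom_one[OF rho_hom] by simp
      then show False using ideal.one_imp_carrier[OF ni] maximalideal.I_notcarr[OF n] by blast
    qed
    then obtain m' where "maximalideal m' R" "{r \<in> carrier R. I +> r \<in> n} \<subseteq> m'"
      using maximal_above[OF V(1)] by blast
    then have "{r \<in> carrier R. I +> r \<in> n} \<subseteq> ?m" using max_ideal_unique by metis
    then have "(+>) I ` {r \<in> carrier R. I +> r \<in> n} \<subseteq> (+>) I ` ?m" by (rule image_mono)
    then have "n \<subseteq> (+>) I ` ?m" using V(3) by simp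
    moreover have "(+>) I ` ?m \<subseteq> carrier Q"
      using ideal.Icarr[OF image_ideal[OF max_ideal_ideal]] by (rule subsetI)
    ultimately have "(+>) I ` ?m = n \<or> (+>) I ` ?m = carrier Q"
      by (intro maximalideal.I_maximal[OF n image_ideal[OF max_ideal_ideal]])
    then show "n = (+>) I ` ?m" using proper by metis
  qed
qed

lemma prime_image:
  assumes P: "primeideal P R" "x \<in> P"
  shows "primeideal ((+>) I ` P) Q"
proof -
  interpret P: primeideal P R by (rule P(1))
  have IP: "I \<subseteq> P" by (rule I_minimal[OF P.ideal_axioms P(2)])
  note mem = rho_mem_iff[OF P.ideal_axioms IP]
  show ?thesis
  proof (rule primeidealI[OF image_ideal[OF P.ideal_axioms] Q_cring])
    show "carrier Q \<noteq> (+>) I ` P"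
    proof
      assume "carrier Q = (+>) I ` P"
      then have "\<one> \<in> P" using mem[OF one_closed] rho_surj by (metis imageI one_closed)
      then show False using P.one_imp_carrier P.I_notcarr by blast
    qed
    fix a b assume a: "a \<in> carrier Q" and b: "b \<in> carrier Q" and ab: "a \<otimes>\<^bsub>Q\<^esub> b \<in> (+>) I ` P"
    obtain r where r: "r \<in> carrier R" "a = I +> r" using rho_obtain[OF a] by metis
    obtain s where s: "s \<in> carrier R" "b = I +> s" using rho_obtain[OF b] by metis
    have "a \<otimes>\<^bsub>Q\<^esub> b = I +> (r \<otimes> s)" using ring_hom_mult[OF rho_hom r(1) s(1)] r s by simp
    then have "r \<otimes> s \<in> P" using ab mem[of "r \<otimes> s"] r s by simp
    then have "r \<in> P \<or> s \<in> P" by (rule P.I_prime[OF r(1) s(1)])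
    then show "a \<in> (+>) I ` P \<or> b \<in> (+>) I ` P" using r s by auto
  qed
qed

lemma prime_chain_image:
  assumes P: "\<forall>i\<le>n. primeideal (P i) R" "\<forall>i<n. P i \<subset> P (Suc i)" and x: "x \<in> P 0"
  shows "prime_chain Q n"
proof -
  have xP: "x \<in> P i" if "i \<le> n" for i
    using that
  proof (induction i)
    case (Suc i)
    then show ?case using P(2) by (metis Suc_le_lessD less_imp_le psubsetD)
  qed (rule x)
  have "(+>) I ` P i \<subset> (+>) I ` P (Suc i)" if i: "i < n" for i
  proof -
    have pi: "primeideal (P i) R" "x \<in> P i" and ps: "primeideal (P (Suc i)) R"
      using P xP i by auto
    have ii: "ideal (P i) R" using pi(1) by (simp add: primeideal_def)
    obtain r where r: "r \<in> P (Suc i)" "r \<notin> P i" using P(2) i by blast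
    have rR: "r \<in> carrier R" using ideal.Icarr[of "P (Suc i)" R r] ps r(1) by (simp add: primeideal_def)
    have "I +> r \<notin> (+>) I ` P i" using rho_mem_iff[OF ii I_minimal[OF ii pi(2)] rR] r(2) by simp
    moreover have "(+>) I ` P i \<subseteq> (+>) I ` P (Suc i)" using P(2) i by blast
    ultimately show ?thesis using r(1) by blast
  qed
  then show ?thesis
    unfolding prime_chain_def using prime_image P xP by (intro exI[of _ "\<lambda>i. (+>) I ` P i"]) simp
qed

text \<open>The inverse images all contain \<open>x\<close>, so a prime avoiding \<open>x\<close>
  below the first of them, from \<open>prime_below\<close>, lengthens the chain by one.\<close>

lemma prime_chain_lift:
  assumes "prime_chain Q n"
  shows "prime_chain R (Suc n)"
proof -
  obtain P where P: "\<forall>i\<le>n. primeideal (P i) Q" "\<forall>i<n. P i \<subset> P (Suc i)"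
    using assms by (auto simp: prime_chain_def)
  define V where "V i = {r \<in> carrier R. I +> r \<in> P i}" for i
  have pr: "primeideal (V i) R" if "i \<le> n" for i
    unfolding V_def using ring_hom_ring.primeideal_vimage[OF rho_hom_ring is_cring] P(1) that by blast
  have strict: "V i \<subset> V (Suc i)" if i: "i < n" for i
  proof -
    have id: "ideal (P (Suc i)) Q" using P(1) i by (simp add: primeideal_def)
    obtain a where a: "a \<in> P (Suc i)" "a \<notin> P i" using P(2) i by blast
    obtain r where "r \<in> carrier R" "a = I +> r" using rho_obtain[OF ideal.Icarr[OF id a(1)]] by metis
    then have "r \<in> carrier R" "I +> r \<in> P (Suc i)" "I +> r \<notin> P i" using a by auto
    moreover have "P i \<subseteq> P (Suc i)" using P(2) i by blast
    ultimately show ?thesis unfolding V_def by blast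
  qed
  obtain q where q: "primeideal q R" "q \<subseteq> V 0" "x \<notin> q"
    using prime_below[OF x_carrier x_nzd pr[of 0]] by blast
  have "ideal (P 0) Q" using P(1) by (simp add: primeideal_def)
  then have "x \<in> V 0" using vimage_ideal(2)[of "P 0"] x_in_I unfolding V_def by blast
  with q have "q \<subset> V 0" by blast
  then show ?thesis by (intro prime_chain_Cons[of q R V] q(1)) (use pr strict in auto)
qed

end

section \<open>Stable annihilators modulo a regular element\<close>

lemma (in abelian_group) finsum_swap:
  assumes "finite A" "finite B" "\<And>i j. i \<in> A \<Longrightarrow> j \<in> B \<Longrightarrow> F i j \<in> carrier G"
  shows "(\<Oplus>i\<in>A. \<Oplus>j\<in>B. F i j) = (\<Oplus>j\<in>B. \<Oplus>i\<in>A. F i j)"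
  using assms(1,3)
proof (induction A)
  case empty
  have "(\<Oplus>j\<in>B. \<Oplus>i\<in>{}. F i j) = (\<Oplus>j\<in>B. \<zero>)" by (rule finsum_cong') auto
  then show ?case by simp
next
  case (insert a A)
  have c: "F i j \<in> carrier G" if "i \<in> insert a A" "j \<in> B" for i j using insert.prems that by blast
  have s: "(\<lambda>i. F i j) \<in> A \<rightarrow> carrier G" "(\<lambda>j. F i j) \<in> B \<rightarrow> carrier G"
    if "i \<in> insert a A" "j \<in> B" for i j using c that by auto
  have sA: "(\<Oplus>i\<in>A. F i j) \<in> carrier G" if "j \<in> B" for j
    by (rule finsum_closed) (use c that in auto)
  have sB: "(\<Oplus>j\<in>B. F i j) \<in> carrier G" if "i \<in> insert a A" for i
    by (rule finsum_closed) (use c that in auto)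
  have "(\<Oplus>i\<in>insert a A. \<Oplus>j\<in>B. F i j) = (\<Oplus>j\<in>B. F a j) \<oplus> (\<Oplus>i\<in>A. \<Oplus>j\<in>B. F i j)"
    by (rule finsum_insert[OF insert.hyps]) (use sB in auto)
  also have "(\<Oplus>i\<in>A. \<Oplus>j\<in>B. F i j) = (\<Oplus>j\<in>B. \<Oplus>i\<in>A. F i j)"
    using insert.IH c by simp
  also have "(\<Oplus>j\<in>B. F a j) \<oplus> (\<Oplus>j\<in>B. \<Oplus>i\<in>A. F i j) = (\<Oplus>j\<in>B. F a j \<oplus> (\<Oplus>i\<in>A. F i j))"
    by (rule finsum_addf[symmetric]) (use c sA in auto)
  also have "\<dots> = (\<Oplus>j\<in>B. \<Oplus>i\<in>insert a A. F i j)"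
  proof (rule finsum_cong')
    show "(\<lambda>j. \<Oplus>i\<in>insert a A. F i j) \<in> B \<rightarrow> carrier G"
      by (intro Pi_I finsum_closed) (use c in auto)
    show "F a j \<oplus> (\<Oplus>i\<in>A. F i j) = (\<Oplus>i\<in>insert a A. F i j)" if j: "j \<in> B" for j
      by (rule finsum_insert[OF insert.hyps, symmetric]) (use c j in auto)
  qed simp
  finally show ?case .
qed

text \<open>Any copy \<open>N\<close> of \<open>M/xM\<close>, given by a surjection with kernel
  \<open>xM\<close>. Copies are needed besides the concrete coset module, because the points of
  \<open>CM\<close> are classes of modules with elements in the universe.\<close>

locale reduction_pres =
  semilinear R M "R Quot (PIdl\<^bsub>R\<^esub> x)" N "\<lambda>r. (PIdl\<^bsub>R\<^esub> x) +>\<^bsub>R\<^esub> r" \<psi>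
  for R :: "('a, 'b) ring_scheme" and M :: "('a, 'm) module" and x :: 'a
    and N :: "('a set, 'n) module" and \<psi> :: "'m \<Rightarrow> 'n" +
  assumes x_carrier: "x \<in> carrier R"
    and ker_iff: "\<And>m. m \<in> carrier M \<Longrightarrow> \<psi> m = \<zero>\<^bsub>N\<^esub> \<longleftrightarrow> (\<exists>m'\<in>carrier M. m = x \<odot>\<^bsub>M\<^esub> m')"
begin

abbreviation "I \<equiv> PIdl\<^bsub>R\<^esub> x"
abbreviation "Q \<equiv> R Quot I"
abbreviation "\<rho> r \<equiv> I +>\<^bsub>R\<^esub> r"

lemma I_ideal: "ideal I R"
  by (rule M.R.cgenideal_ideal[OF x_carrier])

lemma rho_obtain:
  assumes "a \<in> carrier Q"
  obtains r where "r \<in> carrier R" "a = \<rho> r"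
proof -
  have "a \<in> (\<lambda>r. \<rho> r) ` carrier R" using assms rho_surj by simp
  then show ?thesis using that by blast
qed

lemma rho_add: "r \<in> carrier R \<Longrightarrow> s \<in> carrier R \<Longrightarrow> \<rho> (r \<oplus>\<^bsub>R\<^esub> s) = \<rho> r \<oplus>\<^bsub>Q\<^esub> \<rho> s"
  by (rule ring_hom_add[OF rho_hom])

lemma rho_mult: "r \<in> carrier R \<Longrightarrow> s \<in> carrier R \<Longrightarrow> \<rho> (r \<otimes>\<^bsub>R\<^esub> s) = \<rho> r \<otimes>\<^bsub>Q\<^esub> \<rho> s"
  by (rule ring_hom_mult[OF rho_hom])

lemma rho_zero_imp:
  assumes "r \<in> carrier R" "\<rho> r = \<zero>\<^bsub>Q\<^esub>"
  shows "\<exists>s\<in>carrier R. r = x \<otimes>\<^bsub>R\<^esub> s"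
proof -
  have "\<rho> r = I" using assms(2) by (simp add: FactRing_def)
  then have "r \<in> I" by (rule ideal.rcos_const_imp_mem[OF I_ideal assms(1)])
  then show ?thesis using x_carrier by (auto simp: cgenideal_def M.R.m_comm)
qed

lemma rho_x: "s \<in> carrier R \<Longrightarrow> \<rho> (x \<otimes>\<^bsub>R\<^esub> s) = \<zero>\<^bsub>Q\<^esub>"
proof -
  assume s: "s \<in> carrier R"
  have "x \<otimes>\<^bsub>R\<^esub> s \<in> I" using s x_carrier by (auto simp: cgenideal_def M.R.m_comm)
  then show ?thesis using M.R.a_rcos_zero[OF I_ideal] by (simp add: FactRing_def)
qed

lemma psi_obtain:
  assumes "n \<in> carrier N"
  obtains m where "m \<in> carrier M" "n = \<psi> m"
  using assms psi_surj by blast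

lemma psi_eq_imp:
  assumes "m \<in> carrier M" "m' \<in> carrier M" "\<psi> m = \<psi> m'"
  shows "\<exists>d\<in>carrier M. m = m' \<oplus>\<^bsub>M\<^esub> x \<odot>\<^bsub>M\<^esub> d"
proof -
  have "\<psi> (m \<ominus>\<^bsub>M\<^esub> m') = \<zero>\<^bsub>N\<^esub>"
    using assms psi_add[of m "\<ominus>\<^bsub>M\<^esub> m'"] psi_minus[of m'] psi_closed[of m']
    by (simp add: a_minus_def N.M.r_neg)
  then obtain d where d: "d \<in> carrier M" "m \<ominus>\<^bsub>M\<^esub> m' = x \<odot>\<^bsub>M\<^esub> d"
    using ker_iff[of "m \<ominus>\<^bsub>M\<^esub> m'"] assms by auto
  have "m = m' \<oplus>\<^bsub>M\<^esub> (m \<ominus>\<^bsub>M\<^esub> m')" using assms by (simp add: M.M.add_minus_cancel)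
  with d show ?thesis by auto
qed

text \<open>Forms pass to the quotient because \<open>\<phi> (x d) = x \<phi>(d)\<close> vanishes
  modulo \<open>x\<close>; hence the choice of representatives by \<open>\<sigma>\<close> does not
  affect the value.\<close>

lemma descend_form:
  assumes \<phi>: "lin_map R M (regular_module R) \<phi>"
  shows "\<exists>\<phi>'. lin_map Q N (regular_module Q) \<phi>' \<and> (\<forall>y\<in>carrier M. \<phi>' (\<psi> y) = \<rho> (\<phi> y))"
proof -
  have \<phi>c: "\<phi> y \<in> carrier R" if "y \<in> carrier M" for y using lin_mapD(1)[OF \<phi> that] by simp
  define \<sigma> where "\<sigma> n = (SOME m. m \<in> carrier M \<and> \<psi> m = n)" for n
  have \<sigma>: "\<sigma> n \<in> carrier M \<and> \<psi> (\<sigma> n) = n" if "n \<in> carrier N" for n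
    unfolding \<sigma>_def by (rule someI_ex) (use psi_obtain[OF that] in metis)
  define \<phi>' where "\<phi>' n = \<rho> (\<phi> (\<sigma> n))" for n
  have eq: "\<phi>' (\<psi> y) = \<rho> (\<phi> y)" if y: "y \<in> carrier M" for y
  proof -
    have s: "\<sigma> (\<psi> y) \<in> carrier M" "\<psi> (\<sigma> (\<psi> y)) = \<psi> y" using \<sigma>[OF psi_closed[OF y]] by auto
    obtain d where d: "d \<in> carrier M" "\<sigma> (\<psi> y) = y \<oplus>\<^bsub>M\<^esub> x \<odot>\<^bsub>M\<^esub> d"
      using psi_eq_imp[OF s(1) y s(2)] by blast
    have "\<phi> (\<sigma> (\<psi> y)) = \<phi> y \<oplus>\<^bsub>R\<^esub> x \<otimes>\<^bsub>R\<^esub> \<phi> d"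
      unfolding d(2) using lin_mapD(2)[OF \<phi> y, of "x \<odot>\<^bsub>M\<^esub> d"] lin_mapD(3)[OF \<phi> x_carrier d(1)] d(1) x_carrier
      by simp
    then show ?thesis
      unfolding \<phi>'_def using rho_add[of "\<phi> y" "x \<otimes>\<^bsub>R\<^esub> \<phi> d"] rho_x[OF \<phi>c[OF d(1)]]
        \<phi>c[OF y] \<phi>c[OF d(1)] x_carrier rho_closed[OF \<phi>c[OF y]] by simp
  qed
  have "lin_map Q N (regular_module Q) \<phi>'"
    unfolding lin_map_def
  proof (intro conjI ballI)
    fix n assume n: "n \<in> carrier N"
    obtain y where y: "y \<in> carrier M" "n = \<psi> y" using psi_obtain[OF n] .
    show "\<phi>' n \<in> carrier (regular_module Q)" using eq[OF y(1)] y rho_closed[OF \<phi>c[OF y(1)]] by simp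
    fix n' assume n': "n' \<in> carrier N"
    obtain z where z: "z \<in> carrier M" "n' = \<psi> z" using psi_obtain[OF n'] .
    have "\<phi>' (n \<oplus>\<^bsub>N\<^esub> n') = \<rho> (\<phi> (y \<oplus>\<^bsub>M\<^esub> z))"
      using eq[of "y \<oplus>\<^bsub>M\<^esub> z"] psi_add[OF y(1) z(1)] y z by simp
    then show "\<phi>' (n \<oplus>\<^bsub>N\<^esub> n') = \<phi>' n \<oplus>\<^bsub>regular_module Q\<^esub> \<phi>' n'"
      using lin_mapD(2)[OF \<phi> y(1) z(1)] eq[OF y(1)] eq[OF z(1)] y(2) z(2) rho_add \<phi>c[OF y(1)] \<phi>c[OF z(1)]
      by simp
  next
    fix a n assume a: "a \<in> carrier Q" and n: "n \<in> carrier N"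
    obtain y where y: "y \<in> carrier M" "n = \<psi> y" using psi_obtain[OF n] .
    obtain r where r: "r \<in> carrier R" "a = \<rho> r" using rho_obtain[OF a] .
    have "\<phi>' (a \<odot>\<^bsub>N\<^esub> n) = \<rho> (\<phi> (r \<odot>\<^bsub>M\<^esub> y))"
      using eq[of "r \<odot>\<^bsub>M\<^esub> y"] psi_smult[OF r(1) y(1)] y r by simp
    then show "\<phi>' (a \<odot>\<^bsub>N\<^esub> n) = a \<odot>\<^bsub>regular_module Q\<^esub> \<phi>' n"
      using lin_mapD(3)[OF \<phi> r(1) y(1)] eq[OF y(1)] y(2) r rho_mult \<phi>c[OF y(1)] by simp
  qed
  with eq show ?thesis by blast
qed

lemma stable_ann_reduction_easy:
  assumes "r \<in> stable_ann R M"
  shows "\<rho> r \<in> stable_ann Q N"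
proof -
  have r: "r \<in> carrier R" and rep: "dual_rep R M M (\<lambda>y. r \<odot>\<^bsub>M\<^esub> y)"
    using assms M.R.stable_ann_iff[OF M.module_axioms] by auto
  from rep obtain n \<phi> v where "rep_by R M M n \<phi> v (\<lambda>y. r \<odot>\<^bsub>M\<^esub> y)" unfolding dual_rep_def by blast
  note D = rep_byD[OF this]
  have "\<forall>i. \<exists>\<phi>'. i < n \<longrightarrow> lin_map Q N (regular_module Q) \<phi>' \<and> (\<forall>y\<in>carrier M. \<phi>' (\<psi> y) = \<rho> (\<phi> i y))"
    using descend_form D(1) by blast
  then obtain \<phi>' where \<phi>': "\<And>i. i < n \<Longrightarrow> lin_map Q N (regular_module Q) (\<phi>' i) \<and>
      (\<forall>y\<in>carrier M. \<phi>' i (\<psi> y) = \<rho> (\<phi> i y))" by metis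
  have "dual_rep Q N N (\<lambda>z. \<rho> r \<odot>\<^bsub>N\<^esub> z)"
  proof (rule dual_repI[where n = n and \<phi> = \<phi>' and v = "\<lambda>i. \<psi> (v i)"])
    show "lin_map Q N (regular_module Q) (\<phi>' i)" if "i < n" for i using \<phi>'[OF that] by blast
    show "\<psi> (v i) \<in> carrier N" if "i < n" for i using psi_closed[OF D(2)[OF that]] .
    fix z assume z: "z \<in> carrier N"
    obtain y where y: "y \<in> carrier M" "z = \<psi> y" using psi_obtain[OF z] .
    have "\<rho> r \<odot>\<^bsub>N\<^esub> z = \<psi> (\<Oplus>\<^bsub>M\<^esub>i\<in>{..<n}. \<phi> i y \<odot>\<^bsub>M\<^esub> v i)"
      using psi_smult[OF r y(1)] y D(3)[OF y(1)] by simp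
    also have "\<dots> = (\<Oplus>\<^bsub>N\<^esub>i\<in>{..<n}. \<psi> (\<phi> i y \<odot>\<^bsub>M\<^esub> v i))"
      by (rule finsum_additive[OF M.abelian_group_axioms N.abelian_group_axioms finite_lessThan psi_closed psi_add])
        (use D(2,4) y in auto)
    also have "\<dots> = (\<Oplus>\<^bsub>N\<^esub>i\<in>{..<n}. \<phi>' i z \<odot>\<^bsub>N\<^esub> \<psi> (v i))"
    proof (rule N.M.finsum_cong')
      show "(\<lambda>i. \<phi>' i z \<odot>\<^bsub>N\<^esub> \<psi> (v i)) \<in> {..<n} \<rightarrow> carrier N"
      proof
        fix i assume "i \<in> {..<n}"
        then have i: "i < n" by simp
        have "\<phi>' i z \<in> carrier Q" using \<phi>'[OF i] lin_mapD(1)[of Q N _ "\<phi>' i" z] z by force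
        then show "\<phi>' i z \<odot>\<^bsub>N\<^esub> \<psi> (v i) \<in> carrier N" using psi_closed[OF D(2)[OF i]] by simp
      qed
      show "\<psi> (\<phi> i y \<odot>\<^bsub>M\<^esub> v i) = \<phi>' i z \<odot>\<^bsub>N\<^esub> \<psi> (v i)" if "i \<in> {..<n}" for i
        using psi_smult[OF D(4) D(2), of i y i] \<phi>'[of i] that y by simp
    qed simp
    finally show "\<rho> r \<odot>\<^bsub>N\<^esub> z = (\<Oplus>\<^bsub>N\<^esub>i\<in>{..<n}. \<phi>' i z \<odot>\<^bsub>N\<^esub> \<psi> (v i))" .
  qed
  then show ?thesis
    using cring.stable_ann_iff[OF N.R.is_cring N.module_axioms] rho_closed[OF r] by blast
qed

lemma stable_ann_reduction_hard:
  assumes xa: "x \<in> stable_ann R M" and xM: "nzd M {\<zero>\<^bsub>M\<^esub>} x"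
    and xR: "\<And>a. a \<in> carrier R \<Longrightarrow> x \<otimes>\<^bsub>R\<^esub> a = \<zero>\<^bsub>R\<^esub> \<Longrightarrow> a = \<zero>\<^bsub>R\<^esub>"
    and r: "r \<in> carrier R" and ra: "\<rho> r \<in> stable_ann Q N"
  shows "r \<in> stable_ann R M"
proof -
  let ?R = "regular_module R" and ?Q = "regular_module Q"
  interpret G: Module.module R ?R by (rule regular_module_module[OF M.R.is_cring])
  interpret GQ: Module.module Q ?Q by (rule regular_module_module[OF N.R.is_cring])
  have "dual_rep R M M (\<lambda>y. x \<odot>\<^bsub>M\<^esub> y)" using xa M.R.stable_ann_iff[OF M.module_axioms] by blast
  then obtain n g h where "rep_by R M M n g h (\<lambda>y. x \<odot>\<^bsub>M\<^esub> y)" unfolding dual_rep_def by blast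
  note X = rep_byD[OF this]
  have "dual_rep Q N N (\<lambda>z. \<rho> r \<odot>\<^bsub>N\<^esub> z)"
    using ra cring.stable_ann_iff[OF N.R.is_cring N.module_axioms] by blast
  then obtain p \<alpha> w where "rep_by Q N N p \<alpha> w (\<lambda>z. \<rho> r \<odot>\<^bsub>N\<^esub> z)" unfolding dual_rep_def by blast
  note Y = rep_byD[OF this]
  have "\<forall>j. \<exists>m. j < p \<longrightarrow> m \<in> carrier M \<and> w j = \<psi> m" using psi_obtain Y(2) by metis
  then obtain l where l: "\<And>j. j < p \<Longrightarrow> l j \<in> carrier M" "\<And>j. j < p \<Longrightarrow> w j = \<psi> (l j)" by metis
  \<comment> \<open>The coefficients of the form \<open>\<alpha> j\<close> pulled back to
    \<open>R^n\<close> along \<open>h\<close>. On a free module any choice of lifts of the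
    coefficients defines a lift of the form.\<close>
  have "\<forall>j k. \<exists>s. j < p \<longrightarrow> k < n \<longrightarrow> s \<in> carrier R \<and> \<alpha> j (\<psi> (h k)) = \<rho> s"
    using rho_obtain Y(4) psi_closed X(2) by metis
  then obtain s where s: "\<And>j k. j < p \<Longrightarrow> k < n \<Longrightarrow> s j k \<in> carrier R"
    and \<rho>s: "\<And>j k. j < p \<Longrightarrow> k < n \<Longrightarrow> \<alpha> j (\<psi> (h k)) = \<rho> (s j k)" by metis
  define a where "a j y = (\<Oplus>\<^bsub>?R\<^esub>k\<in>{..<n}. g k y \<odot>\<^bsub>?R\<^esub> s j k)" for j y
  have a_lin: "lin_map R M ?R (a j)" if "j < p" for j
    unfolding a_def by (rule lin_map_combination[OF M.module_axioms G.module_axioms X(1)]) (use s that in auto)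
  have ac: "a j y \<in> carrier R" if "j < p" "y \<in> carrier M" for j y
    using lin_mapD(1)[OF a_lin[OF that(1)] that(2)] by simp
  have a_zero: "\<rho> (a j y) = \<zero>\<^bsub>Q\<^esub>" if j: "j < p" and y: "y \<in> carrier M" for j y
  proof -
    note \<alpha>j = Y(1)[OF j]
    have \<alpha>\<psi>: "\<alpha> j (\<psi> (b \<oplus>\<^bsub>M\<^esub> c)) = \<alpha> j (\<psi> b) \<oplus>\<^bsub>?Q\<^esub> \<alpha> j (\<psi> c)" if "b \<in> carrier M" "c \<in> carrier M" for b c
      using psi_add[OF that] lin_mapD(2)[OF \<alpha>j psi_closed[OF that(1)] psi_closed[OF that(2)]] by simp
    have "\<rho> (a j y) = (\<Oplus>\<^bsub>?Q\<^esub>k\<in>{..<n}. \<rho> (g k y \<odot>\<^bsub>?R\<^esub> s j k))"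
      unfolding a_def
      by (rule finsum_additive[OF G.abelian_group_axioms GQ.abelian_group_axioms finite_lessThan])
        (use rho_closed rho_add X(4) y s j in auto)
    also have "\<dots> = (\<Oplus>\<^bsub>?Q\<^esub>k\<in>{..<n}. \<alpha> j (\<psi> (g k y \<odot>\<^bsub>M\<^esub> h k)))"
    proof (rule GQ.M.finsum_cong')
      show "(\<lambda>k. \<alpha> j (\<psi> (g k y \<odot>\<^bsub>M\<^esub> h k))) \<in> {..<n} \<rightarrow> carrier ?Q"
        using lin_mapD(1)[OF \<alpha>j] psi_closed X(2,4) y by auto
      fix k assume "k \<in> {..<n}"
      then have k: "k < n" by simp
      have "\<alpha> j (\<psi> (g k y \<odot>\<^bsub>M\<^esub> h k)) = \<rho> (g k y) \<otimes>\<^bsub>Q\<^esub> \<alpha> j (\<psi> (h k))"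
        using psi_smult[OF X(4)[OF k y] X(2)[OF k]]
          lin_mapD(3)[OF \<alpha>j rho_closed[OF X(4)[OF k y]] psi_closed[OF X(2)[OF k]]] by simp
      then show "\<rho> (g k y \<odot>\<^bsub>?R\<^esub> s j k) = \<alpha> j (\<psi> (g k y \<odot>\<^bsub>M\<^esub> h k))"
        using rho_mult[OF X(4)[OF k y] s[OF j k]] \<rho>s[OF j k] by simp
    qed simp
    also have "\<dots> = \<alpha> j (\<psi> (\<Oplus>\<^bsub>M\<^esub>k\<in>{..<n}. g k y \<odot>\<^bsub>M\<^esub> h k))"
      by (rule finsum_additive[OF M.abelian_group_axioms GQ.abelian_group_axioms finite_lessThan _ \<alpha>\<psi>, symmetric])
        (use lin_mapD(1)[OF \<alpha>j] psi_closed X(2,4) y in auto)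
    also have "\<dots> = \<alpha> j (\<psi> (x \<odot>\<^bsub>M\<^esub> y))" using X(3)[OF y] by simp
    also have "\<psi> (x \<odot>\<^bsub>M\<^esub> y) = \<zero>\<^bsub>N\<^esub>" using ker_iff[of "x \<odot>\<^bsub>M\<^esub> y"] x_carrier y by blast
    also have "\<alpha> j \<zero>\<^bsub>N\<^esub> = \<zero>\<^bsub>Q\<^esub>" using N.lin_map_zero[OF GQ.module_axioms \<alpha>j] by simp
    finally show ?thesis .
  qed
  then have "\<forall>j y. \<exists>b. j < p \<longrightarrow> y \<in> carrier M \<longrightarrow> b \<in> carrier R \<and> a j y = x \<otimes>\<^bsub>R\<^esub> b"
    using rho_zero_imp ac by metis
  then obtain a' where a': "\<And>j y. j < p \<Longrightarrow> y \<in> carrier M \<Longrightarrow> a' j y \<in> carrier R"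
    "\<And>j y. j < p \<Longrightarrow> y \<in> carrier M \<Longrightarrow> a j y = x \<otimes>\<^bsub>R\<^esub> a' j y" by metis
  \<comment> \<open>The quotients \<open>a' j y\<close> are chosen pointwise; that they depend
    linearly on \<open>y\<close> comes from cancelling \<open>x\<close> in \<open>R\<close>.\<close>
  have cancelR: "b = c" if "b \<in> carrier R" "c \<in> carrier R" "x \<otimes>\<^bsub>R\<^esub> b = x \<otimes>\<^bsub>R\<^esub> c" for b c
  proof -
    have "x \<otimes>\<^bsub>R\<^esub> (b \<ominus>\<^bsub>R\<^esub> c) = \<zero>\<^bsub>R\<^esub>"
      using that x_carrier by (simp add: a_minus_def M.R.r_distr M.R.r_minus M.R.r_neg)
    then have "b \<ominus>\<^bsub>R\<^esub> c = \<zero>\<^bsub>R\<^esub>" using xR that by simp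
    then show ?thesis using that by (metis M.R.add_minus_cancel(2) M.R.l_zero)
  qed
  have cancelM: "b = c" if "b \<in> carrier M" "c \<in> carrier M" "x \<odot>\<^bsub>M\<^esub> b = x \<odot>\<^bsub>M\<^esub> c" for b c
  proof -
    have "x \<odot>\<^bsub>M\<^esub> (b \<ominus>\<^bsub>M\<^esub> c) = \<zero>\<^bsub>M\<^esub>"
      using that x_carrier by (simp add: M.smult_r_diff) (simp add: a_minus_def M.M.r_neg)
    then have "b \<ominus>\<^bsub>M\<^esub> c = \<zero>\<^bsub>M\<^esub>" using xM that by (simp add: nzd_def)
    then show ?thesis using that by (metis M.M.add_minus_cancel(2) M.M.l_zero)
  qed
  have a'_lin: "lin_map R M ?R (a' j)" if j: "j < p" for j
    unfolding lin_map_def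
  proof (intro conjI ballI)
    fix y assume y: "y \<in> carrier M"
    show "a' j y \<in> carrier ?R" using a'(1)[OF j y] by simp
    fix z assume z: "z \<in> carrier M"
    have yz: "y \<oplus>\<^bsub>M\<^esub> z \<in> carrier M" using y z by simp
    have "x \<otimes>\<^bsub>R\<^esub> a' j (y \<oplus>\<^bsub>M\<^esub> z) = x \<otimes>\<^bsub>R\<^esub> (a' j y \<oplus>\<^bsub>R\<^esub> a' j z)"
      using a'(2)[OF j yz] a'(2)[OF j y] a'(2)[OF j z] lin_mapD(2)[OF a_lin[OF j] y z]
        a'(1)[OF j y] a'(1)[OF j z] x_carrier by (simp add: M.R.r_distr)
    then have "a' j (y \<oplus>\<^bsub>M\<^esub> z) = a' j y \<oplus>\<^bsub>R\<^esub> a' j z"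
      by (rule cancelR[rotated 2]) (use a'(1)[OF j] y z in auto)
    then show "a' j (y \<oplus>\<^bsub>M\<^esub> z) = a' j y \<oplus>\<^bsub>?R\<^esub> a' j z" by simp
  next
    fix t y assume t: "t \<in> carrier R" and y: "y \<in> carrier M"
    have ty: "t \<odot>\<^bsub>M\<^esub> y \<in> carrier M" using y t by simp
    have "x \<otimes>\<^bsub>R\<^esub> a' j (t \<odot>\<^bsub>M\<^esub> y) = x \<otimes>\<^bsub>R\<^esub> (t \<otimes>\<^bsub>R\<^esub> a' j y)"
      using a'(2)[OF j ty] a'(2)[OF j y] lin_mapD(3)[OF a_lin[OF j] t y]
        a'(1)[OF j y] x_carrier t by (simp add: M.R.m_lcomm)
    then have "a' j (t \<odot>\<^bsub>M\<^esub> y) = t \<otimes>\<^bsub>R\<^esub> a' j y"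
      by (rule cancelR[rotated 2]) (use a'(1)[OF j] y t in auto)
    then show "a' j (t \<odot>\<^bsub>M\<^esub> y) = t \<odot>\<^bsub>?R\<^esub> a' j y" by simp
  qed
  define b where "b k = (\<Oplus>\<^bsub>M\<^esub>j\<in>{..<p}. s j k \<odot>\<^bsub>M\<^esub> l j)" for k
  have bc: "b k \<in> carrier M" if "k < n" for k
    unfolding b_def by (rule M.M.finsum_closed) (use s l that in auto)
  have "\<exists>\<epsilon>\<in>carrier M. b k = r \<odot>\<^bsub>M\<^esub> h k \<oplus>\<^bsub>M\<^esub> x \<odot>\<^bsub>M\<^esub> \<epsilon>" if k: "k < n" for k
  proof (rule psi_eq_imp[OF bc[OF k]])
    show "r \<odot>\<^bsub>M\<^esub> h k \<in> carrier M" using r X(2)[OF k] by simp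
    have "\<psi> (b k) = (\<Oplus>\<^bsub>N\<^esub>j\<in>{..<p}. \<psi> (s j k \<odot>\<^bsub>M\<^esub> l j))"
      unfolding b_def
      by (rule finsum_additive[OF M.abelian_group_axioms N.abelian_group_axioms finite_lessThan psi_closed psi_add])
        (use s l k in auto)
    also have "\<dots> = (\<Oplus>\<^bsub>N\<^esub>j\<in>{..<p}. \<alpha> j (\<psi> (h k)) \<odot>\<^bsub>N\<^esub> w j)"
    proof (rule N.M.finsum_cong')
      show "(\<lambda>j. \<alpha> j (\<psi> (h k)) \<odot>\<^bsub>N\<^esub> w j) \<in> {..<p} \<rightarrow> carrier N"
        using Y(2,4) psi_closed[OF X(2)[OF k]] by auto
      show "\<psi> (s j k \<odot>\<^bsub>M\<^esub> l j) = \<alpha> j (\<psi> (h k)) \<odot>\<^bsub>N\<^esub> w j" if "j \<in> {..<p}" for j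
        using psi_smult[OF s l(1), of j k j] l(2)[of j] \<rho>s[of j k] that k by simp
    qed simp
    also have "\<dots> = \<rho> r \<odot>\<^bsub>N\<^esub> \<psi> (h k)" using Y(3)[OF psi_closed[OF X(2)[OF k]]] by simp
    also have "\<dots> = \<psi> (r \<odot>\<^bsub>M\<^esub> h k)" using psi_smult[OF r X(2)[OF k]] by simp
    finally show "\<psi> (b k) = \<psi> (r \<odot>\<^bsub>M\<^esub> h k)" .
  qed
  then obtain \<epsilon> where \<epsilon>: "\<And>k. k < n \<Longrightarrow> \<epsilon> k \<in> carrier M"
    "\<And>k. k < n \<Longrightarrow> b k = r \<odot>\<^bsub>M\<^esub> h k \<oplus>\<^bsub>M\<^esub> x \<odot>\<^bsub>M\<^esub> \<epsilon> k" by metis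
  define A where "A y = (\<Oplus>\<^bsub>M\<^esub>j\<in>{..<p}. a' j y \<odot>\<^bsub>M\<^esub> l j)" for y
  define E where "E y = (\<Oplus>\<^bsub>M\<^esub>k\<in>{..<n}. g k y \<odot>\<^bsub>M\<^esub> \<epsilon> k)" for y
  have Ar: "dual_rep R M M A" by (rule dual_repI[OF a'_lin l(1) A_def])
  have Er: "dual_rep R M M E" by (rule dual_repI[OF X(1) \<epsilon>(1) E_def])
  have Ac: "A y \<in> carrier M" and Ec: "E y \<in> carrier M" if "y \<in> carrier M" for y
    unfolding A_def E_def using a'(1) l(1) X(4) \<epsilon>(1) that by (auto intro!: M.M.finsum_closed)
  have key: "A y = r \<odot>\<^bsub>M\<^esub> y \<oplus>\<^bsub>M\<^esub> E y" if y: "y \<in> carrier M" for y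
  \<comment> \<open>After multiplication by \<open>x\<close> both sides become the double sum of the
    terms \<open>g k y \<cdot> s j k \<cdot> l j\<close>: summing over \<open>k\<close> first
    produces \<open>x a' j y\<close>, summing over \<open>j\<close> first produces
    \<open>b k\<close>.\<close>
  proof (rule cancelM)
    note gy = X(4)[OF _ y]
    have "x \<odot>\<^bsub>M\<^esub> A y = (\<Oplus>\<^bsub>M\<^esub>j\<in>{..<p}. x \<odot>\<^bsub>M\<^esub> (a' j y \<odot>\<^bsub>M\<^esub> l j))"
      unfolding A_def by (rule M.finsum_smult_ldistr) (use x_carrier a'(1) y l in auto)
    also have "\<dots> = (\<Oplus>\<^bsub>M\<^esub>j\<in>{..<p}. \<Oplus>\<^bsub>M\<^esub>k\<in>{..<n}. g k y \<odot>\<^bsub>M\<^esub> (s j k \<odot>\<^bsub>M\<^esub> l j))"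
    proof (rule M.M.finsum_cong')
      show "(\<lambda>j. \<Oplus>\<^bsub>M\<^esub>k\<in>{..<n}. g k y \<odot>\<^bsub>M\<^esub> (s j k \<odot>\<^bsub>M\<^esub> l j)) \<in> {..<p} \<rightarrow> carrier M"
        by (intro Pi_I M.M.finsum_closed) (use gy s l in auto)
      fix j assume "j \<in> {..<p}"
      then have j: "j < p" by simp
      have lin: "lin_map R ?R M (\<lambda>c. c \<odot>\<^bsub>M\<^esub> l j)"
        using l(1)[OF j] by (simp add: lin_map_def M.smult_l_distr M.smult_assoc1)
      have "x \<odot>\<^bsub>M\<^esub> (a' j y \<odot>\<^bsub>M\<^esub> l j) = a j y \<odot>\<^bsub>M\<^esub> l j"
        using a'[OF j y] x_carrier l(1)[OF j] by (simp add: M.smult_assoc1)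
      also have "\<dots> = (\<Oplus>\<^bsub>M\<^esub>k\<in>{..<n}. (g k y \<odot>\<^bsub>?R\<^esub> s j k) \<odot>\<^bsub>M\<^esub> l j)"
        unfolding a_def by (rule G.lin_map_finsum[OF M.module_axioms lin]) (use gy s j in auto)
      also have "\<dots> = (\<Oplus>\<^bsub>M\<^esub>k\<in>{..<n}. g k y \<odot>\<^bsub>M\<^esub> (s j k \<odot>\<^bsub>M\<^esub> l j))"
        by (rule M.M.finsum_cong') (use gy s j l in \<open>auto simp: M.smult_assoc1\<close>)
      finally show "x \<odot>\<^bsub>M\<^esub> (a' j y \<odot>\<^bsub>M\<^esub> l j) = (\<Oplus>\<^bsub>M\<^esub>k\<in>{..<n}. g k y \<odot>\<^bsub>M\<^esub> (s j k \<odot>\<^bsub>M\<^esub> l j))" .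
    qed simp
    also have "\<dots> = (\<Oplus>\<^bsub>M\<^esub>k\<in>{..<n}. \<Oplus>\<^bsub>M\<^esub>j\<in>{..<p}. g k y \<odot>\<^bsub>M\<^esub> (s j k \<odot>\<^bsub>M\<^esub> l j))"
      by (rule M.M.finsum_swap) (use gy s l in auto)
    also have "\<dots> = (\<Oplus>\<^bsub>M\<^esub>k\<in>{..<n}. r \<odot>\<^bsub>M\<^esub> (g k y \<odot>\<^bsub>M\<^esub> h k) \<oplus>\<^bsub>M\<^esub> x \<odot>\<^bsub>M\<^esub> (g k y \<odot>\<^bsub>M\<^esub> \<epsilon> k))"
    proof (rule M.M.finsum_cong')
      show "(\<lambda>k. r \<odot>\<^bsub>M\<^esub> (g k y \<odot>\<^bsub>M\<^esub> h k) \<oplus>\<^bsub>M\<^esub> x \<odot>\<^bsub>M\<^esub> (g k y \<odot>\<^bsub>M\<^esub> \<epsilon> k)) \<in> {..<n} \<rightarrow> carrier M"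
        using gy X(2) \<epsilon>(1) r x_carrier by auto
      fix k assume "k \<in> {..<n}"
      then have k: "k < n" by simp
      have "(\<Oplus>\<^bsub>M\<^esub>j\<in>{..<p}. g k y \<odot>\<^bsub>M\<^esub> (s j k \<odot>\<^bsub>M\<^esub> l j)) = g k y \<odot>\<^bsub>M\<^esub> b k"
        unfolding b_def by (rule M.finsum_smult_ldistr[symmetric]) (use gy[OF k] s k l in auto)
      also have "\<dots> = r \<odot>\<^bsub>M\<^esub> (g k y \<odot>\<^bsub>M\<^esub> h k) \<oplus>\<^bsub>M\<^esub> x \<odot>\<^bsub>M\<^esub> (g k y \<odot>\<^bsub>M\<^esub> \<epsilon> k)"
        unfolding \<epsilon>(2)[OF k] using gy[OF k] X(2)[OF k] \<epsilon>(1)[OF k] r x_carrier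
        by (simp add: M.smult_r_distr M.smult_commute[of "g k y" r] M.smult_commute[of "g k y" x])
      finally show "(\<Oplus>\<^bsub>M\<^esub>j\<in>{..<p}. g k y \<odot>\<^bsub>M\<^esub> (s j k \<odot>\<^bsub>M\<^esub> l j)) =
        r \<odot>\<^bsub>M\<^esub> (g k y \<odot>\<^bsub>M\<^esub> h k) \<oplus>\<^bsub>M\<^esub> x \<odot>\<^bsub>M\<^esub> (g k y \<odot>\<^bsub>M\<^esub> \<epsilon> k)" .
    qed simp
    also have "\<dots> = (\<Oplus>\<^bsub>M\<^esub>k\<in>{..<n}. r \<odot>\<^bsub>M\<^esub> (g k y \<odot>\<^bsub>M\<^esub> h k)) \<oplus>\<^bsub>M\<^esub>
        (\<Oplus>\<^bsub>M\<^esub>k\<in>{..<n}. x \<odot>\<^bsub>M\<^esub> (g k y \<odot>\<^bsub>M\<^esub> \<epsilon> k))"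
      by (rule M.M.finsum_addf) (use gy X(2) \<epsilon>(1) r x_carrier in auto)
    also have "(\<Oplus>\<^bsub>M\<^esub>k\<in>{..<n}. r \<odot>\<^bsub>M\<^esub> (g k y \<odot>\<^bsub>M\<^esub> h k)) = r \<odot>\<^bsub>M\<^esub> (\<Oplus>\<^bsub>M\<^esub>k\<in>{..<n}. g k y \<odot>\<^bsub>M\<^esub> h k)"
      by (rule M.finsum_smult_ldistr[symmetric]) (use gy X(2) r in auto)
    also have "(\<Oplus>\<^bsub>M\<^esub>k\<in>{..<n}. g k y \<odot>\<^bsub>M\<^esub> h k) = x \<odot>\<^bsub>M\<^esub> y" using X(3)[OF y] by simp
    also have "(\<Oplus>\<^bsub>M\<^esub>k\<in>{..<n}. x \<odot>\<^bsub>M\<^esub> (g k y \<odot>\<^bsub>M\<^esub> \<epsilon> k)) = x \<odot>\<^bsub>M\<^esub> E y"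
      unfolding E_def by (rule M.finsum_smult_ldistr[symmetric]) (use gy \<epsilon>(1) x_carrier in auto)
    also have "r \<odot>\<^bsub>M\<^esub> (x \<odot>\<^bsub>M\<^esub> y) \<oplus>\<^bsub>M\<^esub> x \<odot>\<^bsub>M\<^esub> E y = x \<odot>\<^bsub>M\<^esub> (r \<odot>\<^bsub>M\<^esub> y \<oplus>\<^bsub>M\<^esub> E y)"
      using r x_carrier y Ec[OF y] by (simp add: M.smult_r_distr M.smult_commute[of x r])
    finally show "x \<odot>\<^bsub>M\<^esub> A y = x \<odot>\<^bsub>M\<^esub> (r \<odot>\<^bsub>M\<^esub> y \<oplus>\<^bsub>M\<^esub> E y)" .
  qed (use Ac Ec r y in auto)
  have "dual_rep R M M (\<lambda>y. A y \<oplus>\<^bsub>M\<^esub> (\<ominus>\<^bsub>R\<^esub> \<one>\<^bsub>R\<^esub>) \<odot>\<^bsub>M\<^esub> E y)"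
    by (rule dual_rep_add[OF M.module_axioms Ar dual_rep_smult[OF M.module_axioms Er M.module_axioms]]) simp
  then have "dual_rep R M M (\<lambda>y. r \<odot>\<^bsub>M\<^esub> y)"
  proof (rule dual_rep_cong)
    fix y assume y: "y \<in> carrier M"
    have "A y \<oplus>\<^bsub>M\<^esub> (\<ominus>\<^bsub>R\<^esub> \<one>\<^bsub>R\<^esub>) \<odot>\<^bsub>M\<^esub> E y = (r \<odot>\<^bsub>M\<^esub> y \<oplus>\<^bsub>M\<^esub> E y) \<ominus>\<^bsub>M\<^esub> E y"
      using key[OF y] Ec[OF y] by (simp add: M.smult_l_minus a_minus_def)
    also have "\<dots> = r \<odot>\<^bsub>M\<^esub> y" using M.M.add_minus_cancel(4) r y Ec[OF y] by simp
    finally show "r \<odot>\<^bsub>M\<^esub> y = A y \<oplus>\<^bsub>M\<^esub> (\<ominus>\<^bsub>R\<^esub> \<one>\<^bsub>R\<^esub>) \<odot>\<^bsub>M\<^esub> E y" ..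
  qed
  with r show ?thesis using M.R.stable_ann_iff[OF M.module_axioms] by blast
qed

end

section \<open>Reduction of maximal Cohen-Macaulay modules\<close>

lemma Sup_enat_attained:
  assumes "P 0" "\<And>n. P n \<Longrightarrow> n < (N::nat)"
  shows "\<exists>d. P d \<and> Sup {enat n | n. P n} = enat d \<and> (\<forall>n. P n \<longrightarrow> n \<le> d)"
proof -
  have fin: "finite {n. P n}" by (rule finite_subset[of _ "{..<N}"]) (use assms(2) in auto)
  define d where "d = Max {n. P n}"
  have d: "P d" using Max_in[OF fin] assms(1) unfolding d_def by blast
  have le: "n \<le> d" if "P n" for n unfolding d_def by (rule Max_ge[OF fin]) (use that in simp)
  have "Sup {enat n | n. P n} = enat d"
  proof (rule antisym)
    show "Sup {enat n | n. P n} \<le> enat d" by (rule Sup_least) (use le in auto)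
    show "enat d \<le> Sup {enat n | n. P n}" by (rule Sup_upper) (use d in blast)
  qed
  with d le show ?thesis by blast
qed

lemma regseq_take: "regseq M K ys \<Longrightarrow> regseq M K (take n ys)"
proof (induction ys arbitrary: K n)
  case (Cons y ys)
  then show ?case by (cases n) auto
qed simp

context noeth_local
begin

text \<open>Finiteness of the dimension is extracted from \<open>M\<close>: some length is not
  attained by \<open>regseq_length_bounded\<close>, and it bounds all others because prefixes of
  regular sequences are regular. So the depth is an attained maximum, and it equals the
  dimension.\<close>

lemma mcm_depth_attained:
  assumes mcm: "mcm R M" and ne: "carrier M \<noteq> {\<zero>\<^bsub>M\<^esub>}"
  shows "\<exists>d. krull_dim R = enat d \<and>
    (\<exists>ys. length ys = d \<and> set ys \<subseteq> max_ideal R \<and> regseq M {\<zero>\<^bsub>M\<^esub>} ys) \<and>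
    (\<forall>ys. set ys \<subseteq> max_ideal R \<longrightarrow> regseq M {\<zero>\<^bsub>M\<^esub>} ys \<longrightarrow> length ys \<le> d)"
proof -
  have fg: "fg_module R M" and dep: "depth R M = krull_dim R" using mcm ne by (auto simp: mcm_def)
  have M: "Module.module R M" using fg by (simp add: fg_module_def)
  interpret noeth_module R M "max_ideal R" by (rule noeth_module_fg[OF fg])
  interpret S: semilinear R M R M "\<lambda>r. r" "\<lambda>m. m" by (rule semilinear_id(1)[OF M])
  note ker = semilinear_id(2)[OF M]
  have sub: "submodule {\<zero>\<^bsub>M\<^esub>} R M" using S.ker_submodule unfolding ker .
  define P where
    "P n \<longleftrightarrow> (\<exists>ys. length ys = n \<and> set ys \<subseteq> max_ideal R \<and> regseq M {\<zero>\<^bsub>M\<^esub>} ys)" for n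
  have PI: "P (length ys)" if "set ys \<subseteq> max_ideal R" "regseq M {\<zero>\<^bsub>M\<^esub>} ys" for ys
    unfolding P_def using that by blast
  have "\<exists>n. \<not> P n" unfolding P_def using regseq_length_bounded[OF sub] ne by metis
  then obtain N where N: "\<not> P N" ..
  have lt: "n < N" if n: "P n" for n
  proof (rule ccontr)
    assume "\<not> n < N"
    obtain ys where ys: "length ys = n" "set ys \<subseteq> max_ideal R" "regseq M {\<zero>\<^bsub>M\<^esub>} ys"
      using n unfolding P_def by blast
    have "length (take N ys) = N" using ys(1) \<open>\<not> n < N\<close> by simp
    moreover have "set (take N ys) \<subseteq> max_ideal R" using ys(2) set_take_subset by fastforce
    ultimately have "P N" using PI[of "take N ys"] regseq_take[OF ys(3)] by simp
    with N show False ..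
  qed
  have P0: "P 0" using PI[of "[]"] by simp
  have "\<exists>d. P d \<and> Sup {enat n | n. P n} = enat d \<and> (\<forall>n. P n \<longrightarrow> n \<le> d)"
    using P0 lt by (rule Sup_enat_attained[where P = P and N = N])
  then obtain d where d: "P d" "Sup {enat n | n. P n} = enat d" "\<forall>n. P n \<longrightarrow> n \<le> d" by blast
  have kne: "S.ker \<noteq> carrier M" using ne ker by metis
  have "max_ideal R = (\<lambda>r. r) ` max_ideal R" by simp
  then have "depth R M = Sup {enat n | n. P n}"
    unfolding P_def by (rule S.depth_eq[OF noeth_module_axioms _ kne, unfolded ker])
  then have "krull_dim R = enat d" using dep d(2) by simp
  moreover have "length ys \<le> d" if "set ys \<subseteq> max_ideal R" "regseq M {\<zero>\<^bsub>M\<^esub>} ys" for ys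
    using PI[OF that] d(3) by simp
  moreover note d(1)[unfolded P_def]
  ultimately show ?thesis by (intro exI[of _ d] conjI allI impI)
qed

lemma mcm_nzd:
  assumes mcm: "mcm R M" and x: "x \<in> carrier R"
    and nz: "\<And>a. a \<in> carrier R \<Longrightarrow> x \<otimes> a = \<zero> \<Longrightarrow> a = \<zero>"
  shows "nzd M {\<zero>\<^bsub>M\<^esub>} x"
proof (rule ccontr)
  assume neg: "\<not> nzd M {\<zero>\<^bsub>M\<^esub>} x"
  then obtain u where u: "u \<in> carrier M" "x \<odot>\<^bsub>M\<^esub> u = \<zero>\<^bsub>M\<^esub>" "u \<noteq> \<zero>\<^bsub>M\<^esub>" by (auto simp: nzd_def)
  have ne: "carrier M \<noteq> {\<zero>\<^bsub>M\<^esub>}" using u by blast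
  have fg: "fg_module R M" using mcm by (simp add: mcm_def)
  have M: "Module.module R M" using fg by (simp add: fg_module_def)
  interpret noeth_module R M "max_ideal R" by (rule noeth_module_fg[OF fg])
  have sub: "submodule {\<zero>\<^bsub>M\<^esub>} R M"
    using semilinear.ker_submodule[OF semilinear_id(1)[OF M]] unfolding semilinear_id(2)[OF M] .
  obtain d where d: "krull_dim R = enat d"
    and ex: "\<exists>ys. length ys = d \<and> set ys \<subseteq> max_ideal R \<and> regseq M {\<zero>\<^bsub>M\<^esub>} ys"
    using mcm_depth_attained[OF mcm ne] by metis
  obtain ys where ys: "length ys = d" "set ys \<subseteq> max_ideal R" "regseq M {\<zero>\<^bsub>M\<^esub>} ys" using ex by blast
  have un: "u \<notin> {\<zero>\<^bsub>M\<^esub>}" using u(3) by simp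
  obtain v where v: "v \<in> carrier M" "v \<notin> {\<zero>\<^bsub>M\<^esub>}" "primeideal (colon R M {\<zero>\<^bsub>M\<^esub>} v) R"
    "colon R M {\<zero>\<^bsub>M\<^esub>} u \<subseteq> colon R M {\<zero>\<^bsub>M\<^esub>} v"
    using prime_colon_above[OF sub u(1) un] by blast
  have "x \<in> colon R M {\<zero>\<^bsub>M\<^esub>} u" using x u(2) by (simp add: colon_def)
  with v(4) have xv: "x \<in> colon R M {\<zero>\<^bsub>M\<^esub>} v" by blast
  obtain P where P: "P 0 = colon R M {\<zero>\<^bsub>M\<^esub>} v" "\<forall>i\<le>length ys. primeideal (P i) R"
    "\<forall>i<length ys. P i \<subset> P (Suc i)"
    using regseq_prime_chain[OF sub ys(2,3) v(1,2,3)] by metis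
  \<comment> \<open>A prime below that avoids \<open>x\<close> gives a chain of length
    \<open>d + 1\<close>, one more than the dimension allows.\<close>
  obtain q where q: "primeideal q R" "q \<subseteq> colon R M {\<zero>\<^bsub>M\<^esub>} v" "x \<notin> q"
    using prime_below[OF x nz v(3)] by blast
  have "q \<subset> P 0" using q xv P(1) by blast
  then have "prime_chain R (Suc d)"
    using prime_chain_Cons[of q R P d] q(1) P(2,3) ys(1) by simp
  then have "enat (Suc d) \<le> enat d" using prime_chain_le d by metis
  then show False by simp
qed

lemma mcm_reduction:
  assumes mcm: "mcm R M" and pres: "reduction_pres R M x N \<psi>"
    and nz: "\<And>a. a \<in> carrier R \<Longrightarrow> x \<otimes> a = \<zero> \<Longrightarrow> a = \<zero>"
  shows "mcm (R Quot (PIdl x)) N"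
proof -
  interpret reduction_pres R M x N \<psi> by (rule pres)
  have fg: "fg_module R M" using mcm by (simp add: mcm_def)
  have fgN: "fg_module (R Quot (PIdl x)) N"
  proof -
    obtain S where S: "finite S" "S \<subseteq> carrier M"
      and span: "\<forall>W. submodule W R M \<longrightarrow> S \<subseteq> W \<longrightarrow> W = carrier M"
      using fg_module_span_eq[OF fg] by metis
    have "W = carrier N" if W: "submodule W Q N" "\<psi> ` S \<subseteq> W" for W
    proof
      show "W \<subseteq> carrier N" using N.submodule_mem(1)[OF W(1)] by (rule subsetI)
      have "{m \<in> carrier M. \<psi> m \<in> W} = carrier M"
        using span submodule_vimage[OF W(1)] W(2) S(2) by blast
      then show "carrier N \<subseteq> W" unfolding psi_surj[symmetric] by blast
    qed
    moreover have "\<psi> ` S \<subseteq> carrier N" using S(2) psi_surj by blast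
    ultimately have "{W. submodule W Q N \<and> \<psi> ` S \<subseteq> W} = {carrier N}"
      using N.carrier_is_submodule by blast
    then have "module_span Q N (\<psi> ` S) = carrier N" by (simp add: module_span_def)
    then show ?thesis
      unfolding fg_module_def using N.module_axioms S(1) \<open>\<psi> ` S \<subseteq> carrier N\<close> by blast
  qed
  show ?thesis
  \<comment> \<open>The first case covers \<open>M = 0\<close> and units \<open>x\<close>: then
    \<open>M/xM\<close> is zero, which counts as maximal Cohen-Macaulay even when
    \<open>R/xR\<close> is the zero ring.\<close>
  proof (cases "ker = carrier M")
    case True
    then have "\<psi> m = \<zero>\<^bsub>N\<^esub>" if "m \<in> carrier M" for m using that by (auto simp: ker_def)
    then have "carrier N = {\<zero>\<^bsub>N\<^esub>}" unfolding psi_surj[symmetric] using M.M.zero_closed by (auto intro!: image_eqI)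
    with fgN show ?thesis by (simp add: mcm_def)
  next
    case False
    note kne = this
    have kerE: "ker = addm M {\<zero>\<^bsub>M\<^esub>} x"
    proof (intro equalityI subsetI)
      fix m assume "m \<in> ker"
      then have m: "m \<in> carrier M" "\<psi> m = \<zero>\<^bsub>N\<^esub>" by (simp_all add: ker_def)
      then obtain m' where m': "m' \<in> carrier M" "m = x \<odot>\<^bsub>M\<^esub> m'" using ker_iff by metis
      show "m \<in> addm M {\<zero>\<^bsub>M\<^esub>} x"
        by (rule M.addm_memI[of "\<zero>\<^bsub>M\<^esub>" _ m']) (use m m' in simp_all)
    next
      fix m assume "m \<in> addm M {\<zero>\<^bsub>M\<^esub>} x"
      then obtain m' where m': "m' \<in> carrier M" "m = \<zero>\<^bsub>M\<^esub> \<oplus>\<^bsub>M\<^esub> x \<odot>\<^bsub>M\<^esub> m'" by (auto simp: addm_def)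
      then have "m = x \<odot>\<^bsub>M\<^esub> m'" "m \<in> carrier M" using x_carrier by simp_all
      then show "m \<in> ker" using ker_iff[of m] m'(1) unfolding ker_def by blast
    qed
    have ne: "carrier M \<noteq> {\<zero>\<^bsub>M\<^esub>}"
    proof
      assume "carrier M = {\<zero>\<^bsub>M\<^esub>}"
      then have "ker = carrier M" using psi_zero by (auto simp: ker_def)
      with kne show False ..
    qed
    have x_max: "x \<in> max_ideal R"
    proof (rule ccontr)
      assume "x \<notin> max_ideal R"
      then have "x \<in> Units R" using nonunit_in_max_ideal[OF x_carrier] by blast
      then obtain y where y: "y \<in> carrier R" "x \<otimes> y = \<one>" unfolding Units_def by blast
      have "m \<in> ker" if m: "m \<in> carrier M" for m
      proof -
        have "m = x \<odot>\<^bsub>M\<^esub> (y \<odot>\<^bsub>M\<^esub> m)" using M.smult_assoc1[OF x_carrier y(1) m] y(2) m by simp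
        moreover have "y \<odot>\<^bsub>M\<^esub> m \<in> carrier M" using y m by simp
        ultimately have "\<psi> m = \<zero>\<^bsub>N\<^esub>" using ker_iff[OF m] by metis
        then show ?thesis using m by (simp add: ker_def)
      qed
      then have 1: "carrier M \<subseteq> ker" by (rule subsetI)
      have 2: "ker \<subseteq> carrier M" unfolding ker_def by (rule Collect_restrict)
      show False using kne equalityI[OF 2 1] by simp
    qed
    interpret X: noeth_local_quot R x
      by (rule noeth_local_quot.intro[OF noeth_local_axioms noeth_local_quot_axioms.intro[OF x_max nz]])
    interpret nm: noeth_module R M "max_ideal R" by (rule noeth_module_fg[OF fg])
    have sub: "submodule {\<zero>\<^bsub>M\<^esub>} R M"
      using semilinear.ker_submodule[OF semilinear_id(1)[OF M.module_axioms]]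
      unfolding semilinear_id(2)[OF M.module_axioms] .
    have nx: "nzd M {\<zero>\<^bsub>M\<^esub>} x" by (rule mcm_nzd[OF mcm x_carrier nz])
    obtain d where d: "krull_dim R = enat d"
      and ex: "\<exists>ys. length ys = d \<and> set ys \<subseteq> max_ideal R \<and> regseq M {\<zero>\<^bsub>M\<^esub>} ys"
      and le: "\<forall>ys. set ys \<subseteq> max_ideal R \<longrightarrow> regseq M {\<zero>\<^bsub>M\<^esub>} ys \<longrightarrow> length ys \<le> d"
      using mcm_depth_attained[OF mcm ne] by metis
    obtain ys where ys: "length ys = d" "set ys \<subseteq> max_ideal R" "regseq M {\<zero>\<^bsub>M\<^esub>} ys" using ex by blast
    \<comment> \<open>\<open>[x]\<close> is itself a regular sequence on \<open>M\<close>, so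
      \<open>d\<close> is positive; its predecessor \<open>n\<close> will be the depth and the
      dimension after reduction.\<close>
    have "length [x] \<le> d" using le[rule_format, of "[x]"] x_max nx by simp
    then obtain n where n: "d = Suc n" by (cases d) auto
    have "length ys = Suc n" using ys n by simp
    then obtain zs where zs: "length zs = n" "set zs \<subseteq> max_ideal R" "regseq M ker zs"
      using nm.regseq_exchange[OF sub _ ys(2,3) x_max nx] unfolding kerE by blast
    let ?P = "\<lambda>n. \<exists>ys. length ys = n \<and> set ys \<subseteq> max_ideal R \<and> regseq M ker ys"
    have dep: "depth Q N = Sup {enat n | n. ?P n}"
      by (rule depth_eq[OF nm.noeth_module_axioms X.max_ideal_quot kne])
    \<comment> \<open>Depth is at most dimension over \<open>Q\<close>: the chosen associated prime
      of \<open>M/xM\<close> contains \<open>x\<close>, hence so does every prime of the chain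
      starting from it, and the chain maps to \<open>Q\<close>.\<close>
    have chain: "prime_chain Q m" if m: "?P m" for m
    proof -
      obtain ws where ws: "length ws = m" "set ws \<subseteq> max_ideal R" "regseq M ker ws" using m by blast
      obtain u where u: "u \<in> carrier M" "u \<notin> ker" using kne by (auto simp: ker_def)
      obtain v where v: "v \<in> carrier M" "v \<notin> ker" "primeideal (colon R M ker v) R"
        using nm.prime_colon_above[OF ker_submodule u] by blast
      obtain P where P: "P 0 = colon R M ker v" "\<forall>i\<le>length ws. primeideal (P i) R"
        "\<forall>i<length ws. P i \<subset> P (Suc i)"
        using nm.regseq_prime_chain[OF ker_submodule ws(2,3) v] by metis
      have "x \<odot>\<^bsub>M\<^esub> v \<in> ker" unfolding kerE by (rule M.addm_sup(2)[OF sub x_carrier v(1)])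
      then have "x \<in> P 0" unfolding P(1) using x_carrier by (simp add: colon_def)
      then show ?thesis using X.prime_chain_image[of m P] P(2,3) ws(1) by simp
    qed
    have upper: "m \<le> n" if "prime_chain Q m" for m
    proof -
      have "enat (Suc m) \<le> enat d" using prime_chain_le[OF X.prime_chain_lift[OF that]] d by simp
      then show ?thesis using n by simp
    qed
    have Pn: "?P n" using zs by blast
    \<comment> \<open>The upper bound comes from \<open>prime_chain_lift\<close>, the lower bound
      from the sequence \<open>zs\<close> of length \<open>n\<close> on \<open>M/xM\<close>.\<close>
    have "krull_dim Q = enat n"
    proof (rule antisym)
      show "krull_dim Q \<le> enat n" unfolding krull_dim_eq by (rule Sup_least) (use upper in auto)
      show "enat n \<le> krull_dim Q" by (rule prime_chain_le[OF chain[OF Pn]])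
    qed
    moreover have "depth Q N = enat n"
      unfolding dep
    proof (rule antisym)
      show "Sup {enat n | n. ?P n} \<le> enat n"
      proof (rule Sup_least)
        fix e assume "e \<in> {enat n | n. ?P n}"
        then obtain m where "e = enat m" "?P m" by blast
        then show "e \<le> enat n" using upper[OF chain] by simp
      qed
      show "enat n \<le> Sup {enat n | n. ?P n}" by (rule Sup_upper) (use Pn in blast)
    qed
    ultimately show ?thesis using fgN by (simp add: mcm_def)
  qed
qed

end

section \<open>Copies of \<open>M/xM\<close> and independence of representatives\<close>

lemma surjective_image_module:
  assumes M: "Module.module R M" and R': "cring R'" and \<rho>: "\<rho> \<in> ring_hom R R'" "\<rho> ` carrier R = carrier R'"
    and surj: "\<psi> ` carrier M = carrier N" and zero: "\<psi> \<zero>\<^bsub>M\<^esub> = \<zero>\<^bsub>N\<^esub>"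
    and add: "\<And>m m'. m \<in> carrier M \<Longrightarrow> m' \<in> carrier M \<Longrightarrow> \<psi> (m \<oplus>\<^bsub>M\<^esub> m') = \<psi> m \<oplus>\<^bsub>N\<^esub> \<psi> m'"
    and smult: "\<And>r m. r \<in> carrier R \<Longrightarrow> m \<in> carrier M \<Longrightarrow> \<psi> (r \<odot>\<^bsub>M\<^esub> m) = \<rho> r \<odot>\<^bsub>N\<^esub> \<psi> m"
  shows "Module.module R' N"
proof -
  interpret M: Module.module R M by (rule M)
  interpret R': cring R' by (rule R')
  have ex: "\<exists>m\<in>carrier M. n = \<psi> m" if "n \<in> carrier N" for n using that surj by blast
  have exR: "\<exists>r\<in>carrier R. s = \<rho> r" if "s \<in> carrier R'" for s using that \<rho>(2) by blast
  have cl: "\<psi> m \<in> carrier N" if "m \<in> carrier M" for m using that surj by blast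
  show ?thesis
  proof (rule Module.moduleI[OF R'])
    show "abelian_group N"
    proof (rule abelian_groupI)
      fix a b assume "a \<in> carrier N" "b \<in> carrier N"
      then obtain m k where m: "m \<in> carrier M" "a = \<psi> m" and k: "k \<in> carrier M" "b = \<psi> k" using ex by metis
      show "a \<oplus>\<^bsub>N\<^esub> b \<in> carrier N" using add[OF m(1) k(1)] cl[of "m \<oplus>\<^bsub>M\<^esub> k"] m k by simp
      show "a \<oplus>\<^bsub>N\<^esub> b = b \<oplus>\<^bsub>N\<^esub> a"
        using add[OF m(1) k(1)] add[OF k(1) m(1)] m k by (simp add: M.M.a_comm)
      fix c assume "c \<in> carrier N"
      then obtain l where l: "l \<in> carrier M" "c = \<psi> l" using ex by metis
      show "a \<oplus>\<^bsub>N\<^esub> b \<oplus>\<^bsub>N\<^esub> c = a \<oplus>\<^bsub>N\<^esub> (b \<oplus>\<^bsub>N\<^esub> c)"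
        using add[of "m \<oplus>\<^bsub>M\<^esub> k" l] add[of m "k \<oplus>\<^bsub>M\<^esub> l"] add[OF m(1) k(1)] add[OF k(1) l(1)] m k l
        by (simp add: M.M.a_assoc)
    next
      show "\<zero>\<^bsub>N\<^esub> \<in> carrier N" using cl[OF M.M.zero_closed] zero by simp
      fix a assume "a \<in> carrier N"
      then obtain m where m: "m \<in> carrier M" "a = \<psi> m" using ex by metis
      show "\<zero>\<^bsub>N\<^esub> \<oplus>\<^bsub>N\<^esub> a = a" using add[OF M.M.zero_closed m(1)] m zero by simp
      show "\<exists>b\<in>carrier N. b \<oplus>\<^bsub>N\<^esub> a = \<zero>\<^bsub>N\<^esub>"
        using add[of "\<ominus>\<^bsub>M\<^esub> m" m] m zero cl[of "\<ominus>\<^bsub>M\<^esub> m"]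
        by (intro bexI[of _ "\<psi> (\<ominus>\<^bsub>M\<^esub> m)"]) (simp_all add: M.M.l_neg)
    qed
  next
    fix s n assume "s \<in> carrier R'" "n \<in> carrier N"
    then obtain r m where r: "r \<in> carrier R" "s = \<rho> r" and m: "m \<in> carrier M" "n = \<psi> m" using ex exR by metis
    show "s \<odot>\<^bsub>N\<^esub> n \<in> carrier N" using smult[OF r(1) m(1)] cl[of "r \<odot>\<^bsub>M\<^esub> m"] r m by simp
    fix t assume "t \<in> carrier R'"
    then obtain q where q: "q \<in> carrier R" "t = \<rho> q" using exR by metis
    show "(s \<oplus>\<^bsub>R'\<^esub> t) \<odot>\<^bsub>N\<^esub> n = s \<odot>\<^bsub>N\<^esub> n \<oplus>\<^bsub>N\<^esub> t \<odot>\<^bsub>N\<^esub> n"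
      using smult[of "r \<oplus>\<^bsub>R\<^esub> q" m] smult[OF r(1) m(1)] smult[OF q(1) m(1)]
        add[of "r \<odot>\<^bsub>M\<^esub> m" "q \<odot>\<^bsub>M\<^esub> m"] ring_hom_add[OF \<rho>(1) r(1) q(1)] r q m
      by (simp add: M.smult_l_distr)
    show "s \<otimes>\<^bsub>R'\<^esub> t \<odot>\<^bsub>N\<^esub> n = s \<odot>\<^bsub>N\<^esub> (t \<odot>\<^bsub>N\<^esub> n)"
      using smult[of "r \<otimes>\<^bsub>R\<^esub> q" m] smult[of r "q \<odot>\<^bsub>M\<^esub> m"] smult[OF q(1) m(1)]
        ring_hom_mult[OF \<rho>(1) r(1) q(1)] r q m
      by (simp add: M.smult_assoc1)
  next
    fix s n n' assume "s \<in> carrier R'" "n \<in> carrier N" "n' \<in> carrier N"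
    then obtain r m m' where r: "r \<in> carrier R" "s = \<rho> r" and m: "m \<in> carrier M" "n = \<psi> m"
      and m': "m' \<in> carrier M" "n' = \<psi> m'" using ex exR by metis
    show "s \<odot>\<^bsub>N\<^esub> (n \<oplus>\<^bsub>N\<^esub> n') = s \<odot>\<^bsub>N\<^esub> n \<oplus>\<^bsub>N\<^esub> s \<odot>\<^bsub>N\<^esub> n'"
      using smult[of r "m \<oplus>\<^bsub>M\<^esub> m'"] smult[OF r(1) m(1)] smult[OF r(1) m'(1)]
        add[of "r \<odot>\<^bsub>M\<^esub> m" "r \<odot>\<^bsub>M\<^esub> m'"] add[OF m(1) m'(1)] r m m'
      by (simp add: M.smult_r_distr)
  next
    fix n assume "n \<in> carrier N"
    then obtain m where m: "m \<in> carrier M" "n = \<psi> m" using ex by metis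
    show "\<one>\<^bsub>R'\<^esub> \<odot>\<^bsub>N\<^esub> n = n"
      using smult[OF M.R.one_closed m(1)] ring_hom_one[OF \<rho>(1)] m by simp
  qed
qed

lemma reduction_pres_reduction:
  assumes M: "Module.module R M" and x: "x \<in> carrier R"
  defines "K \<equiv> (\<lambda>m. x \<odot>\<^bsub>M\<^esub> m) ` carrier M"
  shows "reduction_pres R M x (reduction M x) (\<lambda>m. K +>\<^bsub>M\<^esub> m)"
proof -
  interpret M: plain_module R M by (intro plain_module.intro M)
  let ?I = "PIdl\<^bsub>R\<^esub> x"
  have I: "ideal ?I R" by (rule M.R.cgenideal_ideal[OF x])
  have K: "submodule K R M"
    unfolding K_def
  proof (rule M.lin_map_image_submodule[OF M])
    show "lin_map R M M (\<lambda>m. x \<odot>\<^bsub>M\<^esub> m)"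
      using x by (auto simp: lin_map_def M.smult_r_distr M.smult_commute[of x])
  qed
  interpret K: abelian_subgroup K M by (rule M.submodule_abelian_subgroup[OF K])
  note Km = M.submodule_mem[OF K]
  have simps: "carrier (reduction M x) = (\<lambda>m. K +>\<^bsub>M\<^esub> m) ` carrier M" "\<zero>\<^bsub>reduction M x\<^esub> = K"
    "add (reduction M x) = set_add M"
    "smult (reduction M x) = (\<lambda>A B. \<Union>a\<in>A. \<Union>b\<in>B. K +>\<^bsub>M\<^esub> (a \<odot>\<^bsub>M\<^esub> b))"
    by (auto simp: reduction_def Let_def K_def A_RCOSETS_def')
  have add: "K +>\<^bsub>M\<^esub> (m \<oplus>\<^bsub>M\<^esub> m') = (K +>\<^bsub>M\<^esub> m) \<oplus>\<^bsub>reduction M x\<^esub> (K +>\<^bsub>M\<^esub> m')"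
    if "m \<in> carrier M" "m' \<in> carrier M" for m m'
    unfolding simps using K.a_rcos_sum[OF that] by simp
  have coset_eq: "K +>\<^bsub>M\<^esub> (k \<oplus>\<^bsub>M\<^esub> m) = K +>\<^bsub>M\<^esub> m" if "k \<in> K" "m \<in> carrier M" for k m
  proof -
    have "k \<oplus>\<^bsub>M\<^esub> m \<in> K +>\<^bsub>M\<^esub> m" using that by (auto simp: a_r_coset_def')
    then show ?thesis using K.a_repr_independence'[of "k \<oplus>\<^bsub>M\<^esub> m" m] that by simp
  qed
  have smult: "K +>\<^bsub>M\<^esub> (r \<odot>\<^bsub>M\<^esub> m) = (?I +>\<^bsub>R\<^esub> r) \<odot>\<^bsub>reduction M x\<^esub> (K +>\<^bsub>M\<^esub> m)"
    if r: "r \<in> carrier R" and m: "m \<in> carrier M" for r m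
  proof -
    \<comment> \<open>Products of arbitrary representatives \<open>a = i + r\<close> and
      \<open>b = k + m\<close> differ from \<open>r m\<close> by \<open>a k + i m\<close>, which
      lies in \<open>xM\<close>; so the double union in \<open>reduction\<close> is a single
      coset.\<close>
    have eq: "K +>\<^bsub>M\<^esub> (a \<odot>\<^bsub>M\<^esub> b) = K +>\<^bsub>M\<^esub> (r \<odot>\<^bsub>M\<^esub> m)"
      if a: "a \<in> ?I +>\<^bsub>R\<^esub> r" and b: "b \<in> K +>\<^bsub>M\<^esub> m" for a b
    proof -
      obtain i where i: "i \<in> ?I" "a = i \<oplus>\<^bsub>R\<^esub> r" using a by (auto simp: a_r_coset_def')
      obtain k where k: "k \<in> K" "b = k \<oplus>\<^bsub>M\<^esub> m" using b by (auto simp: a_r_coset_def')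
      obtain c where c: "c \<in> carrier R" "i = c \<otimes>\<^bsub>R\<^esub> x" using i(1) by (auto simp: cgenideal_def)
      have iR: "i \<in> carrier R" and kM: "k \<in> carrier M" using c x Km(1)[OF k(1)] by auto
      have "i \<odot>\<^bsub>M\<^esub> m = x \<odot>\<^bsub>M\<^esub> (c \<odot>\<^bsub>M\<^esub> m)"
        using c x m by (simp add: M.smult_assoc1 M.smult_commute[of c x])
      then have im: "i \<odot>\<^bsub>M\<^esub> m \<in> K" using c m unfolding K_def by auto
      have "a \<odot>\<^bsub>M\<^esub> b = (a \<odot>\<^bsub>M\<^esub> k \<oplus>\<^bsub>M\<^esub> i \<odot>\<^bsub>M\<^esub> m) \<oplus>\<^bsub>M\<^esub> r \<odot>\<^bsub>M\<^esub> m"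
        unfolding k(2) using i(2) iR r kM m by (simp add: M.smult_r_distr M.smult_l_distr M.M.a_assoc)
      moreover have "a \<odot>\<^bsub>M\<^esub> k \<oplus>\<^bsub>M\<^esub> i \<odot>\<^bsub>M\<^esub> m \<in> K"
        by (rule Km(3)[OF Km(6)[OF _ k(1)] im]) (use i(2) iR r in simp)
      ultimately show ?thesis using coset_eq r m by simp
    qed
    have "r \<in> ?I +>\<^bsub>R\<^esub> r" using ideal.axioms(1)[OF I] r
      by (metis M.R.abelian_group_axioms abelian_subgroup.a_rcos_self abelian_subgroupI3)
    moreover have "m \<in> K +>\<^bsub>M\<^esub> m" by (rule K.a_rcos_self[OF m])
    ultimately have "(\<Union>a\<in>?I +>\<^bsub>R\<^esub> r. \<Union>b\<in>K +>\<^bsub>M\<^esub> m. K +>\<^bsub>M\<^esub> (a \<odot>\<^bsub>M\<^esub> b)) = K +>\<^bsub>M\<^esub> (r \<odot>\<^bsub>M\<^esub> m)"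
      using eq by blast
    then show ?thesis unfolding simps by simp
  qed
  have rs: "(\<lambda>r. ?I +>\<^bsub>R\<^esub> r) ` carrier R = carrier (R Quot ?I)"
    by (auto simp: FactRing_def A_RCOSETS_def')
  have rh: "(\<lambda>r. ?I +>\<^bsub>R\<^esub> r) \<in> ring_hom R (R Quot ?I)" by (rule ideal.rcos_ring_hom[OF I])
  have z: "K +>\<^bsub>M\<^esub> \<zero>\<^bsub>M\<^esub> = \<zero>\<^bsub>reduction M x\<^esub>"
    using M.coset_simps(1)[OF K M.M.zero_closed] Km(2) simps by simp
  have "Module.module (R Quot ?I) (reduction M x)"
    by (rule surjective_image_module[OF M ideal.quotient_is_cring[OF I M.R.is_cring] rh rs _ z add smult])
      (simp_all add: simps)
  then show ?thesis
  proof (intro reduction_pres.intro semilinear.intro semilinear_axioms.intro reduction_pres_axioms.intro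
      plain_module.intro M rh rs add smult x)
    show "(\<lambda>m. K +>\<^bsub>M\<^esub> m) ` carrier M = carrier (reduction M x)" by (simp add: simps)
    show "(K +>\<^bsub>M\<^esub> m = \<zero>\<^bsub>reduction M x\<^esub>) = (\<exists>m'\<in>carrier M. m = x \<odot>\<^bsub>M\<^esub> m')" if "m \<in> carrier M" for m
      unfolding simps M.coset_simps(1)[OF K that] by (auto simp: K_def)
  qed
qed

lemma module_isoE:
  assumes "module_iso R M N"
  obtains f where "lin_map R M N f" "bij_betw f (carrier M) (carrier N)"
  using assms by (auto simp: module_iso_def module_hom_iff)

lemma module_isoI:
  assumes M: "Module.module R M" and f: "lin_map R M N f" "bij_betw f (carrier M) (carrier N)"
  shows "module_iso R M N"
proof -
  have "bij_betw (restrict f (carrier M)) (carrier M) (carrier N)"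
    using f(2) bij_betw_cong[of "carrier M" "restrict f (carrier M)" f] by simp
  then show ?thesis unfolding module_iso_def using lin_map_restrict[OF M f(1)] by blast
qed

lemma module_iso_refl:
  assumes "Module.module R M"
  shows "module_iso R M M"
  by (rule module_isoI[OF assms, of _ "\<lambda>m. m"]) (auto simp: lin_map_def bij_betw_def)

lemma reduction_pres_iso:
  assumes pres: "reduction_pres R M x N \<psi>" and N': "Module.module (R Quot (PIdl\<^bsub>R\<^esub> x)) N'"
    and iso: "module_iso (R Quot (PIdl\<^bsub>R\<^esub> x)) N N'"
  shows "\<exists>\<psi>'. reduction_pres R M x N' \<psi>'"
proof -
  interpret reduction_pres R M x N \<psi> by (rule pres)
  interpret N': Module.module Q N' by (rule N')
  obtain f where f: "lin_map Q N N' f" "bij_betw f (carrier N) (carrier N')" using module_isoE[OF iso] .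
  have f0: "f \<zero>\<^bsub>N\<^esub> = \<zero>\<^bsub>N'\<^esub>" by (rule N.lin_map_zero[OF N' f(1)])
  have "reduction_pres R M x N' (\<lambda>m. f (\<psi> m))"
  proof (intro reduction_pres.intro semilinear.intro semilinear_axioms.intro reduction_pres_axioms.intro
      plain_module.intro M.module_axioms N' rho_hom rho_surj x_carrier)
    show "(\<lambda>m. f (\<psi> m)) ` carrier M = carrier N'"
      using bij_betw_imp_surj_on[OF f(2)] psi_surj by (metis image_image)
    show "f (\<psi> (m \<oplus>\<^bsub>M\<^esub> m')) = f (\<psi> m) \<oplus>\<^bsub>N'\<^esub> f (\<psi> m')" if "m \<in> carrier M" "m' \<in> carrier M" for m m'
      using psi_add[OF that] lin_mapD(2)[OF f(1) psi_closed[OF that(1)] psi_closed[OF that(2)]] by simp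
    show "f (\<psi> (r \<odot>\<^bsub>M\<^esub> m)) = \<rho> r \<odot>\<^bsub>N'\<^esub> f (\<psi> m)" if "r \<in> carrier R" "m \<in> carrier M" for r m
      using psi_smult[OF that] lin_mapD(3)[OF f(1) rho_closed[OF that(1)] psi_closed[OF that(2)]] by simp
    show "(f (\<psi> m) = \<zero>\<^bsub>N'\<^esub>) = (\<exists>m'\<in>carrier M. m = x \<odot>\<^bsub>M\<^esub> m')" if m: "m \<in> carrier M" for m
    proof -
      have "f (\<psi> m) = \<zero>\<^bsub>N'\<^esub> \<longleftrightarrow> \<psi> m = \<zero>\<^bsub>N\<^esub>"
        using inj_onD[OF bij_betw_imp_inj_on[OF f(2)], of "\<psi> m" "\<zero>\<^bsub>N\<^esub>"] psi_closed[OF m] f0 by auto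
      then show ?thesis using ker_iff[OF m] by simp
    qed
  qed
  then show ?thesis by (rule exI[where x = "\<lambda>m. f (\<psi> m)"])
qed

lemma reduction_pres_source_iso:
  assumes pres: "reduction_pres R M' x N \<psi>" and M: "Module.module R M" and iso: "module_iso R M M'"
  shows "\<exists>\<psi>'. reduction_pres R M x N \<psi>'"
proof -
  interpret reduction_pres R M' x N \<psi> by (rule pres)
  interpret M0: Module.module R M by (rule M)
  obtain f where f: "lin_map R M M' f" "bij_betw f (carrier M) (carrier M')" using module_isoE[OF iso] .
  note fc = lin_mapD(1)[OF f(1)] and g = M0.lin_map_inverse[OF f]
  let ?g = "inv_into (carrier M) f"
  have "reduction_pres R M x N (\<lambda>m. \<psi> (f m))"
  proof (intro reduction_pres.intro semilinear.intro semilinear_axioms.intro reduction_pres_axioms.intro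
      plain_module.intro M N.module_axioms rho_hom rho_surj x_carrier)
    show "(\<lambda>m. \<psi> (f m)) ` carrier M = carrier N"
      using bij_betw_imp_surj_on[OF f(2)] psi_surj by (metis image_image)
    show "\<psi> (f (m \<oplus>\<^bsub>M\<^esub> m')) = \<psi> (f m) \<oplus>\<^bsub>N\<^esub> \<psi> (f m')" if "m \<in> carrier M" "m' \<in> carrier M" for m m'
      using psi_add[OF fc[OF that(1)] fc[OF that(2)]] lin_mapD(2)[OF f(1) that] by simp
    show "\<psi> (f (r \<odot>\<^bsub>M\<^esub> m)) = \<rho> r \<odot>\<^bsub>N\<^esub> \<psi> (f m)" if "r \<in> carrier R" "m \<in> carrier M" for r m
      using psi_smult[OF that(1) fc[OF that(2)]] lin_mapD(3)[OF f(1) that] by simp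
    show "(\<psi> (f m) = \<zero>\<^bsub>N\<^esub>) = (\<exists>m'\<in>carrier M. m = x \<odot>\<^bsub>M\<^esub> m')" if m: "m \<in> carrier M" for m
      unfolding ker_iff[OF fc[OF m]]
    proof
      assume "\<exists>m'\<in>carrier M'. f m = x \<odot>\<^bsub>M'\<^esub> m'"
      then obtain m' where m': "m' \<in> carrier M'" "f m = x \<odot>\<^bsub>M'\<^esub> m'" by blast
      have "m = ?g (f m)" using g(2)[OF m] by simp
      also have "\<dots> = x \<odot>\<^bsub>M\<^esub> ?g m'" unfolding m'(2) by (rule lin_mapD(3)[OF g(1) x_carrier m'(1)])
      finally show "\<exists>m'\<in>carrier M. m = x \<odot>\<^bsub>M\<^esub> m'" using lin_mapD(1)[OF g(1) m'(1)] by blast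
    next
      assume "\<exists>m'\<in>carrier M. m = x \<odot>\<^bsub>M\<^esub> m'"
      then obtain m' where m': "m' \<in> carrier M" "m = x \<odot>\<^bsub>M\<^esub> m'" by blast
      then have "f m = x \<odot>\<^bsub>M'\<^esub> f m'" using lin_mapD(3)[OF f(1) x_carrier m'(1)] by simp
      then show "\<exists>m'\<in>carrier M'. f m = x \<odot>\<^bsub>M'\<^esub> m'" using fc[OF m'(1)] by blast
    qed
  qed
  then show ?thesis by (rule exI[where x = "\<lambda>m. \<psi> (f m)"])
qed

text \<open>Both kernels are \<open>xM\<close>, so \<open>\<psi>\<close> and \<open>\<psi>'\<close>
  identify the same elements of \<open>M\<close>. Together with the transport along isomorphisms of
  source and target, this makes the value of \<open>cm_reduction\<close> a single isomorphism
  class.\<close>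

lemma reduction_pres_unique:
  assumes p: "reduction_pres R M x N \<psi>" and p': "reduction_pres R M x N' \<psi>'"
  shows "module_iso (R Quot (PIdl\<^bsub>R\<^esub> x)) N N'"
proof -
  interpret reduction_pres R M x N \<psi> by (rule p)
  interpret P: reduction_pres R M x N' \<psi>' by (rule p')
  define \<sigma> where "\<sigma> n = (SOME m. m \<in> carrier M \<and> \<psi> m = n)" for n
  have \<sigma>: "\<sigma> n \<in> carrier M \<and> \<psi> (\<sigma> n) = n" if "n \<in> carrier N" for n
    unfolding \<sigma>_def by (rule someI_ex) (use psi_obtain[OF that] in metis)
  have same: "\<psi> m = \<psi> m' \<longleftrightarrow> \<psi>' m = \<psi>' m'" if m: "m \<in> carrier M" and m': "m' \<in> carrier M" for m m'
  proof -
    have d: "m \<ominus>\<^bsub>M\<^esub> m' \<in> carrier M" using that by simp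
    have e: "m = (m \<ominus>\<^bsub>M\<^esub> m') \<oplus>\<^bsub>M\<^esub> m'" using that by (simp add: M.M.add_minus_cancel)
    have "\<psi> m = \<psi> (m \<ominus>\<^bsub>M\<^esub> m') \<oplus>\<^bsub>N\<^esub> \<psi> m'" using psi_add[OF d m'] e by simp
    then have 1: "\<psi> m = \<psi> m' \<longleftrightarrow> \<psi> (m \<ominus>\<^bsub>M\<^esub> m') = \<zero>\<^bsub>N\<^esub>"
      using psi_closed[OF d] psi_closed[OF m'] by simp
    have "\<psi>' m = \<psi>' (m \<ominus>\<^bsub>M\<^esub> m') \<oplus>\<^bsub>N'\<^esub> \<psi>' m'" using P.psi_add[OF d m'] e by simp
    then have 2: "\<psi>' m = \<psi>' m' \<longleftrightarrow> \<psi>' (m \<ominus>\<^bsub>M\<^esub> m') = \<zero>\<^bsub>N'\<^esub>"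
      using P.psi_closed[OF d] P.psi_closed[OF m'] by simp
    show ?thesis unfolding 1 2 ker_iff[OF d] P.ker_iff[OF d] ..
  qed
  define f where "f n = \<psi>' (\<sigma> n)" for n
  have f\<psi>: "f (\<psi> m) = \<psi>' m" if m: "m \<in> carrier M" for m
    unfolding f_def using same[OF _ m, of "\<sigma> (\<psi> m)"] \<sigma>[OF psi_closed[OF m]] by simp
  have lin: "lin_map Q N N' f"
    unfolding lin_map_def
  proof (intro conjI ballI)
    fix n assume n: "n \<in> carrier N"
    obtain m where m: "m \<in> carrier M" "n = \<psi> m" using psi_obtain[OF n] .
    show "f n \<in> carrier N'" using f\<psi>[OF m(1)] m(2) P.psi_closed[OF m(1)] by simp
    fix n' assume n': "n' \<in> carrier N"
    obtain m' where m': "m' \<in> carrier M" "n' = \<psi> m'" using psi_obtain[OF n'] .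
    show "f (n \<oplus>\<^bsub>N\<^esub> n') = f n \<oplus>\<^bsub>N'\<^esub> f n'"
      using f\<psi>[of "m \<oplus>\<^bsub>M\<^esub> m'"] psi_add[OF m(1) m'(1)] P.psi_add[OF m(1) m'(1)] f\<psi>[OF m(1)] f\<psi>[OF m'(1)] m m'
      by simp
  next
    fix a n assume a: "a \<in> carrier Q" and n: "n \<in> carrier N"
    obtain m where m: "m \<in> carrier M" "n = \<psi> m" using psi_obtain[OF n] .
    obtain r where r: "r \<in> carrier R" "a = \<rho> r" using rho_obtain[OF a] .
    show "f (a \<odot>\<^bsub>N\<^esub> n) = a \<odot>\<^bsub>N'\<^esub> f n"
      using f\<psi>[of "r \<odot>\<^bsub>M\<^esub> m"] psi_smult[OF r(1) m(1)] P.psi_smult[OF r(1) m(1)] f\<psi>[OF m(1)] m r by simp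
  qed
  have "bij_betw f (carrier N) (carrier N')"
    unfolding bij_betw_def
  proof
    show "inj_on f (carrier N)"
      unfolding psi_surj[symmetric] by (rule inj_onI) (use f\<psi> same in force)
    show "f ` carrier N = carrier N'"
      unfolding psi_surj[symmetric] P.psi_surj[symmetric] image_image using f\<psi> by simp
  qed
  then show ?thesis by (rule module_isoI[OF N.module_axioms lin])
qed

lemma (in cring) stable_ann_iso_subset:
  assumes M: "Module.module R M" and N: "Module.module R N" and iso: "module_iso R M N"
  shows "stable_ann R M \<subseteq> stable_ann R N"
proof
  interpret M: Module.module R M by (rule M)
  obtain f where f: "lin_map R M N f" "bij_betw f (carrier M) (carrier N)" using module_isoE[OF iso] .
  note g = M.lin_map_inverse[OF f]
  let ?g = "inv_into (carrier M) f"
  fix r assume "r \<in> stable_ann R M"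
  then have r: "r \<in> carrier R" and rep: "dual_rep R M M (\<lambda>y. r \<odot>\<^bsub>M\<^esub> y)"
    using stable_ann_iff[OF M] by auto
  have "dual_rep R N N (\<lambda>z. f (r \<odot>\<^bsub>M\<^esub> ?g z))" by (rule dual_rep_comp[OF M N rep g(1) f(1)])
  then have "dual_rep R N N (\<lambda>z. r \<odot>\<^bsub>N\<^esub> z)"
  proof (rule dual_rep_cong)
    fix z assume z: "z \<in> carrier N"
    show "r \<odot>\<^bsub>N\<^esub> z = f (r \<odot>\<^bsub>M\<^esub> ?g z)"
      using lin_mapD(3)[OF f(1) r lin_mapD(1)[OF g(1) z]] g(3)[OF z] by simp
  qed
  with r show "r \<in> stable_ann R N" using stable_ann_iff[OF N] by blast
qed

lemma (in cring) class_ann_iso_class: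
  fixes M :: "('a, 'a univ) module"
  assumes M: "Module.module R M"
  shows "class_ann R (iso_class R M) = stable_ann R M"
proof
  have "M \<in> iso_class R M" using M module_iso_refl by (simp add: iso_class_def)
  then show "class_ann R (iso_class R M) \<subseteq> stable_ann R M" by (auto simp: class_ann_def)
  show "stable_ann R M \<subseteq> class_ann R (iso_class R M)"
    unfolding class_ann_def using stable_ann_iso_subset[OF M] by (auto simp: iso_class_def)
qed

theorem theorem3p3:
  fixes R :: "('a, 'b) ring_scheme" and x :: 'a
  assumes "gorenstein_local_ring R"
    and "x \<in> coh_ann R"
    and "nonzerodivisor_on (regular_module R) x"
  shows "continuous_map (cm_topology R) (cm_topology (R Quot (PIdl\<^bsub>R\<^esub> x))) (cm_reduction R x)"
proof -
  let ?Q = "R Quot (PIdl\<^bsub>R\<^esub> x)"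
  have "local_ring R" "noetherian_ring R" using assms(1) by (auto simp: gorenstein_local_ring_def)
  then interpret noeth_local R
    by (intro noeth_local.intro noeth_local_axioms.intro) (auto simp: local_ring_def)
  have nz: "a = \<zero>\<^bsub>R\<^esub>" if "a \<in> carrier R" "x \<otimes>\<^bsub>R\<^esub> a = \<zero>\<^bsub>R\<^esub>" for a
    using assms(3) that by (simp add: nonzerodivisor_on_def)
  have xa: "x \<in> stable_ann R M" if "mcm R M" for M :: "('a, 'a univ) module"
    using assms(2) that by (auto simp: coh_ann_def)
  \<comment> \<open>All that continuity needs to know about one class: the image is a point of
    \<open>CM ?Q\<close>, its annihilator is tested on representatives by that of \<open>c\<close>,
    and every element of it is the coset of some \<open>r\<close>.\<close>
  have main: "cm_reduction R x c \<in> CM ?Q \<and>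
      (\<forall>r\<in>carrier R. PIdl\<^bsub>R\<^esub> x +>\<^bsub>R\<^esub> r \<in> class_ann ?Q (cm_reduction R x c) \<longleftrightarrow> r \<in> class_ann R c) \<and>
      class_ann ?Q (cm_reduction R x c) \<subseteq> (\<lambda>r. PIdl\<^bsub>R\<^esub> x +>\<^bsub>R\<^esub> r) ` carrier R"
    if c: "c \<in> CM R" for c
  proof -
    obtain M :: "('a, 'a univ) module" where M: "mcm R M" "c = iso_class R M" using c by (auto simp: CM_def)
    have Mm: "Module.module R M" using M(1) by (simp add: mcm_def fg_module_def)
    have x: "x \<in> carrier R" using xa[OF M(1)] stable_ann_iff[OF Mm] by blast
    \<comment> \<open>A copy of \<open>M/xM\<close> in the universe is needed, because the points of
      \<open>CM ?Q\<close> are sets of such modules.\<close>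
    have "\<exists>N :: ('a set, 'a set univ) module. Module.module ?Q N \<and> module_iso ?Q (reduction M x) N"
    proof (rule fg_module_in_universe)
      show "fg_module ?Q (reduction M x)"
        using mcm_reduction[OF M(1) reduction_pres_reduction[OF Mm x] nz] by (simp add: mcm_def)
    qed
    then obtain N0 :: "('a set, 'a set univ) module" where N0: "Module.module ?Q N0" "module_iso ?Q (reduction M x) N0"
      by blast
    obtain \<psi> where \<psi>: "reduction_pres R M x N0 \<psi>"
      using reduction_pres_iso[OF reduction_pres_reduction[OF Mm x] N0] by blast
    \<comment> \<open>Every copy of the reduction of any representative of \<open>c\<close> is also
      presented by the one module \<open>M\<close>, so uniqueness of presentations gathers them all
      in the class of \<open>N0\<close>.\<close>
    have eq: "cm_reduction R x c = iso_class ?Q N0"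
    proof (intro equalityI subsetI)
      fix N assume "N \<in> cm_reduction R x c"
      then obtain M' :: "('a, 'a univ) module" where M': "Module.module R M'" "module_iso R M M'"
        and N: "Module.module ?Q N" "module_iso ?Q (reduction M' x) N"
        by (auto simp: cm_reduction_def M(2) iso_class_def)
      obtain \<psi>' where "reduction_pres R M' x N \<psi>'"
        using reduction_pres_iso[OF reduction_pres_reduction[OF M'(1) x] N] by blast
      then obtain \<psi>'' where "reduction_pres R M x N \<psi>''" using reduction_pres_source_iso[OF _ Mm M'(2)] by blast
      then have "module_iso ?Q N0 N" by (rule reduction_pres_unique[OF \<psi>])
      then show "N \<in> iso_class ?Q N0" using N by (simp add: iso_class_def)
    next
      fix N assume "N \<in> iso_class ?Q N0"
      then have N: "Module.module ?Q N" "module_iso ?Q N0 N" by (auto simp: iso_class_def)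
      obtain \<psi>' where "reduction_pres R M x N \<psi>'" using reduction_pres_iso[OF \<psi> N] by blast
      then have "module_iso ?Q (reduction M x) N"
        by (rule reduction_pres_unique[OF reduction_pres_reduction[OF Mm x]])
      then have "N \<in> iso_class ?Q (reduction M x)" using N by (simp add: iso_class_def)
      moreover have "M \<in> c" using Mm module_iso_refl by (simp add: M(2) iso_class_def)
      ultimately show "N \<in> cm_reduction R x c" unfolding cm_reduction_def by blast
    qed
    interpret P: reduction_pres R M x N0 \<psi> by (rule \<psi>)
    have "mcm ?Q N0" by (rule mcm_reduction[OF M(1) \<psi> nz])
    then have "iso_class ?Q N0 \<in> CM ?Q" unfolding CM_def by blast
    moreover have cQ: "class_ann ?Q (iso_class ?Q N0) = stable_ann ?Q N0"
      by (rule cring.class_ann_iso_class[OF P.N.R.is_cring N0(1)])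
    moreover have cR: "class_ann R c = stable_ann R M"
      unfolding M(2) by (rule class_ann_iso_class[OF Mm])
    moreover have "P.\<rho> r \<in> stable_ann ?Q N0 \<longleftrightarrow> r \<in> stable_ann R M" if "r \<in> carrier R" for r
      using P.stable_ann_reduction_easy P.stable_ann_reduction_hard[OF xa[OF M(1)] mcm_nzd[OF M(1) x nz] nz that]
      by blast
    moreover have "stable_ann ?Q N0 \<subseteq> (\<lambda>r. PIdl\<^bsub>R\<^esub> x +>\<^bsub>R\<^esub> r) ` carrier R"
      using cring.stable_ann_iff[OF P.N.R.is_cring N0(1)] P.rho_surj by blast
    ultimately show ?thesis unfolding eq by simp
  qed
  have \<pi>CM: "cm_reduction R x c \<in> CM ?Q" if "c \<in> CM R" for c
    using main[OF that] by (rule conjunct1)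
  have \<pi>ann: "PIdl\<^bsub>R\<^esub> x +>\<^bsub>R\<^esub> r \<in> class_ann ?Q (cm_reduction R x c) \<longleftrightarrow> r \<in> class_ann R c"
    if "c \<in> CM R" "r \<in> carrier R" for c r
    using main[OF that(1)] that(2) by simp
  have \<pi>coset: "\<exists>r\<in>carrier R. a = PIdl\<^bsub>R\<^esub> x +>\<^bsub>R\<^esub> r"
    if "c \<in> CM R" "a \<in> class_ann ?Q (cm_reduction R x c)" for c a
  proof -
    have "a \<in> (\<lambda>r. PIdl\<^bsub>R\<^esub> x +>\<^bsub>R\<^esub> r) ` carrier R" using main[OF that(1)] that(2) by (meson subsetD)
    then show ?thesis by (elim imageE) (rule bexI)
  qed
  \<comment> \<open>Openness restated: \<open>U\<close> is closed under passing to classes with a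
    larger annihilator. \<open>S\<close> is left generic to serve both \<open>R\<close> and
    \<open>?Q\<close>.\<close>
  have eq: "CM S - U = (\<Union>c\<in>CM S - U. cm_cl S c) \<longleftrightarrow>
      (\<forall>c\<in>CM S. \<forall>l\<in>CM S. l \<in> U \<longrightarrow> class_ann S l \<subseteq> class_ann S c \<longrightarrow> c \<in> U)"
    for S :: "('e, 'f) ring_scheme" and U
    unfolding cm_cl_def by blast
  show ?thesis
    unfolding continuous_map_def
  proof (intro conjI allI impI)
    show "cm_reduction R x \<in> topspace (cm_topology R) \<rightarrow> topspace (cm_topology ?Q)" using \<pi>CM by simp
    fix U assume "openin (cm_topology ?Q) U"
    then have "U \<subseteq> CM ?Q \<and>
        (\<forall>c\<in>CM ?Q. \<forall>l\<in>CM ?Q. l \<in> U \<longrightarrow> class_ann ?Q l \<subseteq> class_ann ?Q c \<longrightarrow> c \<in> U)"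
      unfolding openin_cm_topology eq .
    note U = conjunct1[OF this] conjunct2[OF this]
    have step: "cm_reduction R x c \<in> U"
      if c: "c \<in> CM R" and l: "l \<in> CM R" "cm_reduction R x l \<in> U" and sub: "class_ann R l \<subseteq> class_ann R c" for c l
    proof -
      have "class_ann ?Q (cm_reduction R x l) \<subseteq> class_ann ?Q (cm_reduction R x c)"
      proof
        fix a assume a: "a \<in> class_ann ?Q (cm_reduction R x l)"
        \<comment> \<open>The coset \<open>a\<close> is represented by some \<open>r\<close>. The
          hard inclusion brings \<open>r\<close> into the annihilator of \<open>l\<close>,
          \<open>sub\<close> moves it into that of \<open>c\<close>, and the easy inclusion reduces
          it again.\<close>
        then obtain r where r: "r \<in> carrier R" "a = PIdl\<^bsub>R\<^esub> x +>\<^bsub>R\<^esub> r" using \<pi>coset[OF l(1)] by metis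
        have "r \<in> class_ann R l" using a \<pi>ann[OF l(1) r(1)] r(2) by simp
        then have "r \<in> class_ann R c" using sub by (rule subsetD[rotated])
        then show "a \<in> class_ann ?Q (cm_reduction R x c)" using \<pi>ann[OF c r(1)] r(2) by simp
      qed
      then show ?thesis by (rule U(2)[rule_format, OF \<pi>CM[OF c] \<pi>CM[OF l(1)] l(2)])
    qed
    show "openin (cm_topology R) {c \<in> topspace (cm_topology R). cm_reduction R x c \<in> U}"
      unfolding openin_cm_topology eq topspace_cm_topology
    proof (intro conjI ballI impI CollectI)
      show "{c \<in> CM R. cm_reduction R x c \<in> U} \<subseteq> CM R" by (rule Collect_restrict)
      fix c l assume c: "c \<in> CM R" and l: "l \<in> CM R" "l \<in> {c \<in> CM R. cm_reduction R x c \<in> U}"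
        and sub: "class_ann R l \<subseteq> class_ann R c"
      show "c \<in> CM R" by (rule c)
      have "cm_reduction R x l \<in> U" using l(2) unfolding mem_Collect_eq by (rule conjunct2)
      then show "cm_reduction R x c \<in> U" by (rule step[OF c l(1) _ sub])
    qed
  qed
qed

end
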